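(* Let $d\ge1$, let $S$ be a finite set, and let $\mu$ be a translation-invariant Markov random field on $S^{\mathbb{Z}^d}$ satisfying high-noise. Then $\mu$ is a finitary factor of a finite-valued i.i.d. process with stretched-exponential tails; that is, there exist a finite set $T$, an i.i.d. process $Y=(Y_v)_{v\in\mathbb{Z}^d}$ taking values in $T$, and a coding $\varphi$ from $Y$ to a random field $X$ with distribution $\mu$ whose coding radius $R$ has stretched-exponential tails.
   Context: **Markov random fields and high-noise.** Vertices $u,v\in\mathbb{Z}^d$ are adjacent if $\|u-v\|_1=1$; $N(v)$ is the set of vertices adjacent to $v$, $\mathbf{0}$ is the origin, and for $V\subset\mathbb{Z}^d$, $\partial V$ is the set of vertices at $\ell_1$-distance 1 from $V$. Let $S$ be finite, let $\mu$ be a probability measure on $S^{\mathbb{Z}^d}$ and let $X=(X_v)_{v\in\mathbb{Z}^d}$ have distribution $\mu$. The measure $\mu$ is a Markov random field if for any finite $V\subset\mathbb{Z}^d$ and any $\xi\in S^V$, $$\mathbb{P}\big(X|_V=\xi\mid X|_{\mathbb{Z}^d\setminus V}\big)=\mathbb{P}\big(X|_V=\xi\mid X|_{\partial V}\big)\quad\text{almost surely}.$$ For a translation-invariant Markov random field $\mu$ and $s\in S$, let $$\gamma_s:=\inf_{\substack{\xi\in S^{N(\mathbf{0})}\\ \mathbb{P}(X|_{N(\mathbf{0})}=\xi)>0}}\mathbb{P}\big(X_{\mathbf{0}}=s\mid X|_{N(\mathbf{0})}=\xi\big).$$ The measure $\mu$ satisfies high-noise if $\gamma:=\sum_{s\in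 S}\gamma_s>1-\frac1{2d}$. **Codings.** Let $(S,\mathcal{S})$, $(T,\mathcal{T})$ be measurable spaces and let $X=(X_v)_{v\in\mathbb{Z}^d}$ and $Y=(Y_v)_{v\in\mathbb{Z}^d}$ be $S$-valued and $T$-valued stationary (translation-invariant in law) random fields. A coding from $Y$ to $X$ is a measurable function $\varphi:T^{\mathbb{Z}^d}\to S^{\mathbb{Z}^d}$ which commutes with every translation of $\mathbb{Z}^d$ and such that $\varphi(Y)$ and $X$ are identical in distribution. The coding radius $R(y)$ of $\varphi$ at $y\in T^{\mathbb{Z}^d}$ is the minimal integer $r\ge0$ such that $\varphi(y')_{\mathbf{0}}=\varphi(y)_{\mathbf{0}}$ for almost all (with respect to the law of $Y$) $y'\in T^{\mathbb{Z}^d}$ which satisfy $y'_v=y_v$ for all $\|v\|_1\le r$, with $R(y)=\infty$ if no such $r$ exists. Write $R=R(Y)$. The coding is finitary if $R$ is almost surely finite. A non-negative random variable $R$ has stretched-exponential tails if there are $C,c>0$ with $\mathbb{P}(R\ge r)\le Ce^{-r^c}$ for all $r\ge0$. A probability measure is said to be a factor of a given type if a random field having that distribution is. *)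

theory Defs
  imports "HOL-Probability.Probability"
begin

type_synonym 'd lattice = "int ^ 'd"

definition norm1 :: "'d::finite lattice \<Rightarrow> int" where
  "norm1 v = (\<Sum>i\<in>UNIV. \<bar>v $ i\<bar>)"

definition adjacent :: "'d::finite lattice \<Rightarrow> 'd lattice \<Rightarrow> bool" where
  "adjacent u v \<longleftrightarrow> norm1 (u - v) = 1"

definition nbhd :: "'d::finite lattice \<Rightarrow> 'd lattice set" where
  "nbhd v = {u. adjacent u v}"

text \<open>The distance from a vertex to a set is the minimum over the set, so the boundary is
  disjoint from the set.\<close>

definition bdry :: "'d::finite lattice set \<Rightarrow> 'd lattice set" where
  "bdry V = {u. (\<exists>v\<in>V. norm1 (u - v) = 1) \<and> (\<forall>v\<in>V. 1 \<le> norm1 (u - v))}"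

text \<open>A measurable space of spins is a value of type \<open>measure\<close> of which only the space and
  the measurable sets matter; a finite set \<open>S\<close> of spins is \<open>count_space S\<close>.
  Random fields are represented by their laws, i.e. by the coordinate process.\<close>

definition config_space :: "'a measure \<Rightarrow> ('d::finite lattice \<Rightarrow> 'a) measure" where
  "config_space S = (\<Pi>\<^sub>M v\<in>UNIV. S)"

definition field_law :: "'a measure \<Rightarrow> ('d::finite lattice \<Rightarrow> 'a) measure \<Rightarrow> bool" where
  "field_law S \<mu> \<longleftrightarrow> prob_space \<mu> \<and> sets \<mu> = sets (config_space S)"

definition shift :: "'d::finite lattice \<Rightarrow> ('d lattice \<Rightarrow> 'a) \<Rightarrow> ('d lattice \<Rightarrow> 'a)" where
  "shift u x = (\<lambda>v. x (v + u))"

definition translation_invariant ::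
    "'a measure \<Rightarrow> ('d::finite lattice \<Rightarrow> 'a) measure \<Rightarrow> bool" where
  "translation_invariant S \<mu> \<longleftrightarrow> (\<forall>u. distr \<mu> (config_space S) (shift u) = \<mu>)"

text \<open>The \<open>\<sigma>\<close>-algebra generated by the restriction of the field to \<open>A\<close>.\<close>

definition restr_algebra ::
    "'a measure \<Rightarrow> 'd::finite lattice set \<Rightarrow> ('d lattice \<Rightarrow> 'a) measure" where
  "restr_algebra S A =
     vimage_algebra (space (config_space S)) (\<lambda>x. restrict x A) (\<Pi>\<^sub>M v\<in>A. S)"

definition markov_random_field ::
    "'a set \<Rightarrow> ('d::finite lattice \<Rightarrow> 'a) measure \<Rightarrow> bool" where
  "markov_random_field S \<mu> \<longleftrightarrow>
     field_law (count_space S) \<mu> \<and>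
     (\<forall>V. finite V \<longrightarrow> (\<forall>\<xi> \<in> V \<rightarrow>\<^sub>E S.
        AE x in \<mu>.
          real_cond_exp \<mu> (restr_algebra (count_space S) (- V))
            (indicator {x \<in> space \<mu>. restrict x V = \<xi>}) x =
          real_cond_exp \<mu> (restr_algebra (count_space S) (bdry V))
            (indicator {x \<in> space \<mu>. restrict x V = \<xi>}) x))"

definition min_cond_prob ::
    "'a set \<Rightarrow> ('d::finite lattice \<Rightarrow> 'a) measure \<Rightarrow> 'a \<Rightarrow> real" where
  "min_cond_prob S \<mu> s =
     (INF \<xi> \<in> {\<xi> \<in> nbhd 0 \<rightarrow>\<^sub>E S. measure \<mu> {x \<in> space \<mu>. restrict x (nbhd 0) = \<xi>} > 0}.
        cond_prob \<mu> (\<lambda>x. x 0 = s) (\<lambda>x. restrict x (nbhd 0) = \<xi>))"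

definition high_noise :: "'a set \<Rightarrow> ('d::finite lattice \<Rightarrow> 'a) measure \<Rightarrow> bool" where
  "high_noise S \<mu> \<longleftrightarrow> (\<Sum>s\<in>S. min_cond_prob S \<mu> s) > 1 - 1 / (2 * real CARD('d))"

definition iid_law :: "'b measure \<Rightarrow> ('d::finite lattice \<Rightarrow> 'b) measure \<Rightarrow> bool" where
  "iid_law T \<nu> \<longleftrightarrow>
     field_law T \<nu> \<and>
     prob_space.indep_vars \<nu> (\<lambda>_. T) (\<lambda>v y. y v) UNIV \<and>
     (\<forall>u v. distr \<nu> T (\<lambda>y. y u) = distr \<nu> T (\<lambda>y. y v))"

definition coding ::
    "'b measure \<Rightarrow> ('d::finite lattice \<Rightarrow> 'b) measure \<Rightarrow> 'a measure \<Rightarrow> ('d lattice \<Rightarrow> 'a) measure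
     \<Rightarrow> (('d lattice \<Rightarrow> 'b) \<Rightarrow> ('d lattice \<Rightarrow> 'a)) \<Rightarrow> bool" where
  "coding T \<nu> S \<mu> \<phi> \<longleftrightarrow>
     field_law T \<nu> \<and> translation_invariant T \<nu> \<and>
     field_law S \<mu> \<and> translation_invariant S \<mu> \<and>
     \<phi> \<in> measurable (config_space T) (config_space S) \<and>
     (\<forall>u. \<forall>y \<in> space (config_space T). \<phi> (shift u y) = shift u (\<phi> y)) \<and>
     distr \<nu> (config_space S) \<phi> = \<mu>"

definition determined_within ::
    "('d::finite lattice \<Rightarrow> 'b) measure \<Rightarrow> (('d lattice \<Rightarrow> 'b) \<Rightarrow> ('d lattice \<Rightarrow> 'a))
     \<Rightarrow> ('d lattice \<Rightarrow> 'b) \<Rightarrow> nat \<Rightarrow> bool" where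
  "determined_within \<nu> \<phi> y r \<longleftrightarrow>
     (AE y' in \<nu>. (\<forall>v. norm1 v \<le> int r \<longrightarrow> y' v = y v) \<longrightarrow> \<phi> y' 0 = \<phi> y 0)"

definition coding_radius ::
    "('d::finite lattice \<Rightarrow> 'b) measure \<Rightarrow> (('d lattice \<Rightarrow> 'b) \<Rightarrow> ('d lattice \<Rightarrow> 'a))
     \<Rightarrow> ('d lattice \<Rightarrow> 'b) \<Rightarrow> enat" where
  "coding_radius \<nu> \<phi> y =
     (if \<exists>r. determined_within \<nu> \<phi> y r
      then enat (LEAST r. determined_within \<nu> \<phi> y r) else \<infinity>)"

definition finitary ::
    "('d::finite lattice \<Rightarrow> 'b) measure \<Rightarrow> (('d lattice \<Rightarrow> 'b) \<Rightarrow> ('d lattice \<Rightarrow> 'a)) \<Rightarrow> bool" where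
  "finitary \<nu> \<phi> \<longleftrightarrow> (AE y in \<nu>. coding_radius \<nu> \<phi> y < \<infinity>)"

text \<open>Measurability is required explicitly because \<open>measure\<close> is \<open>0\<close> on non-measurable sets.\<close>

definition stretched_exponential_tails :: "'w measure \<Rightarrow> ('w \<Rightarrow> ennreal) \<Rightarrow> bool" where
  "stretched_exponential_tails M R \<longleftrightarrow>
     R \<in> borel_measurable M \<and>
     (\<exists>C c :: real. C > 0 \<and> c > 0 \<and>
        (\<forall>r::real. r \<ge> 0 \<longrightarrow>
           measure M {w \<in> space M. R w \<ge> ennreal r} \<le> C * exp (- (r powr c))))"

end

theory Submission
  imports Defs "HOL-Real_Asymp.Real_Asymp"
begin

text \<open>
  The field \<open>\<mu>\<close> is sampled by coupling from the past. Run, from the infinite past up to the present,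
  the following dynamics: at every time each site tosses a coin and is active if its coin shows
  heads and the coins of all its neighbours show tails, and all active sites are resampled from
  their conditional laws given their neighbours. Active sites are never adjacent, so this preserves
  \<open>\<mu>\<close> (\<open>expectation_flow\<close>). A resampling is split in two: with probability \<open>\<gamma>\<close>, the sum
  of the \<open>\<gamma>\<^sub>s\<close>, the new spin is drawn obliviously, without looking at the neighbours, and otherwise
  from a residual law that depends on them (\<open>oblivious_update_exists\<close>). Going backwards in time,
  call a site live if its spin may still influence the present. An active live site dies if its update
  is oblivious and passes liveness to its at most \<open>2d\<close> neighbours otherwise. High noise says that
  \<open>2d (1 - \<gamma>) < 1\<close>, so the density of live sites decays exponentially (\<open>prob_live\<close>); as soon as
  no live site is left near a given site, its present spin is a function of the symbols read so
  far, whatever the initial configuration (\<open>flow_dead\<close>).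

  The updates are numbered backwards, starting with \<open>0\<close> for the last one, and the number of an
  update is called its time.

  This algorithm reads one symbol per site and time, whereas the coding has only finitely many
  symbols per site. The remedy is that at time \<open>n\<close> only the live sites and their neighbours request
  a symbol, and these have exponentially small density. Each site therefore carries symbols of
  its own for the first \<open>n0\<close> times, one spare symbol, and a letter. The letters spell words of a
  prefix-free code along lattice lines, and thereby give each spare symbol at most one label; label \<open>n\<close> has
  density at least of order \<open>n\<close> to the power \<open>-3\<close>, more than the density of requests at time \<open>n\<close>
  once \<open>n \<ge> n0\<close>. At such a time the requests are matched along lines with the spare symbols of label \<open>n\<close>,
  like opening with closing brackets. Which spare symbol a request receives depends on letters
  and on symbols of smaller times only, and no spare symbol is used twice. Hence the field of symbols
  as read through the matching is again an independent field (\<open>readout_preserves\<close>), and the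
  output of the algorithm still has law \<open>\<mu>\<close> exactly.

  It remains to see how far the algorithm looks. In the independent field, whether a site requests
  a symbol at time \<open>n\<close> depends on the symbols within distance of order \<open>n\<close>, so
  Hoeffding's inequality applies along residue classes of a line (\<open>prob_no_hit\<close>): except on an
  event whose probability is exponentially small in \<open>N\<close>, nothing near the origin is live at time \<open>N\<close>, and all
  matchings at earlier times bridge a distance that is polynomial in \<open>N\<close> (\<open>prob_not_good\<close>). Outside this event
  the symbols within a radius of order \<open>N\<close> to the power 9 determine the spin at the origin
  (\<open>cftp_local\<close>), which gives stretched-exponential tails with exponent \<open>1 / 10\<close>.
\<close>

section \<open>Product measures of discrete laws\<close>

definition depends_on :: "'i set \<Rightarrow> (('i \<Rightarrow> 'b) \<Rightarrow> 'c) \<Rightarrow> bool" where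
  "depends_on J f \<longleftrightarrow> (\<forall>\<omega> \<omega>'. (\<forall>i\<in>J. \<omega> i = \<omega>' i) \<longrightarrow> f \<omega> = f \<omega>')"

lemma depends_onI: "(\<And>\<omega> \<omega>'. (\<And>i. i \<in> J \<Longrightarrow> \<omega> i = \<omega>' i) \<Longrightarrow> f \<omega> = f \<omega>') \<Longrightarrow> depends_on J f"
  unfolding depends_on_def by blast

lemma depends_onD: "depends_on J f \<Longrightarrow> (\<And>i. i \<in> J \<Longrightarrow> \<omega> i = \<omega>' i) \<Longrightarrow> f \<omega> = f \<omega>'"
  unfolding depends_on_def by blast

lemma depends_on_comp: "depends_on J f \<Longrightarrow> depends_on J (\<lambda>\<omega>. h (f \<omega>))"
  unfolding depends_on_def by metis

text \<open>A finite product of countable discrete spaces is discrete, so a function of finitely many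
  discrete coordinates is measurable whatever it is. All measurability below that is not a
  countable combination of such functions is reduced to this.\<close>
lemma measurable_depends_on:
  fixes f :: "('i \<Rightarrow> 'b::countable) \<Rightarrow> 'c"
  assumes J: "finite J" and f: "depends_on J f"
    and W: "\<And>i. i \<in> J \<Longrightarrow> (\<lambda>\<omega>. W \<omega> i) \<in> measurable M (count_space UNIV)"
  shows "(\<lambda>\<omega>. f (W \<omega>)) \<in> measurable M (count_space UNIV)"
proof -
  have "(\<lambda>\<omega>. \<lambda>i\<in>J. W \<omega> i) \<in> measurable M (PiM J (\<lambda>_. count_space UNIV))"
    by (rule measurable_restrict) (use W in auto)
  also have "PiM J (\<lambda>_. count_space UNIV) = count_space (PiE J (\<lambda>_. UNIV :: 'b set))"
    by (rule count_space_PiM_finite) (use J in auto)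
  finally have 1: "(\<lambda>\<omega>. \<lambda>i\<in>J. W \<omega> i) \<in> measurable M (count_space (PiE J (\<lambda>_. UNIV)))" .
  have 2: "f \<in> measurable (count_space (PiE J (\<lambda>_. UNIV))) (count_space UNIV)"
    by simp
  have "f (W \<omega>) = f (\<lambda>i\<in>J. W \<omega> i)" for \<omega>
    by (rule depends_onD[OF f]) auto
  with measurable_compose[OF 1 2] show ?thesis by simp
qed

locale discrete_product =
  fixes p :: "'i \<Rightarrow> 'b::countable pmf"
begin

definition Om :: "('i \<Rightarrow> 'b) measure" where
  "Om = PiM UNIV (\<lambda>i. measure_pmf (p i))"

sublocale prob_space Om
  unfolding Om_def by (intro prob_space_PiM measure_pmf.prob_space_axioms)

lemma space_Om [simp]: "space Om = UNIV"
  by (simp add: Om_def space_PiM PiE_UNIV_domain)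

lemma sets_Om: "sets Om = sets (PiM UNIV (\<lambda>_. count_space UNIV))"
  unfolding Om_def by (rule sets_PiM_cong) auto

lemma measurable_coord [measurable]: "(\<lambda>\<omega>. \<omega> i) \<in> measurable Om (count_space UNIV)"
  unfolding measurable_cong_sets[OF sets_Om refl]
  by (rule measurable_component_singleton) simp

lemma measurable_local:
  assumes "finite J" "depends_on J f"
  shows "f \<in> measurable Om (count_space UNIV)"
  using measurable_depends_on[OF assms, where W="\<lambda>x. x" and M=Om] by simp

lemma event_of_pred: "Measurable.pred Om P \<Longrightarrow> {\<omega>. P \<omega>} \<in> sets Om"
  by (simp add: pred_def)

lemma measurable_into_Om:
  assumes "\<And>i. (\<lambda>\<omega>. W \<omega> i) \<in> measurable M (count_space UNIV)"
  shows "W \<in> measurable M Om"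
proof -
  have "(\<lambda>\<omega>. \<lambda>i\<in>UNIV. W \<omega> i) \<in> measurable M (PiM UNIV (\<lambda>_. count_space UNIV))"
    by (rule measurable_restrict) (use assms in auto)
  then show ?thesis
    unfolding measurable_cong_sets[OF refl sets_Om] by (simp add: restrict_def)
qed

lemma indep_coords: "indep_vars (\<lambda>i. measure_pmf (p i)) (\<lambda>i \<omega>. \<omega> i) UNIV"
proof -
  have m: "(\<lambda>\<omega>. \<omega> i) \<in> measurable Om (measure_pmf (p i))" for i
    using measurable_coord by simp
  have "distr Om (measure_pmf (p i)) (\<lambda>\<omega>. \<omega> i) = measure_pmf (p i)" for i
    unfolding Om_def
    by (rule distr_PiM_component) (auto intro: measure_pmf.prob_space_axioms)
  then have "distr Om (PiM UNIV (\<lambda>i. measure_pmf (p i))) (\<lambda>x. \<lambda>i\<in>UNIV. x i) =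
      PiM UNIV (\<lambda>i. distr Om (measure_pmf (p i)) (\<lambda>\<omega>. \<omega> i))"
    by (simp add: distr_id2 Om_def restrict_def)
  then show ?thesis
    by (subst indep_vars_iff_distr_eq_PiM') (use m in auto)
qed

text \<open>Locality is stated pointwise by \<^const>\<open>depends_on\<close>; this converts it into stochastic
  independence. Such a function factors through the restriction to its coordinates, extended
  by an arbitrary value.\<close>
lemma indep_vars_depends:
  assumes disj: "disjoint_family_on J L"
    and dep: "\<And>j. j \<in> L \<Longrightarrow> depends_on (J j) (f j)"
    and meas: "\<And>j. j \<in> L \<Longrightarrow> f j \<in> measurable Om (N j)"
  shows "indep_vars N f L"
proof -
  let ?P = "\<lambda>j. PiM (J j) (\<lambda>i. measure_pmf (p i))"
  define ext where "ext j r = (\<lambda>i. if i \<in> J j then r i else undefined)" for j and r :: "'i \<Rightarrow> 'b"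
  have 1: "indep_vars ?P (\<lambda>j \<omega>. restrict (\<lambda>i. \<omega> i) (J j)) L"
    by (rule indep_vars_restrict[OF indep_coords _ disj]) auto
  have 2: "(\<lambda>r. f j (ext j r)) \<in> measurable (?P j) (N j)" if "j \<in> L" for j
  proof (rule measurable_compose[OF _ meas[OF that]], rule measurable_into_Om)
    fix i show "(\<lambda>\<omega>. ext j \<omega> i) \<in> measurable (?P j) (count_space UNIV)"
    proof (cases "i \<in> J j")
      case True
      have "(\<lambda>\<omega>. \<omega> i) \<in> measurable (?P j) (measure_pmf (p i))"
        by (rule measurable_component_singleton[OF True])
      then show ?thesis using True by (simp add: ext_def)
    qed (simp add: ext_def)
  qed
  have "indep_vars N (\<lambda>j \<omega>. f j (ext j (restrict (\<lambda>i. \<omega> i) (J j)))) L"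
    by (rule indep_vars_compose2[OF 1 2])
  moreover have "f j (ext j (restrict (\<lambda>i. \<omega> i) (J j))) = f j \<omega>" if "j \<in> L" for j \<omega>
    by (rule depends_onD[OF dep[OF that]]) (auto simp: ext_def)
  ultimately show ?thesis
    by (subst indep_vars_cong[OF refl _ refl, where Y="\<lambda>j \<omega>. f j (ext j (restrict (\<lambda>i. \<omega> i) (J j)))"])
      (auto simp: fun_eq_iff)
qed

lemma prob_conj_depends:
  assumes "depends_on J P" "depends_on K Q" "J \<inter> K = {}"
    and P: "Measurable.pred Om P" and Q: "Measurable.pred Om Q"
  shows "prob {\<omega>. P \<omega> \<and> Q \<omega>} = prob {\<omega>. P \<omega>} * prob {\<omega>. Q \<omega>}"
proof -
  have "indep_vars (\<lambda>_. count_space UNIV) (case_bool P Q) UNIV"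
    by (rule indep_vars_depends[where J="case_bool J K"])
      (use assms in \<open>auto simp: disjoint_family_on_def split: bool.splits\<close>)
  then have "indep_var (count_space UNIV) P (count_space UNIV) Q"
    unfolding indep_var_def
    by (rule back_subst[where P="\<lambda>M. indep_vars M _ _"]) (auto split: bool.split)
  from indep_varD[OF this, of "{True}" "{True}"] show ?thesis
    by (simp add: vimage_def)
qed

lemma borel_local:
  fixes f :: "('i \<Rightarrow> 'b) \<Rightarrow> real"
  assumes "finite J" "depends_on J f"
  shows "f \<in> borel_measurable Om"
  by (rule measurable_compose[OF measurable_local[OF assms]]) simp

lemma expectation_mult_depends:
  fixes f g :: "('i \<Rightarrow> 'b) \<Rightarrow> real"
  assumes "depends_on J f" "depends_on K g" "J \<inter> K = {}" "integrable Om f" "integrable Om g"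
  shows "expectation (\<lambda>\<omega>. f \<omega> * g \<omega>) = expectation f * expectation g"
proof -
  have "indep_vars (\<lambda>_. borel) (case_bool f g) UNIV"
    by (rule indep_vars_depends[where J="case_bool J K"])
      (use assms in \<open>auto simp: disjoint_family_on_def split: bool.splits\<close>)
  then have "indep_var borel f borel g"
    unfolding indep_var_def
    by (rule back_subst[where P="\<lambda>M. indep_vars M _ _"]) (auto split: bool.split)
  then show ?thesis by (rule indep_var_lebesgue_integral) (use assms in auto)
qed

lemma prob_coord:
  "prob {\<omega>. \<omega> i \<in> X} = measure (measure_pmf (p i)) X"
proof -
  have "distr Om (measure_pmf (p i)) (\<lambda>\<omega>. \<omega> i) = measure_pmf (p i)"
    unfolding Om_def
    by (rule distr_PiM_component) (auto intro: measure_pmf.prob_space_axioms)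
  then have "measure (measure_pmf (p i)) X = measure (distr Om (measure_pmf (p i)) (\<lambda>\<omega>. \<omega> i)) X"
    by simp
  also have "\<dots> = prob {\<omega>. \<omega> i \<in> X}"
    by (subst measure_distr) (auto simp: vimage_def)
  finally show ?thesis ..
qed

lemma pred_coords: 
  assumes "finite F" shows "Measurable.pred Om (\<lambda>\<omega>. \<forall>i\<in>F. \<omega> i \<in> X i)"
  by (rule measurable_local[OF assms]) (auto simp: depends_on_def)

lemma prob_coords:
  assumes "finite F"
  shows "prob {\<omega>. \<forall>i\<in>F. \<omega> i \<in> X i} = (\<Prod>i\<in>F. measure (measure_pmf (p i)) (X i))"
  using assms
proof (induction F)
  case empty
  then show ?case using prob_space by simp
next
  case (insert i F)
  have "prob {\<omega>. \<omega> i \<in> X i \<and> (\<forall>i\<in>F. \<omega> i \<in> X i)} =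
      prob {\<omega>. \<omega> i \<in> X i} * prob {\<omega>. \<forall>i\<in>F. \<omega> i \<in> X i}"
    by (rule prob_conj_depends[where J="{i}" and K=F])
      (use insert pred_coords[of "{i}" X] pred_coords[of F X] in \<open>auto simp: depends_on_def\<close>)
  then show ?case using insert prob_coord by simp
qed

text \<open>Cylinders with arbitrary sides are needed here, not only single points, because they are the
  generator to which the uniqueness theorem for product measures applies.\<close>
lemma measure_preservingI:
  assumes T: "\<And>i. (\<lambda>\<omega>. T \<omega> i) \<in> measurable Om (count_space UNIV)"
    and eq: "\<And>F X. finite F \<Longrightarrow>
      prob {\<omega>. \<forall>i\<in>F. T \<omega> i \<in> X i} = (\<Prod>i\<in>F. measure (measure_pmf (p i)) (X i))"
  shows "distr Om Om T = Om"
proof -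
  have TM: "T \<in> measurable Om Om" by (rule measurable_into_Om[OF T])
  have "distr Om Om T = PiM UNIV (\<lambda>i. measure_pmf (p i))"
  proof (rule measure_eqI_PiM_infinite)
    show "sets (distr Om Om T) = sets (PiM UNIV (\<lambda>i. measure_pmf (p i)))" by (simp add: Om_def)
    show "sets (PiM UNIV (\<lambda>i. measure_pmf (p i))) = sets (PiM UNIV (\<lambda>i. measure_pmf (p i)))" ..
    show "finite_measure (distr Om Om T)"
      using prob_space_distr[OF TM] by (simp add: prob_space.axioms)
    fix A and J :: "'i set" assume J: "finite J"
    let ?E = "prod_emb UNIV (\<lambda>i. measure_pmf (p i)) J (PiE J A)"
    have E: "?E = {\<omega>. \<forall>i\<in>J. \<omega> i \<in> A i}"
      by (auto simp: prod_emb_def space_PiM restrict_def PiE_iff extensional_def)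
    have Es: "?E \<in> sets Om"
      unfolding Om_def using J by (intro sets_PiM_I) auto
    have "emeasure (distr Om Om T) ?E = emeasure Om {\<omega>. \<forall>i\<in>J. T \<omega> i \<in> A i}"
      by (subst emeasure_distr[OF TM Es]) (simp add: E vimage_def)
    also have "\<dots> = emeasure Om {\<omega>. \<forall>i\<in>J. \<omega> i \<in> A i}"
      by (simp add: emeasure_eq_measure eq[OF J] prob_coords[OF J])
    also have "\<dots> = emeasure (PiM UNIV (\<lambda>i. measure_pmf (p i))) ?E"
      by (simp add: E Om_def)
    finally show "emeasure (distr Om Om T) ?E = emeasure (PiM UNIV (\<lambda>i. measure_pmf (p i))) ?E" .
  qed
  then show ?thesis by (simp add: Om_def)
qed

end

section \<open>Lattice geometry\<close>

lemma norm1_nonneg [simp]: "0 \<le> norm1 v"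
  unfolding norm1_def by (simp add: sum_nonneg)

lemma norm1_zero [simp]: "norm1 0 = 0"
  unfolding norm1_def by simp

lemma norm1_minus [simp]: "norm1 (- v) = norm1 v"
  unfolding norm1_def by simp

lemma norm1_triangle: "norm1 (u + v) \<le> norm1 u + norm1 v"
  unfolding norm1_def sum.distrib[symmetric] by (rule sum_mono) (simp add: abs_triangle_ineq)

lemma norm1_eq_0: "norm1 v = 0 \<longleftrightarrow> v = 0"
  unfolding norm1_def by (subst sum_nonneg_eq_0_iff) (auto simp: vec_eq_iff)

abbreviation nb0 :: "'d::finite lattice set" where "nb0 \<equiv> nbhd 0"

lemma nb0_iff: "z \<in> nb0 \<longleftrightarrow> norm1 z = 1"
  by (simp add: nbhd_def adjacent_def)

lemma nb0_uminus: "- z \<in> nb0 \<longleftrightarrow> z \<in> nb0"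
  by (simp add: nb0_iff)

lemma nb0_sub: "nb0 \<subseteq> (\<lambda>i. axis i 1) ` UNIV \<union> (\<lambda>i. axis i (- 1)) ` (UNIV :: 'd::finite set)"
proof
  fix z :: "'d lattice" assume "z \<in> nb0"
  then have s: "(\<Sum>i\<in>UNIV. \<bar>z $ i\<bar>) = 1" by (simp add: nb0_iff norm1_def)
  then obtain i where i: "z $ i \<noteq> 0"
    by (cases "\<forall>i. z $ i = 0") auto
  have "\<bar>z $ i\<bar> + (\<Sum>j\<in>UNIV - {i}. \<bar>z $ j\<bar>) = 1"
    using s by (simp add: sum.remove[of UNIV i])
  moreover have "0 \<le> (\<Sum>j\<in>UNIV - {i}. \<bar>z $ j\<bar>)" by (simp add: sum_nonneg)
  ultimately have zi: "\<bar>z $ i\<bar> = 1" and r: "(\<Sum>j\<in>UNIV - {i}. \<bar>z $ j\<bar>) = 0"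
    using i by linarith+
  from r have "z $ j = 0" if "j \<noteq> i" for j
    using that by (subst (asm) sum_nonneg_eq_0_iff) auto
  then have "z = axis i (z $ i)" by (simp add: vec_eq_iff axis_def)
  moreover from zi have "z $ i = 1 \<or> z $ i = - 1" by linarith
  ultimately show "z \<in> (\<lambda>i. axis i 1) ` UNIV \<union> (\<lambda>i. axis i (- 1)) ` UNIV"
    by (metis UNIV_I UnI1 UnI2 image_eqI)
qed

lemma finite_nb0 [simp, intro]: "finite (nb0 :: 'd::finite lattice set)"
  by (rule finite_subset[OF nb0_sub]) auto

lemma card_nb0: "card (nb0 :: 'd::finite lattice set) \<le> 2 * CARD('d)"
proof -
  have "card (nb0 :: 'd lattice set) \<le>
      card ((\<lambda>i. axis i 1) ` UNIV \<union> (\<lambda>i. axis i (- 1)) ` (UNIV :: 'd set) :: 'd lattice set)"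
    by (rule card_mono[OF _ nb0_sub]) auto
  also have "\<dots> \<le> card ((\<lambda>i. axis i 1) ` (UNIV :: 'd set) :: 'd lattice set) +
      card ((\<lambda>i. axis i (- 1)) ` (UNIV :: 'd set) :: 'd lattice set)"
    by (rule card_Un_le)
  also have "\<dots> \<le> CARD('d) + CARD('d)"
    by (intro add_mono card_image_le) auto
  finally show ?thesis by simp
qed

lemma nbhd_eq: "nbhd v = (\<lambda>z. v + z) ` nb0"
proof -
  have "u \<in> (\<lambda>z. v + z) ` nb0 \<longleftrightarrow> u - v \<in> nb0" for u
    by (auto intro: image_eqI[where x="u - v"])
  then show ?thesis by (auto simp: nb0_iff nbhd_def adjacent_def)
qed

definition ball1 :: "'d::finite lattice \<Rightarrow> nat \<Rightarrow> 'd lattice set" where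
  "ball1 u r = {v. norm1 (v - u) \<le> int r}"

lemma ball1_center [simp]: "u \<in> ball1 u r"
  by (simp add: ball1_def)

lemma ball1_mono: "r \<le> s \<Longrightarrow> ball1 u r \<subseteq> ball1 u s"
  by (auto simp: ball1_def)

lemma ball1_trans: "v \<in> ball1 u r \<Longrightarrow> w \<in> ball1 v s \<Longrightarrow> r + s \<le> t \<Longrightarrow> w \<in> ball1 u t"
  using norm1_triangle[of "w - v" "v - u"] by (simp add: ball1_def)

lemma ball1_nb: "z \<in> nb0 \<Longrightarrow> v + z \<in> ball1 v 1"
  by (simp add: ball1_def nb0_iff)

lemma
  shows finite_ball1 [simp, intro]: "finite (ball1 u r :: 'd::finite lattice set)"
    and card_ball1: "card (ball1 u r :: 'd::finite lattice set) \<le> (2 * r + 1) ^ CARD('d)"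
proof -
  let ?B = "PiE UNIV (\<lambda>i::'d. {u $ i - int r .. u $ i + int r})"
  have inj: "inj_on vec_nth (ball1 u r :: 'd lattice set)"
    by (auto simp: inj_on_def vec_nth_inject)
  have sub: "vec_nth ` (ball1 u r :: 'd lattice set) \<subseteq> ?B"
  proof (rule image_subsetI, rule PiE_I)
    fix v :: "'d lattice" and i assume "v \<in> ball1 u r"
    then have "(\<Sum>i\<in>UNIV. \<bar>v $ i - u $ i\<bar>) \<le> int r" by (simp add: ball1_def norm1_def)
    moreover have "\<bar>v $ i - u $ i\<bar> \<le> (\<Sum>i\<in>UNIV. \<bar>v $ i - u $ i\<bar>)"
      by (rule member_le_sum) auto
    ultimately have "\<bar>v $ i - u $ i\<bar> \<le> int r" by linarith
    then show "v $ i \<in> {u $ i - int r .. u $ i + int r}" by auto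
  qed simp
  have fB: "finite ?B" by (rule finite_PiE) auto
  show "finite (ball1 u r :: 'd lattice set)"
    using finite_imageD[OF finite_subset[OF sub fB] inj] .
  have "card (ball1 u r :: 'd lattice set) = card (vec_nth ` (ball1 u r :: 'd lattice set))"
    by (simp add: card_image[OF inj])
  also have "\<dots> \<le> card ?B" by (rule card_mono[OF fB sub])
  also have "\<dots> = (2 * r + 1) ^ CARD('d)"
    by (simp add: card_PiE nat_add_distrib nat_mult_distrib)
  finally show "card (ball1 u r :: 'd lattice set) \<le> (2 * r + 1) ^ CARD('d)" .
qed

text \<open>The axis is an arbitrary but fixed one.\<close>
definition along :: "'d::finite lattice \<Rightarrow> nat \<Rightarrow> 'd lattice" where
  "along v j = v + axis undefined (int j)"

lemma along_0 [simp]: "along v 0 = v"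
  by (simp add: along_def axis_def vec_eq_iff)

lemma along_along: "along (along v i) j = along v (i + j)"
  by (simp add: along_def axis_def vec_eq_iff)

lemma along_add: "along v j + u = along (v + u) j"
  by (simp add: along_def algebra_simps)

lemma norm1_along:
  fixes v :: "'d::finite lattice"
  shows "norm1 (along v i - along v j) = \<bar>int i - int j\<bar>"
proof -
  have "norm1 (along v i - along v j) = (\<Sum>k\<in>(UNIV::'d set). if k = undefined then \<bar>int i - int j\<bar> else 0)"
    unfolding norm1_def by (rule sum.cong) (auto simp: along_def axis_def)
  then show ?thesis by simp
qed

lemma along_inj [simp]: "along v i = along v j \<longleftrightarrow> i = j"
  using norm1_along[of v i j] norm1_eq_0[of "along v i - along v j"] by auto

lemma along_ball1: "along v j \<in> ball1 v j"
  using norm1_along[of v j 0] by (simp add: ball1_def)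

lemma along_ball1_trans: "v \<in> ball1 u r \<Longrightarrow> r + j \<le> t \<Longrightarrow> along v j \<in> ball1 u t"
  using ball1_trans[OF _ along_ball1] by blast

lemma along_balls_disjoint:
  assumes "2 * r < i - j"
  shows "ball1 (along v i) r \<inter> ball1 (along v j) r = {}"
proof (rule ccontr)
  assume "\<not> ?thesis"
  then obtain w where w: "norm1 (w - along v i) \<le> int r" "norm1 (w - along v j) \<le> int r"
    by (auto simp: ball1_def)
  have "norm1 (along v i - along v j) \<le> norm1 (-(w - along v i)) + norm1 (w - along v j)"
    using norm1_triangle[of "-(w - along v i)" "w - along v j"] by simp
  then have "\<bar>int i - int j\<bar> \<le> 2 * int r"
    using w unfolding norm1_minus norm1_along by linarith
  with assms show False by linarith
qed

section \<open>Coupling from the past\<close>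

type_synonym 'd field = "'d lattice \<times> nat \<Rightarrow> bool \<times> nat"

definition translate :: "'d::finite lattice \<Rightarrow> 'd field \<Rightarrow> 'd field" where
  "translate a w = (\<lambda>(v, k). w (v + a, k))"

lemma translate_apply [simp]: "translate a w (v, k) = w (v + a, k)"
  by (simp add: translate_def)

text \<open>Layer \<open>0\<close> of a field holds the letters, layer \<open>n + 1\<close> the symbols of time \<open>n\<close>. The letters from
  \<open>v\<close> onwards spell the binary digits of \<open>n\<close>, lowest first and without leading zeros, followed by the terminal
  letter \<open>2\<close>. A word has about \<open>log\<^sub>2 n\<close> letters, so a given label has polynomially small density.\<close>
fun label :: "nat \<Rightarrow> 'd::finite field \<Rightarrow> 'd lattice \<Rightarrow> bool" where
  "label n w v \<longleftrightarrow> (if n = 0 then snd (w (v, 0)) = 2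
     else snd (w (v, 0)) = n mod 2 \<and> label (n div 2) w (along v 1))"

declare label.simps [simp del]

text \<open>Prefix-freeness of the code: every word ends at its first letter \<open>2\<close>.\<close>
lemma label_unique: "label n w v \<Longrightarrow> label m w v \<Longrightarrow> n = m"
proof (induction n arbitrary: m v rule: less_induct)
  case (less n)
  show ?case
  proof (cases "n = 0 \<or> m = 0")
    case True
    then show ?thesis using less.prems
      by (auto simp: label.simps[of n] label.simps[of m] split: if_splits)
  next
    case False
    then have "n mod 2 = m mod 2" "label (n div 2) w (along v 1)" "label (m div 2) w (along v 1)"
      using less.prems by (auto simp: label.simps[of n] label.simps[of m] split: if_splits)
    then show ?thesis using less.IH[of "n div 2" "along v 1" "m div 2"] False
      by (metis bot_nat_0.not_eq_extremum div_less_dividend div_mult_mod_eq one_less_numeral_iff semiring_norm(76))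
  qed
qed

lemma label_cong:
  "(\<And>i. i \<le> n \<Longrightarrow> w (along v i, 0) = w' (along v i, 0)) \<Longrightarrow> label n w v = label n w' v"
proof (induction n arbitrary: v rule: less_induct)
  case (less n)
  have 0: "w (v, 0) = w' (v, 0)" using less.prems[of 0] by simp
  show ?case
  proof (cases "n = 0")
    case False
    have "label (n div 2) w (along v 1) = label (n div 2) w' (along v 1)"
    proof (rule less.IH)
      show "n div 2 < n" using False by simp
      fix i assume "i \<le> n div 2"
      then show "w (along (along v 1) i, 0) = w' (along (along v 1) i, 0)"
        using less.prems[of "Suc i"] False by (simp add: along_along)
    qed
    then show ?thesis using False 0 by (simp add: label.simps[of n])
  qed (simp add: label.simps 0)
qed

lemma label_translate: "label n (translate a w) v = label n w (v + a)"
  by (induction n arbitrary: v rule: less_induct)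
    (simp add: label.simps[of _ "translate a w"] label.simps[of _ w] along_add)

text \<open>The first component of a symbol is the coin, the second one encodes the update.\<close>
definition act :: "nat \<Rightarrow> 'd::finite field \<Rightarrow> 'd lattice \<Rightarrow> bool" where
  "act n w v \<longleftrightarrow> fst (w (v, Suc n)) \<and> (\<forall>z\<in>nb0. \<not> fst (w (v + z, Suc n)))"

lemma act_cong:
  assumes "\<And>u. u \<in> ball1 v 1 \<Longrightarrow> w (u, Suc n) = w' (u, Suc n)"
  shows "act n w v = act n w' v"
  using assms[of v] assms[OF ball1_nb] by (simp add: act_def)

lemma act_translate: "act n (translate a w) v = act n w (v + a)"
  by (simp add: act_def algebra_simps)

text \<open>An update is a map from the spins around a site, indexed by the neighbours of the origin, to a
  spin. The oblivious updates are constant maps; they are what stops the search for the past.\<close>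
locale noisy_dynamics =
  fixes upd :: "nat \<Rightarrow> ('d::finite lattice \<Rightarrow> 'a) \<Rightarrow> 'a"
    and obl :: "nat \<Rightarrow> bool"
    and S :: "'a set" and s0 :: 'a
  assumes obl: "obl k \<Longrightarrow> upd k \<xi> = upd k \<xi>'"
    and upd_in: "upd k \<xi> \<in> S"
    and s0_in: "s0 \<in> S"
begin

text \<open>A site is live at time \<open>n\<close> if following the last \<open>n\<close> updates backwards from some site at present may
  lead to it. Starting from all sites at once makes the notion translation-invariant, and the
  search from a single site \<open>u\<close> is covered because it stays within distance \<open>n\<close> of \<open>u\<close>.\<close>
primrec live :: "nat \<Rightarrow> 'd field \<Rightarrow> 'd lattice \<Rightarrow> bool" where
  "live 0 w v = True"
| "live (Suc n) w v \<longleftrightarrow> live n w v \<and> \<not> act n w v \<or>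
     (\<exists>z\<in>nb0. live n w (v + z) \<and> act n w (v + z) \<and> \<not> obl (snd (w (v + z, Suc n))))"

text \<open>Whether a live site is active depends on the coins of its neighbours, so they need a symbol, too.\<close>
definition req :: "nat \<Rightarrow> 'd field \<Rightarrow> 'd lattice \<Rightarrow> bool" where
  "req n w v \<longleftrightarrow> live n w v \<or> (\<exists>z\<in>nb0. live n w (v + z))"

lemma live_imp_req: "live n w v \<Longrightarrow> u \<in> ball1 v 1 \<Longrightarrow> req n w u"
proof -
  assume l: "live n w v" and "u \<in> ball1 v 1"
  then have "norm1 (v - u) = 0 \<or> norm1 (v - u) = 1"
    using norm1_minus[of "u - v"] norm1_nonneg[of "u - v"]
    by (simp add: ball1_def del: norm1_minus norm1_nonneg) linarith
  then consider "u = v" | "v - u \<in> nb0" "v = u + (v - u)"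
    by (auto simp: norm1_eq_0 nb0_iff)
  then show ?thesis
    by cases (use l in \<open>auto simp: req_def intro!: bexI[of _ "v - u"]\<close>)
qed

text \<open>Liveness at time \<open>n + 1\<close> reads the symbols of time \<open>n\<close> at requested sites only. This is what
  makes it harmless that the other sites receive a meaningless symbol.\<close>
lemma live_Suc_cong:
  assumes l: "\<And>u. u \<in> ball1 v 1 \<Longrightarrow> live n w u = live n w' u"
    and s: "\<And>u. u \<in> ball1 v 2 \<Longrightarrow> req n w u \<Longrightarrow> w (u, Suc n) = w' (u, Suc n)"
  shows "live (Suc n) w v = live (Suc n) w' v"
proof -
  have a: "act n w u = act n w' u \<and> w (u, Suc n) = w' (u, Suc n)"
    if "u \<in> ball1 v 1" "live n w u" for u
  proof
    have *: "w (t, Suc n) = w' (t, Suc n)" if "t \<in> ball1 u 1" for t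
      using s[of t] live_imp_req[OF \<open>live n w u\<close> that] ball1_trans[OF \<open>u \<in> ball1 v 1\<close> that, of 2]
      by simp
    then show "act n w u = act n w' u" by (rule act_cong)
    show "w (u, Suc n) = w' (u, Suc n)" by (rule *) simp
  qed
  have b: "(live n w u \<and> \<not> act n w u) = (live n w' u \<and> \<not> act n w' u)" if "u \<in> ball1 v 1" for u
    using l[OF that] a[OF that] by auto
  have c: "(live n w u \<and> act n w u \<and> \<not> obl (snd (w (u, Suc n)))) =
      (live n w' u \<and> act n w' u \<and> \<not> obl (snd (w' (u, Suc n))))" if "u \<in> ball1 v 1" for u
    using l[OF that] a[OF that] by auto
  have "(\<exists>z\<in>nb0. live n w (v + z) \<and> act n w (v + z) \<and> \<not> obl (snd (w (v + z, Suc n)))) =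
      (\<exists>z\<in>nb0. live n w' (v + z) \<and> act n w' (v + z) \<and> \<not> obl (snd (w' (v + z, Suc n))))"
    by (rule bex_cong[OF refl]) (rule c[OF ball1_nb])
  then show ?thesis using b[of v] by simp
qed

lemma req_cong:
  assumes "\<And>u. u \<in> ball1 v 1 \<Longrightarrow> live n w u = live n w' u"
  shows "req n w v = req n w' v"
  unfolding req_def using assms[of v] assms[OF ball1_nb] by simp

lemma live_cong:
  "(\<And>u k. u \<in> ball1 v (Suc n) \<Longrightarrow> 1 \<le> k \<Longrightarrow> k \<le> n \<Longrightarrow> w (u, k) = w' (u, k)) \<Longrightarrow>
    live n w v = live n w' v"
proof (induction n arbitrary: v)
  case (Suc n)
  show ?case
  proof (rule live_Suc_cong)
    fix u assume u: "u \<in> ball1 v 1"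
    show "live n w u = live n w' u"
      by (rule Suc.IH, rule Suc.prems) (use ball1_trans[OF u] in auto)
  next
    fix u assume "u \<in> ball1 v 2"
    then have "u \<in> ball1 v (Suc (Suc n))" using ball1_mono[of 2 "Suc (Suc n)" v] by auto
    then show "w (u, Suc n) = w' (u, Suc n)" by (rule Suc.prems) auto
  qed
qed simp

lemma req_cong':
  assumes "\<And>u k. u \<in> ball1 v (Suc (Suc n)) \<Longrightarrow> 1 \<le> k \<Longrightarrow> k \<le> n \<Longrightarrow> w (u, k) = w' (u, k)"
  shows "req n w v = req n w' v"
  by (rule req_cong, rule live_cong, rule assms) (auto elim: ball1_trans)

lemma live_translate: "live n (translate a w) v = live n w (v + a)"
  by (induction n arbitrary: v) (simp_all add: act_translate algebra_simps)

lemma req_translate: "req n (translate a w) v = req n w (v + a)"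
  by (simp add: req_def live_translate algebra_simps)

definition step :: "nat \<Rightarrow> 'd field \<Rightarrow> ('d lattice \<Rightarrow> 'a) \<Rightarrow> 'd lattice \<Rightarrow> 'a" where
  "step n w x v = (if act n w v then upd (snd (w (v, Suc n))) (\<lambda>z\<in>nb0. x (v + z)) else x v)"

text \<open>The symbols of time \<open>n\<close> are applied before those of time \<open>n - 1\<close>: \<open>flow n w x\<close> is the
  present state when the last \<open>n\<close> updates are applied to \<open>x\<close>.\<close>
primrec flow :: "nat \<Rightarrow> 'd field \<Rightarrow> ('d lattice \<Rightarrow> 'a) \<Rightarrow> 'd lattice \<Rightarrow> 'a" where
  "flow 0 w x = x"
| "flow (Suc n) w x = flow n w (step n w x)"

lemma flow_in: "(\<And>v. x v \<in> S) \<Longrightarrow> flow n w x v \<in> S"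
  by (induction n arbitrary: x) (auto simp: step_def upd_in)

lemma step_live:
  assumes x: "\<And>u. u \<in> ball1 v 1 \<Longrightarrow> live (Suc n) w u \<Longrightarrow> x u = x' u"
    and v: "live n w v"
  shows "step n w x v = step n w x' v"
proof (cases "act n w v")
  case True
  show ?thesis
  proof (cases "obl (snd (w (v, Suc n)))")
    case True
    then show ?thesis using \<open>act n w v\<close> obl by (auto simp: step_def)
  next
    case False
    have "x (v + z) = x' (v + z)" if z: "z \<in> nb0" for z
    proof (rule x[OF ball1_nb[OF z]])
      have "- z \<in> nb0" "v + z + - z = v" using z by (auto simp: nb0_uminus)
      then show "live (Suc n) w (v + z)"
        using v True False by (metis live.simps(2))
    qed
    then have "(\<lambda>z\<in>nb0. x (v + z)) = (\<lambda>z\<in>nb0. x' (v + z))" by (simp add: restrict_def fun_eq_iff)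
    then show ?thesis by (simp add: step_def x v True)
  qed
next
  case False
  then show ?thesis using x[of v] v by (simp add: step_def)
qed

text \<open>The purpose of \<open>live\<close>: the state at \<open>u\<close> depends on the initial configuration only through the live
  sites near \<open>u\<close>. An active live site with an oblivious update ignores its neighbours, and
  otherwise its neighbours are live one step further back.\<close>
lemma flow_live:
  "(\<And>v. v \<in> ball1 u n \<Longrightarrow> live n w v \<Longrightarrow> x v = x' v) \<Longrightarrow> flow n w x u = flow n w x' u"
proof (induction n arbitrary: x x')
  case (Suc n)
  have "step n w x v = step n w x' v" if "v \<in> ball1 u n" "live n w v" for v
  proof (rule step_live[OF _ that(2)])
    fix t assume "t \<in> ball1 v 1" "live (Suc n) w t"
    then show "x t = x' t" using ball1_trans[OF that(1), of t 1 "Suc n"] Suc.prems by simp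
  qed
  then show ?case by (simp add: Suc.IH[of "step n w x" "step n w x'"])
qed simp

lemma flow_cong:
  "(\<And>m v. m < n \<Longrightarrow> v \<in> ball1 u n \<Longrightarrow> live m w v = live m w' v) \<Longrightarrow>
   (\<And>m v. m < n \<Longrightarrow> v \<in> ball1 u (Suc n) \<Longrightarrow> req m w v \<Longrightarrow> w (v, Suc m) = w' (v, Suc m)) \<Longrightarrow>
   flow n w x u = flow n w' x u"
proof (induction n arbitrary: x)
  case (Suc n)
  have s: "step n w x v = step n w' x v" if v: "v \<in> ball1 u n" "live n w' v" for v
  proof -
    have l: "live n w v" using Suc.prems(1)[of n v] v ball1_mono[of n "Suc n" u] by auto
    have *: "w (t, Suc n) = w' (t, Suc n)" if "t \<in> ball1 v 1" for t
      using Suc.prems(2)[of n t] live_imp_req[OF l that] ball1_trans[OF v(1) that, of "Suc (Suc n)"]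
      by simp
    have "act n w v = act n w' v" by (rule act_cong) (rule *)
    then show ?thesis using *[of v] by (simp add: step_def)
  qed
  have "flow (Suc n) w x u = flow n w' (step n w x) u"
    unfolding flow.simps
  proof (rule Suc.IH)
    fix m v assume "m < n" "v \<in> ball1 u n"
    then show "live m w v = live m w' v" using Suc.prems(1)[of m v] ball1_mono[of n "Suc n" u] by auto
  next
    fix m v assume "m < n" "v \<in> ball1 u (Suc n)" "req m w v"
    then show "w (v, Suc m) = w' (v, Suc m)"
      using Suc.prems(2)[of m v] ball1_mono[of "Suc n" "Suc (Suc n)" u] by auto
  qed
  also have "\<dots> = flow n w' (step n w' x) u"
    by (rule flow_live) (rule s)
  finally show ?case by simp
qed simp

lemma flow_cong':
  assumes "\<And>v k. v \<in> ball1 u (Suc (2 * n)) \<Longrightarrow> 1 \<le> k \<Longrightarrow> k \<le> n \<Longrightarrow> w (v, k) = w' (v, k)"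
  shows "flow n w x u = flow n w' x u"
proof (rule flow_cong)
  fix m v assume m: "m < n" and v: "v \<in> ball1 u n"
  show "live m w v = live m w' v"
    by (rule live_cong, rule assms) (use ball1_trans[OF v] m in auto)
next
  fix m v assume "m < n" and "v \<in> ball1 u (Suc n)"
  then show "w (v, Suc m) = w' (v, Suc m)"
    using assms[of v "Suc m"] ball1_mono[of "Suc n" "Suc (2 * n)" u] by auto
qed

lemma step_translate:
  "step n (translate a w) (\<lambda>v. x (v + a)) = (\<lambda>v. step n w x (v + a))"
  by (auto simp: step_def act_translate algebra_simps fun_eq_iff intro!: arg_cong[of _ _ "upd _"])

lemma flow_translate:
  "flow n (translate a w) (\<lambda>v. x (v + a)) = (\<lambda>v. flow n w x (v + a))"
  by (induction n arbitrary: x) (simp_all add: step_translate)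

definition dead :: "nat \<Rightarrow> 'd field \<Rightarrow> 'd lattice \<Rightarrow> bool" where
  "dead n w u \<longleftrightarrow> (\<forall>v\<in>ball1 u n. \<not> live n w v)"

text \<open>If the search for the past never ends, which has probability zero, the value is \<open>s0\<close>.\<close>
definition cftp :: "'d field \<Rightarrow> 'd lattice \<Rightarrow> 'a" where
  "cftp w u = (if \<exists>n. dead n w u then flow (LEAST n. dead n w u) w (\<lambda>_. s0) u else s0)"

lemma cftp_in: "cftp w u \<in> S"
  by (simp add: cftp_def s0_in flow_in)

lemma flow_factor: "\<exists>y. flow (k + m) w x = flow k w y"
  by (induction m arbitrary: x) auto

lemma flow_dead: "dead n w u \<Longrightarrow> flow n w x u = flow n w x' u"
  by (rule flow_live) (auto simp: dead_def)

text \<open>Once no live site is left, starting even further in the past does not change the value. The number of live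
  sites in the growing ball need not stay zero, so this is not a matter of monotonicity: the longer
  flow factors through the shorter one.\<close>
lemma dead_flow_eq_cftp:
  assumes "dead n w u"
  shows "flow n w x u = cftp w u"
proof -
  define k where "k = (LEAST n. dead n w u)"
  have k: "dead k w u" unfolding k_def using assms by (rule LeastI)
  have "k \<le> n" unfolding k_def using assms by (rule Least_le)
  then obtain y where "flow n w x = flow k w y"
    using flow_factor[of k "n - k" w x] by auto
  then show ?thesis using flow_dead[OF k, of y "\<lambda>_. s0"] assms by (auto simp: cftp_def k_def)
qed

lemma dead_translate: "dead n (translate a w) u = dead n w (u + a)"
proof -
  have "v \<in> ball1 u n \<longleftrightarrow> v + a \<in> ball1 (u + a) n" for v by (simp add: ball1_def)
  moreover have "\<exists>v'. v = v' + a" for v by (rule exI[of _ "v - a"]) simp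
  ultimately show ?thesis unfolding dead_def live_translate by metis
qed

lemma cftp_translate: "cftp (translate a w) u = cftp w (u + a)"
  using flow_translate[of _ a w "\<lambda>_. s0"] by (simp add: cftp_def dead_translate)

end

section \<open>Matching requests with spare symbols\<close>

text \<open>Besides the letters in layer \<open>0\<close>, the resource field has spare symbols in layer \<open>1\<close> and the
  own symbols of a site for time \<open>n\<close> in layer \<open>n + 2\<close>. The layers \<open>n + 2\<close> with \<open>n \<ge> n0\<close> are not
  available to the coding; they serve sites without a partner and will turn out to be irrelevant.\<close>
locale matched_dynamics = noisy_dynamics upd obl S s0
  for upd :: "nat \<Rightarrow> ('d::finite lattice \<Rightarrow> 'a) \<Rightarrow> 'a" and obl S s0 +
  fixes n0 :: nat
begin

definition excess :: "nat \<Rightarrow> 'd field \<Rightarrow> 'd lattice \<Rightarrow> int" where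
  "excess n w v = of_bool (label n w v) - of_bool (req n w v)"

definition bal :: "nat \<Rightarrow> 'd field \<Rightarrow> 'd lattice \<Rightarrow> nat \<Rightarrow> int" where
  "bal n w v j = (\<Sum>i\<in>{1..<j}. excess n w (along v i))"

text \<open>Read spare symbols of label \<open>n\<close> as closing and requests as opening brackets, the spare symbol of a
  site preceding its request. The request at \<open>v\<close> is closed by the first site at which the closing brackets
  beyond \<open>v\<close> exceed the opening ones.\<close>
definition hit :: "nat \<Rightarrow> 'd field \<Rightarrow> 'd lattice \<Rightarrow> nat \<Rightarrow> bool" where
  "hit n w v j \<longleftrightarrow> 1 \<le> j \<and> 1 \<le> bal n w v j + of_bool (label n w (along v j))"

lemma bal_Suc: "1 \<le> j \<Longrightarrow> bal n w v (Suc j) = bal n w v j + excess n w (along v j)"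
  by (simp add: bal_def)

text \<open>A window with more spare symbols than requests contains the partner; only this criterion is
  used to estimate how far away the partner is.\<close>
lemma hit_if_positive:
  assumes "1 \<le> j" "1 \<le> (\<Sum>i\<in>{1..j}. excess n w (along v i))"
  shows "hit n w v j"
proof -
  have "(\<Sum>i\<in>{1..j}. excess n w (along v i)) = bal n w v j + excess n w (along v j)"
    using assms(1) bal_Suc[of j n w v] by (simp add: bal_def atLeastLessThanSuc_atLeastAtMost)
  moreover have "0 \<le> (of_bool (req n w (along v j)) :: int)" by simp
  ultimately show ?thesis using assms unfolding hit_def excess_def by linarith
qed

definition partner :: "nat \<Rightarrow> 'd field \<Rightarrow> 'd lattice \<Rightarrow> nat" where
  "partner n w v = (LEAST j. hit n w v j)"

lemma
  assumes "hit n w v k"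
  shows hit_partner: "hit n w v (partner n w v)"
    and bal_partner: "bal n w v (partner n w v) = 0"
    and label_partner: "label n w (along v (partner n w v))"
proof -
  define j where "j = partner n w v"
  show h: "hit n w v (partner n w v)" unfolding partner_def using assms by (rule LeastI)
  have m: "\<not> hit n w v i" if "i < j" for i
    using not_less_Least that by (auto simp: j_def partner_def)
  have j1: "1 \<le> j" using h by (simp add: hit_def j_def)
  have "bal n w v j \<le> 0"
  proof (cases "j = 1")
    case False
    then obtain i where i: "j = Suc i" "1 \<le> i" using j1 by (cases j) auto
    then show ?thesis using m[of i] bal_Suc[of i n w v]
      by (auto simp: hit_def excess_def split: if_splits)
  qed (simp add: bal_def)
  then show "bal n w v (partner n w v) = 0" "label n w (along v (partner n w v))"
    using h by (auto simp: hit_def j_def of_bool_def split: if_splits)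
qed

text \<open>Brackets nest: if \<open>v'\<close> lies between \<open>v\<close> and its partner, then the balance seen from \<open>v\<close> has
  dropped to \<open>-1\<close> or less just after \<open>v'\<close>, so that at the partner of \<open>v'\<close> it is still too small to close \<open>v\<close>.\<close>
lemma partner_inj_aux:
  assumes "hit n w v k" "hit n w v' k'" "req n w v'"
    and eq: "along v (partner n w v) = along v' (partner n w v')"
    and le: "partner n w v' \<le> partner n w v"
  shows "v = v'"
proof (rule ccontr)
  define j j' where "j = partner n w v" and "j' = partner n w v'"
  define i where "i = j - j'"
  assume "v \<noteq> v'"
  have v': "v' = along v i"
  proof -
    have "along v j = v' + axis undefined (int j')" using eq by (simp add: along_def j_def j'_def)
    moreover have "along v j = along v i + axis undefined (int j')"
      using along_along[of v i j'] le by (simp add: along_def i_def j_def j'_def)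
    ultimately show ?thesis by simp
  qed
  with \<open>v \<noteq> v'\<close> have i0: "1 \<le> i" by (cases i) auto
  have h': "hit n w v' j'" using hit_partner[OF assms(2)] by (simp add: j'_def)
  then have ij: "i < j" "j' = j - i" "1 \<le> j'" using i0 by (auto simp: i_def hit_def)
  have "\<not> hit n w v i"
    using not_less_Least ij(1) by (auto simp: j_def partner_def)
  then have "bal n w v (Suc i) \<le> -1"
    using assms(3) bal_Suc[OF i0, of n w v] i0 by (auto simp: hit_def excess_def v' split: if_splits)
  moreover have "bal n w v j = bal n w v (Suc i) + (\<Sum>t\<in>{Suc i..<j}. excess n w (along v t))"
    unfolding bal_def using i0 ij(1) by (intro sum.atLeastLessThan_concat[symmetric]) auto
  moreover have "(\<Sum>t\<in>{Suc i..<j}. excess n w (along v t)) = bal n w v' j'"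
    unfolding bal_def v' along_along
    by (rule sum.reindex_bij_witness[of _ "\<lambda>t. i + t" "\<lambda>t. t - i"]) (use ij in auto)
  ultimately show False
    using bal_partner[OF assms(1)] bal_partner[OF assms(2)] by (simp add: j_def j'_def)
qed

lemma partner_inj:
  assumes "hit n w v k" "hit n w v' k'" "req n w v" "req n w v'"
    and "along v (partner n w v) = along v' (partner n w v')"
  shows "v = v'"
  by (cases "partner n w v' \<le> partner n w v")
    (use partner_inj_aux[of n w v k v' k'] partner_inj_aux[of n w v' k' v k] assms in auto)

text \<open>The resource coordinate from which the symbol of \<open>v\<close> at time \<open>n\<close> is taken.\<close>
definition source :: "nat \<Rightarrow> 'd field \<Rightarrow> 'd lattice \<Rightarrow> 'd lattice \<times> nat" where
  "source n w v = (if n0 \<le> n \<and> req n w v \<and> (\<exists>j. hit n w v j)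
     then (along v (partner n w v), 1) else (v, n + 2))"

text \<open>Within one time this is the nesting of brackets, and spare symbols used at different times carry
  different labels.\<close>
lemma source_inj:
  assumes "source n w v = source m w u"
  shows "n = m \<and> v = u"
proof (cases "n0 \<le> n \<and> req n w v \<and> (\<exists>j. hit n w v j)")
  case True
  then have *: "n0 \<le> m \<and> req m w u \<and> (\<exists>j. hit m w u j)"
    using assms by (auto simp: source_def split: if_splits)
  then have eq: "along v (partner n w v) = along u (partner m w u)"
    using True assms by (simp add: source_def)
  then have "n = m"
  proof -
    obtain j k where "hit n w v j" "hit m w u k" using True * by blast
    then show ?thesis
      using label_partner[of n w v j] label_partner[of m w u k] eq
      by (auto intro: label_unique)
  qed
  moreover from this have "v = u" using partner_inj[of n w v _ u] True * eq by auto
  ultimately show ?thesis ..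
next
  case False
  then show ?thesis using assms by (auto simp: source_def split: if_splits)
qed

lemma snd_source: "1 \<le> snd (source n w v)"
  by (simp add: source_def)

lemma excess_cong:
  assumes "\<And>u k. u \<in> ball1 v (n + 2) \<Longrightarrow> k \<le> n \<Longrightarrow> w (u, k) = w' (u, k)"
  shows "excess n w v = excess n w' v"
proof -
  have "label n w v = label n w' v"
    by (rule label_cong, rule assms) (auto intro: along_ball1_trans[OF ball1_center[of v 0]])
  moreover have "req n w v = req n w' v"
    by (rule req_cong', rule assms) auto
  ultimately show ?thesis by (simp add: excess_def)
qed

lemma hit_cong:
  assumes "\<And>u k. u \<in> ball1 v (j + n + 2) \<Longrightarrow> k \<le> n \<Longrightarrow> w (u, k) = w' (u, k)"
  shows "hit n w v j = hit n w' v j"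
proof -
  have "bal n w v j = bal n w' v j"
    unfolding bal_def
    by (rule sum.cong[OF refl], rule excess_cong, rule assms)
      (auto intro: ball1_trans[OF along_ball1])
  moreover have "label n w (along v j) = label n w' (along v j)"
    by (rule label_cong, rule assms) (auto simp: along_along intro: ball1_mono[THEN subsetD, OF _ along_ball1])
  ultimately show ?thesis by (simp add: hit_def)
qed

lemma source_cong:
  assumes "\<And>u k. k \<le> n \<Longrightarrow> w (u, k) = w' (u, k)"
  shows "source n w v = source n w' v"
proof -
  have "hit n w v = hit n w' v"
    by (rule ext, rule hit_cong) (rule assms)
  moreover have "req n w v = req n w' v"
    by (rule req_cong') (rule assms)
  ultimately show ?thesis by (simp add: source_def partner_def)
qed

lemma excess_translate: "excess n (translate a w) v = excess n w (v + a)"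
  by (simp add: excess_def label_translate req_translate)

lemma hit_translate: "hit n (translate a w) v = hit n w (v + a)"
  by (simp add: fun_eq_iff hit_def bal_def excess_translate label_translate along_add)

lemma source_translate: "translate a \<omega> (source n (translate a w) v) = \<omega> (source n w (v + a))"
proof -
  have "partner n (translate a w) v = partner n w (v + a)"
    by (simp add: partner_def hit_translate)
  then show ?thesis by (auto simp: source_def hit_translate req_translate along_add)
qed

text \<open>The source at time \<open>n\<close> depends on the symbols read at earlier times, hence the recursion; layers above
  \<open>n\<close> are not meaningful yet.\<close>
primrec readout_upto :: "nat \<Rightarrow> 'd field \<Rightarrow> 'd field" where
  "readout_upto 0 \<omega> = (\<lambda>(v, k). \<omega> (v, 0))"
| "readout_upto (Suc n) \<omega> = (\<lambda>(v, k). if k = Suc n then \<omega> (source n (readout_upto n \<omega>) v) else readout_upto n \<omega> (v, k))"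

definition readout :: "'d field \<Rightarrow> 'd field" where
  "readout \<omega> = (\<lambda>(v, k). readout_upto k \<omega> (v, k))"

lemma readout_upto_eq: "k \<le> n \<Longrightarrow> readout_upto n \<omega> (v, k) = readout \<omega> (v, k)"
  by (induction n) (auto simp: readout_def le_Suc_eq)

lemma readout_0: "readout \<omega> (v, 0) = \<omega> (v, 0)"
  by (simp add: readout_def)

lemma readout_Suc: "readout \<omega> (v, Suc n) = \<omega> (source n (readout \<omega>) v)"
proof -
  have "source n (readout_upto n \<omega>) v = source n (readout \<omega>) v"
    by (rule source_cong) (rule readout_upto_eq)
  then show ?thesis by (simp add: readout_def)
qed

lemma readout_translate: "readout (translate a \<omega>) = translate a (readout \<omega>)"
proof -
  have "readout (translate a \<omega>) (v, k) = readout \<omega> (v + a, k)" for v k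
  proof (induction k arbitrary: v rule: less_induct)
    case (less k)
    show ?case
    proof (cases k)
      case (Suc n)
      have "source n (readout (translate a \<omega>)) v = source n (translate a (readout \<omega>)) v"
        by (rule source_cong) (simp add: less.IH Suc)
      then show ?thesis by (simp add: Suc readout_Suc source_translate)
    qed (simp add: readout_0)
  qed
  then show ?thesis by (auto simp: fun_eq_iff)
qed

text \<open>The source of \<open>(v, n)\<close> is fresh: the symbol stored there is not read anywhere else up to time \<open>n\<close>, so
  changing it affects neither the earlier symbols nor the choice of any source up to time \<open>n\<close>.\<close>
lemma readout_fresh:
  assumes off: "\<And>i. i \<noteq> source n (readout \<omega>) v \<Longrightarrow> \<omega>' i = \<omega> i"
    and "k \<le> Suc n" "(u, k) \<noteq> (v, Suc n)"
  shows "readout \<omega>' (u, k) = readout \<omega> (u, k)"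
  using assms(2,3)
proof (induction k arbitrary: u rule: less_induct)
  case (less k)
  show ?case
  proof (cases k)
    case 0
    have "source n (readout \<omega>) v \<noteq> (u, 0)" using snd_source[of n "readout \<omega>" v] by auto
    then show ?thesis using off[of "(u, 0)"] by (simp add: 0 readout_0)
  next
    case (Suc m)
    have "source m (readout \<omega>') u = source m (readout \<omega>) u"
      by (rule source_cong, rule less.IH) (use less.prems Suc in auto)
    moreover have "source m (readout \<omega>) u \<noteq> source n (readout \<omega>) v"
      using source_inj[of m "readout \<omega>" u n v] less.prems Suc by auto
    ultimately show ?thesis using off by (simp add: Suc readout_Suc)
  qed
qed

text \<open>One time step costs the distance \<open>l\<close> to a partner and three further steps for neighbours; the last
  \<open>N + 1\<close> keep the ball that is read by the flow in the domain.\<close>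
definition reach :: "nat \<Rightarrow> nat \<Rightarrow> nat" where
  "reach N l = N * (l + 3) + N + 1"

text \<open>If up to time \<open>N\<close> every partner is within distance \<open>l\<close> and nothing near the origin is live at time
  \<open>N\<close>, then the resource near the origin, in the layers available to the coding, determines the
  output at the origin. The hypotheses are about \<open>\<omega>\<close> only and carry over to \<open>\<omega>'\<close>: by induction
  over time, both read the same symbols at requested sites, on balls that shrink with time.\<close>
lemma cftp_local:
  fixes \<omega> \<omega>' :: "'d field"
  assumes agree: "\<And>v k. v \<in> ball1 0 (reach N l + N + 1) \<Longrightarrow> k \<le> Suc n0 \<Longrightarrow> \<omega> (v, k) = \<omega>' (v, k)"
    and hits: "\<And>n v. n0 \<le> n \<Longrightarrow> n < N \<Longrightarrow> v \<in> ball1 0 (reach N l) \<Longrightarrow>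
      \<exists>j\<le>l. hit n (readout \<omega>) v j"
    and dead: "dead N (readout \<omega>) 0"
  shows "cftp (readout \<omega>') 0 = cftp (readout \<omega>) 0"
proof -
  \<comment> \<open>The ball on which both fields agree at time \<open>n\<close> has radius \<open>r n\<close>.\<close>
  define W W' where "W = readout \<omega>" and "W' = readout \<omega>'"
  define r where "r n = (N - n) * (l + 3) + N + 1" for n
  have r_Suc: "r n = r (Suc n) + l + 3" if "n < N" for n
  proof -
    have "N - n = Suc (N - Suc n)" using that by simp
    then show ?thesis by (simp add: r_def)
  qed
  have r0: "r n \<le> reach N l" for n
    by (simp add: r_def reach_def)
  have rN: "N + 1 \<le> r n" for n by (simp add: r_def)
  have sym: "W (v, Suc n) = W' (v, Suc n)"
    if n: "n < N" and live: "\<And>v. v \<in> ball1 0 (r n) \<Longrightarrow> live n W v = live n W' v"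
      and v: "v \<in> ball1 0 (r (Suc n) + 2)" and rq: "req n W v" for n v
  proof -
    note rS = r_Suc[OF n] r0[of n] rN[of n]
    have req: "req n W u = req n W' u" if "u \<in> ball1 0 (r (Suc n) + l + 2)" for u
      by (rule req_cong, rule live) (use ball1_trans[OF that] rS in auto)
    have label: "label n W (along v i) = label n W' (along v i)" if "i \<le> l" for i
    proof (rule label_cong)
      fix j assume "j \<le> n"
      then have "along v (i + j) \<in> ball1 0 (reach N l + N + 1)"
        using along_ball1_trans[OF v, of "i + j" "reach N l + N + 1"] that n rS by simp
      then show "W (along (along v i) j, 0) = W' (along (along v i) j, 0)"
        using agree by (simp add: W_def W'_def readout_0 along_along)
    qed
    have ex: "excess n W (along v i) = excess n W' (along v i)" if "i \<le> l" for i
      using req[of "along v i"] label[OF that] along_ball1_trans[OF v, of i "r (Suc n) + l + 2"] that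
      by (simp add: excess_def)
    have hit: "hit n W v j = hit n W' v j" if "j \<le> l" for j
      using that by (auto simp: hit_def bal_def ex label)
    have rq': "req n W' v" using req[of v] rq v ball1_mono[of "r (Suc n) + 2" "r (Suc n) + l + 2"] by auto
    show ?thesis
    proof (cases "n0 \<le> n")
      case True
      have "v \<in> ball1 0 (reach N l)" using v rS ball1_mono[of "r (Suc n) + 2" "reach N l" 0] by auto
      then obtain j where j: "j \<le> l" "hit n W v j" using hits[OF True n] by (auto simp: W_def)
      define p where "p = partner n W v"
      have p: "hit n W v p" unfolding p_def by (rule hit_partner[OF j(2)])
      have pl: "p \<le> l" using Least_le[of "hit n W v", OF j(2)] j(1) by (simp add: p_def partner_def)
      have "partner n W' v = p"
        unfolding partner_def
      proof (rule Least_equality)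
        show "hit n W' v p" using hit[OF pl] p by simp
        fix y assume y: "hit n W' v y"
        show "p \<le> y"
        proof (rule ccontr)
          assume "\<not> p \<le> y"
          then have "y < p" "hit n W v y" using hit[of y] pl y by auto
          then show False using not_less_Least[of y "hit n W v"] by (simp add: p_def partner_def)
        qed
      qed
      moreover have "\<exists>j. hit n W' v j" using hit[OF j(1)] j(2) by auto
      ultimately have "source n W v = (along v p, 1)" "source n W' v = (along v p, 1)"
        using True rq rq' j(2) by (auto simp: source_def p_def)
      moreover have "along v p \<in> ball1 0 (reach N l + N + 1)"
        by (rule along_ball1_trans[OF v]) (use pl rS in auto)
      ultimately show ?thesis using agree[of "along v p" 1] by (simp add: W_def W'_def readout_Suc)
    next
      case False
      then have "source n W v = (v, n + 2)" "source n W' v = (v, n + 2)" by (auto simp: source_def)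
      moreover have "v \<in> ball1 0 (reach N l + N + 1)"
        using v rS ball1_mono[of "r (Suc n) + 2" "reach N l + N + 1" 0] by auto
      ultimately show ?thesis using agree[of v "n + 2"] False by (simp add: W_def W'_def readout_Suc)
    qed
  qed
  have live: "\<forall>v\<in>ball1 0 (r n). live n W v = live n W' v" if "n \<le> N" for n
    using that
  proof (induction n)
    case (Suc n)
    show ?case
    proof (rule ballI, rule live_Suc_cong)
      fix v u :: "'d lattice" assume v: "v \<in> ball1 0 (r (Suc n))" and u: "u \<in> ball1 v 1"
      then have "u \<in> ball1 0 (r n)" using r_Suc[of n] Suc.prems by (intro ball1_trans[OF v u]) auto
      then show "live n W u = live n W' u" using Suc by auto
    next
      fix v u :: "'d lattice" assume v: "v \<in> ball1 0 (r (Suc n))" and u: "u \<in> ball1 v 2" and rq: "req n W u"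
      show "W (u, Suc n) = W' (u, Suc n)"
        by (rule sym[OF _ _ ball1_trans[OF v u] rq]) (use Suc in auto)
    qed
  qed simp
  have "dead N W' 0"
    unfolding dead_def
  proof
    fix v :: "'d lattice" assume v: "v \<in> ball1 0 N"
    then have "v \<in> ball1 0 (r N)" using rN[of N] ball1_mono[of N "r N" 0] by auto
    then have "live N W v = live N W' v" using live[of N] by blast
    then show "\<not> live N W' v" using dead v unfolding dead_def W_def by blast
  qed
  then have "cftp W' 0 = flow N W' (\<lambda>_. s0) 0" by (rule dead_flow_eq_cftp[symmetric])
  also have "\<dots> = flow N W (\<lambda>_. s0) 0"
  proof (rule flow_cong[symmetric])
    fix m and v :: "'d lattice" assume m: "m < N" and v: "v \<in> ball1 0 N"
    show "live m W v = live m W' v"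
      using live[of m] m v rN[of m] ball1_mono[of N "r m" 0] by auto
  next
    fix m and v :: "'d lattice" assume m: "m < N" and v: "v \<in> ball1 0 (Suc N)" and rq: "req m W v"
    show "W (v, Suc m) = W' (v, Suc m)"
      using sym[OF m _ _ rq] live[of m] m v rN[of "Suc m"] ball1_mono[of "Suc N" "r (Suc m) + 2" 0] by auto
  qed
  also have "\<dots> = cftp W 0" using dead by (intro dead_flow_eq_cftp) (simp add: W_def)
  finally show ?thesis by (simp add: W_def W'_def)
qed

end

section \<open>The field read through the matching is independent\<close>

text \<open>Both the resource and the ideal field consist of independent letters in layer \<open>0\<close> and independent symbols
  in all other layers, so that they live on the same probability space and reading the one from the other
  is a measure-preserving map.\<close>
locale coded_dynamics = matched_dynamics upd obl S s0 n0
  for upd :: "nat \<Rightarrow> ('d::finite lattice \<Rightarrow> 'a) \<Rightarrow> 'a" and obl S s0 n0 +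
  fixes letter_law :: "(bool \<times> nat) pmf" and update_law :: "nat pmf"
  assumes letter_uniform: "a \<le> 2 \<Longrightarrow> measure (measure_pmf letter_law) {s. snd s = a} = 1 / 3"
begin

definition symbol_law :: "(bool \<times> nat) pmf" where
  "symbol_law = pair_pmf (bernoulli_pmf (1 / 2)) update_law"

definition coord_law :: "'d lattice \<times> nat \<Rightarrow> (bool \<times> nat) pmf" where
  "coord_law i = (if snd i = 0 then letter_law else symbol_law)"

sublocale discrete_product coord_law .

lemma
  shows measurable_readout: "(\<lambda>\<omega>. readout \<omega> i) \<in> measurable Om (count_space UNIV)"
    and measurable_source: "(\<lambda>\<omega>. source n (readout \<omega>) v) \<in> measurable Om (count_space UNIV)"
proof -
  have A: "(\<lambda>\<omega>. source n (readout \<omega>) v) \<in> measurable Om (count_space UNIV)"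
    if IH: "\<And>k v. k \<le> n \<Longrightarrow> (\<lambda>\<omega>. readout \<omega> (v, k)) \<in> measurable Om (count_space UNIV)" for n v
  proof -
    have [measurable]: "Measurable.pred Om (\<lambda>\<omega>. hit n (readout \<omega>) v j)" for j
      by (rule measurable_depends_on[where J="ball1 v (j + n + 2) \<times> {..n}"])
        (auto intro!: depends_onI hit_cong IH)
    have [measurable]: "Measurable.pred Om (\<lambda>\<omega>. req n (readout \<omega>) v)"
      by (rule measurable_depends_on[where J="ball1 v (Suc (Suc n)) \<times> {..n}"])
        (auto intro!: depends_onI req_cong' IH)
    have [measurable]: "(\<lambda>\<omega>. partner n (readout \<omega>) v) \<in> measurable Om (count_space UNIV)"
      unfolding partner_def by measurable
    show ?thesis unfolding source_def by measurable
  qed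
  have T: "(\<lambda>\<omega>. readout \<omega> (v, k)) \<in> measurable Om (count_space UNIV)" for v k
  proof (induction k arbitrary: v rule: less_induct)
    case (less k)
    show ?case
    proof (cases k)
      case (Suc n)
      have "(\<lambda>\<omega>. source n (readout \<omega>) v) \<in> measurable Om (count_space UNIV)"
        by (rule A) (simp add: less.IH Suc)
      then show ?thesis unfolding Suc readout_Suc
        by (rule measurable_compose_countable[rotated]) (rule measurable_coord)
    qed (simp add: readout_0)
  qed
  show "(\<lambda>\<omega>. readout \<omega> i) \<in> measurable Om (count_space UNIV)"
    using T[of "fst i" "snd i"] by simp
  show "(\<lambda>\<omega>. source n (readout \<omega>) v) \<in> measurable Om (count_space UNIV)"
    by (rule A) (rule T)
qed

text \<open>What has been read before, together with the position of the source, carries no information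
  about the symbol stored in the source.\<close>
lemma fresh_source_independent:
  fixes F :: "('d lattice \<times> nat) set" and X :: "'d lattice \<times> nat \<Rightarrow> (bool \<times> nat) set"
  assumes F: "finite F" "\<And>i. i \<in> F \<Longrightarrow> snd i \<le> Suc n" "(v, Suc n) \<notin> F"
  shows "depends_on (- {a}) (\<lambda>\<omega>. (\<forall>i\<in>F. readout \<omega> i \<in> X i) \<and> source n (readout \<omega>) v = a)"
proof -
  have *: "(\<forall>i\<in>F. readout \<omega>' i \<in> X i) \<and> source n (readout \<omega>') v = a"
    if off: "\<And>i. i \<in> - {a} \<Longrightarrow> \<omega> i = \<omega>' i"
      and \<omega>: "(\<forall>i\<in>F. readout \<omega> i \<in> X i) \<and> source n (readout \<omega>) v = a" for \<omega> \<omega>'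
  proof -
    have fresh: "readout \<omega>' (u, k) = readout \<omega> (u, k)" if "k \<le> Suc n" "(u, k) \<noteq> (v, Suc n)" for u k
      by (rule readout_fresh[OF _ that]) (use off \<omega> in auto)
    have "readout \<omega>' i = readout \<omega> i" if "i \<in> F" for i
      using fresh[of "snd i" "fst i"] F(2)[OF that] F(3) that by (cases i) auto
    moreover have "source n (readout \<omega>') v = source n (readout \<omega>) v"
      by (rule source_cong, rule fresh) auto
    ultimately show ?thesis using \<omega> by auto
  qed
  show ?thesis
  proof (rule depends_onI, rule iffI)
    fix \<omega> \<omega>' :: "'d field" assume off: "\<And>i. i \<in> - {a} \<Longrightarrow> \<omega> i = \<omega>' i"
    {
      assume "(\<forall>i\<in>F. readout \<omega> i \<in> X i) \<and> source n (readout \<omega>) v = a"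
      from *[OF off this] show "(\<forall>i\<in>F. readout \<omega>' i \<in> X i) \<and> source n (readout \<omega>') v = a" .
    next
      assume "(\<forall>i\<in>F. readout \<omega>' i \<in> X i) \<and> source n (readout \<omega>') v = a"
      from *[OF off[symmetric] this] show "(\<forall>i\<in>F. readout \<omega> i \<in> X i) \<and> source n (readout \<omega>) v = a" .
    }
  qed
qed

text \<open>The coordinates are added in the order of their layers. Given the symbols read so far and the position \<open>a\<close> of
  the next source, the symbol at \<open>a\<close> is still independent with the right law; summing over the countably many
  positions \<open>a\<close> gives one more factor in the product formula.\<close>
lemma readout_preserves: "distr Om Om readout = Om"
proof (rule measure_preservingI[OF measurable_readout])
  fix F :: "('d lattice \<times> nat) set" and X :: "'d lattice \<times> nat \<Rightarrow> (bool \<times> nat) set"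
  assume "finite F"
  then show "prob {\<omega>. \<forall>i\<in>F. readout \<omega> i \<in> X i} = (\<Prod>i\<in>F. measure (measure_pmf (coord_law i)) (X i))"
  proof (induction F rule: finite_ranking_induct[where f=snd])
    case empty
    show ?case using prob_space by simp
  next
    case (insert x F)
    obtain v k where x: "x = (v, k)" by (cases x)
    have keys: "snd i \<le> k" if "i \<in> F" for i using insert.hyps(2)[OF that] x by simp
    show ?case
    proof (cases "x \<in> F")
      case True
      then show ?thesis using insert.IH by (simp add: insert_absorb)
    next
      case False
      show ?thesis
      proof (cases k)
        case 0
        have "readout \<omega> i = \<omega> i" if "i \<in> insert x F" for i \<omega>
          using that x keys[of i] readout_0[of \<omega> "fst i"] by (cases i) (auto simp: 0)
        then have "{\<omega>. \<forall>i\<in>insert x F. readout \<omega> i \<in> X i} = {\<omega>. \<forall>i\<in>insert x F. \<omega> i \<in> X i}" by auto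
        then show ?thesis using prob_coords[of "insert x F" X] insert.hyps(1) by simp
      next
        case (Suc n)
        let ?Q = "\<lambda>\<omega>. \<forall>i\<in>F. readout \<omega> i \<in> X i"
        let ?A = "\<lambda>\<omega>. source n (readout \<omega>) v"
        let ?c = "measure (measure_pmf symbol_law) (X x)"
        \<comment> \<open>\<open>C a\<close>: the source is \<open>a\<close>. \<open>B a\<close>: in addition the symbol found there is right.\<close>
        define B where "B a = {\<omega>. (?Q \<omega> \<and> ?A \<omega> = a) \<and> \<omega> a \<in> X x}" for a
        define C where "C a = {\<omega>. ?Q \<omega> \<and> ?A \<omega> = a}" for a
        note [measurable] = measurable_readout measurable_source
        have Qm [measurable]: "Measurable.pred Om ?Q"
          using insert.hyps(1) by (intro pred_intros_finite) auto
        have Am: "Measurable.pred Om (\<lambda>\<omega>. ?A \<omega> = a)" for a by measurable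
        have CQ: "Measurable.pred Om (\<lambda>\<omega>. ?Q \<omega> \<and> ?A \<omega> = a)" for a
          by (intro pred_intros_logic Qm Am)
        have Xm: "Measurable.pred Om (\<lambda>\<omega>. \<omega> a \<in> X x)" for a by measurable
        have Cm: "C a \<in> sets Om" for a using CQ[of a] by (simp add: C_def pred_def)
        have "Measurable.pred Om (\<lambda>\<omega>. (?Q \<omega> \<and> ?A \<omega> = a) \<and> \<omega> a \<in> X x)" for a
          by (intro pred_intros_logic CQ Xm)
        then have Bm: "B a \<in> sets Om" for a by (simp add: B_def pred_def)
        have BC: "emeasure Om (B a) = emeasure Om (C a) * ennreal ?c" for a
        proof (cases "snd a = 0")
          case True
          then have "?A \<omega> \<noteq> a" for \<omega> using snd_source[of n "readout \<omega>" v] by auto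
          then show ?thesis by (simp add: B_def C_def)
        next
          case False
          have "prob (B a) = prob (C a) * prob {\<omega>. \<omega> a \<in> X x}"
            unfolding B_def C_def
          proof (rule prob_conj_depends)
            show "depends_on (- {a}) (\<lambda>\<omega>. ?Q \<omega> \<and> ?A \<omega> = a)"
              by (rule fresh_source_independent)
                (use insert.hyps(1) keys \<open>x \<notin> F\<close> Suc x in auto)
            show "depends_on {a} (\<lambda>\<omega>. \<omega> a \<in> X x)" by (auto simp: depends_on_def)
          qed (use CQ Xm in auto)
          also have "prob {\<omega>. \<omega> a \<in> X x} = ?c" using prob_coord[of a] False by (simp add: coord_law_def)
          finally show ?thesis by (simp add: emeasure_eq_measure ennreal_mult)
        qed
        have "{\<omega>. \<forall>i\<in>insert x F. readout \<omega> i \<in> X i} = (\<Union>a. B a)"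
          by (auto simp: B_def x Suc readout_Suc)
        then have "emeasure Om {\<omega>. \<forall>i\<in>insert x F. readout \<omega> i \<in> X i} = emeasure Om (\<Union>a. B a)"
          by simp
        also have "\<dots> = (\<integral>\<^sup>+a. emeasure Om (B a) \<partial>count_space UNIV)"
          by (rule emeasure_UN_countable) (use Bm in \<open>auto simp: disjoint_family_on_def B_def\<close>)
        also have "\<dots> = (\<integral>\<^sup>+a. emeasure Om (C a) \<partial>count_space UNIV) * ennreal ?c"
          unfolding BC by (rule nn_integral_multc) auto
        also have "(\<integral>\<^sup>+a. emeasure Om (C a) \<partial>count_space UNIV) = emeasure Om (\<Union>a. C a)"
          by (rule emeasure_UN_countable[symmetric]) (use Cm in \<open>auto simp: disjoint_family_on_def C_def\<close>)
        also have "(\<Union>a. C a) = {\<omega>. ?Q \<omega>}" by (auto simp: C_def)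
        finally have "prob {\<omega>. \<forall>i\<in>insert x F. readout \<omega> i \<in> X i} = prob {\<omega>. ?Q \<omega>} * ?c"
          by (simp add: emeasure_eq_measure ennreal_mult[symmetric])
        also have "?c = measure (measure_pmf (coord_law x)) (X x)"
          by (simp add: coord_law_def x Suc)
        finally show ?thesis using insert \<open>x \<notin> F\<close> by (simp add: mult.commute)
      qed
    qed
  qed
qed

lemma readout_measurable: "readout \<in> measurable Om Om"
  by (rule measurable_into_Om[OF measurable_readout])

lemma prob_readout:
  assumes "Measurable.pred Om P"
  shows "prob {\<omega>. P (readout \<omega>)} = prob {\<omega>. P \<omega>}"
proof -
  have "prob {\<omega>. P \<omega>} = measure (distr Om Om readout) {\<omega>. P \<omega>}" by (simp add: readout_preserves)
  also have "\<dots> = prob {\<omega>. P (readout \<omega>)}"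
    by (subst measure_distr[OF readout_measurable]) (use assms in \<open>auto simp: vimage_def pred_def\<close>)
  finally show ?thesis ..
qed

lemma translate_preserves: "distr Om Om (translate a) = Om"
proof (rule measure_preservingI)
  fix i show "(\<lambda>\<omega>. translate a \<omega> i) \<in> measurable Om (count_space UNIV)"
    by (cases i) simp
next
  fix F :: "('d lattice \<times> nat) set" and X :: "'d lattice \<times> nat \<Rightarrow> (bool \<times> nat) set"
  assume F: "finite F"
  define g where "g = (\<lambda>(v, k). (v + a, k) :: 'd lattice \<times> nat)"
  have inj: "inj_on g F" by (auto simp: inj_on_def g_def)
  have tr: "translate a \<omega> i = \<omega> (g i)" for \<omega> i by (cases i) (simp add: g_def)
  have "{\<omega>. \<forall>i\<in>F. translate a \<omega> i \<in> X i} = {\<omega>. \<forall>i\<in>g ` F. \<omega> i \<in> X (the_inv_into F g i)}"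
    using inj by (auto simp: tr the_inv_into_f_f)
  then have "prob {\<omega>. \<forall>i\<in>F. translate a \<omega> i \<in> X i} =
      (\<Prod>i\<in>g ` F. measure (measure_pmf (coord_law i)) (X (the_inv_into F g i)))"
    using prob_coords[of "g ` F" "\<lambda>i. X (the_inv_into F g i)"] F by simp
  also have "\<dots> = (\<Prod>i\<in>F. measure (measure_pmf (coord_law i)) (X i))"
    using inj by (subst prod.reindex) (auto simp: the_inv_into_f_f coord_law_def g_def intro!: prod.cong)
  finally show "prob {\<omega>. \<forall>i\<in>F. translate a \<omega> i \<in> X i} = \<dots>" .
qed

lemma translate_measurable: "translate a \<in> measurable Om Om"
proof (rule measurable_into_Om)
  fix i show "(\<lambda>\<omega>. translate a \<omega> i) \<in> measurable Om (count_space UNIV)"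
    by (cases i) simp
qed

lemma label_local: "depends_on ((\<lambda>i. (along v i, 0)) ` {..n}) (\<lambda>\<omega>. label n \<omega> v)"
  by (auto intro!: depends_onI label_cong)

lemma pred_label [measurable]: "Measurable.pred Om (\<lambda>\<omega>. label n \<omega> v)"
  by (rule measurable_local[OF _ label_local]) auto

text \<open>One letter contributes a factor of 3 and halves \<open>n\<close>. The exponent \<open>3\<close> is larger than
  \<open>log\<^sub>2 3\<close> in order to absorb the rounding.\<close>
lemma prob_label: "1 / (3 * real (n + 1) ^ 3) \<le> prob {\<omega>. label n \<omega> v}"
proof (induction n arbitrary: v rule: less_induct)
  case (less n)
  have letter: "prob {\<omega>. snd (\<omega> (v, 0)) = a} = 1 / 3" if "a \<le> 2" for a
    using prob_coord[of "(v, 0)" "{s. snd s = a}"] letter_uniform[OF that] by (simp add: coord_law_def)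
  show ?case
  proof (cases "n = 0")
    case True
    then show ?thesis using letter[of 2] by (simp add: label.simps)
  next
    case False
    define m where "m = n div 2"
    have m: "m < n" "2 * m \<le> n" using False by (auto simp: m_def)
    have "prob {\<omega>. label n \<omega> v} = prob {\<omega>. snd (\<omega> (v, 0)) = n mod 2 \<and> label m \<omega> (along v 1)}"
      using False by (simp add: label.simps[of n] m_def)
    also have "\<dots> = prob {\<omega>. snd (\<omega> (v, 0)) = n mod 2} * prob {\<omega>. label m \<omega> (along v 1)}"
    proof (rule prob_conj_depends)
      show "depends_on {(v, 0)} (\<lambda>\<omega>. snd (\<omega> (v, 0)) = n mod 2)" by (auto simp: depends_on_def)
      have "along v (Suc i) \<noteq> v" for i using along_inj[of v "Suc i" 0] by (simp del: along_inj)
      then show "{(v, 0)} \<inter> (\<lambda>i. (along (along v 1) i, 0)) ` {..m} = {}"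
        by (fastforce simp: along_along)
    qed (auto intro: label_local)
    also have "prob {\<omega>. snd (\<omega> (v, 0)) = n mod 2} = 1 / 3"
      using letter[of "n mod 2"] by simp
    finally have eq: "prob {\<omega>. label n \<omega> v} = 1 / 3 * prob {\<omega>. label m \<omega> (along v 1)}" .
    \<comment> \<open>For \<open>m = 0\<close>, \<open>n = 1\<close> the bound \<open>n \<ge> 2 m\<close> is too weak, but \<open>3 \<le> 2\<^sup>3\<close>.\<close>
    have "3 * (m + 1) ^ 3 \<le> (n + 1) ^ 3"
    proof (cases "m = 0")
      case True
      then have "2 ^ 3 \<le> (n + 1) ^ 3" using False by (intro power_mono) auto
      then show ?thesis using True by simp
    next
      case False
      have "3 * (m + 1) ^ 3 \<le> (2 * m + 1) ^ 3"
        using False by (cases m) (simp_all add: power3_eq_cube algebra_simps)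
      also have "\<dots> \<le> (n + 1) ^ 3" using m by (intro power_mono) auto
      finally show ?thesis .
    qed
    then have "real (3 * (m + 1) ^ 3) \<le> real ((n + 1) ^ 3)" by (rule of_nat_mono)
    then have "3 * real (m + 1) ^ 3 \<le> real (n + 1) ^ 3" by simp
    then have "1 / (3 * real (n + 1) ^ 3) \<le> 1 / (3 * (3 * real (m + 1) ^ 3))"
      by (intro divide_left_mono mult_pos_pos mult_left_mono) auto
    also have "\<dots> = 1 / 3 * (1 / (3 * real (m + 1) ^ 3))" by simp
    also have "\<dots> \<le> prob {\<omega>. label n \<omega> v}"
      unfolding eq by (rule mult_left_mono[OF less.IH[OF m(1)]]) simp
    finally show ?thesis .
  qed
qed

end

section \<open>Decay of the live set and of the matching distance\<close>

text \<open>Here \<open>\<rho>\<close> bounds the expected number of live successors of a live site: an inactive site succeeds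
  itself; a site is active with probability \<open>(1 / 2) ^ Suc (card nb0)\<close>, and then has \<open>card nb0\<close>
  successors with the probability of a non-oblivious update, and none otherwise. The bound on \<open>n0\<close> makes requests at
  most half as frequent as labels.\<close>
locale subcritical_dynamics = coded_dynamics upd obl S s0 n0 letter_law update_law
  for upd :: "nat \<Rightarrow> ('d::finite lattice \<Rightarrow> 'a) \<Rightarrow> 'a" and obl S s0 n0 letter_law update_law +
  fixes \<rho> :: real
  assumes decay: "1 - (1 / 2) ^ Suc (card (nb0 :: 'd lattice set)) *
      (1 - real (card (nb0 :: 'd lattice set)) * measure (measure_pmf update_law) {k. \<not> obl k}) \<le> \<rho>"
    and rho: "0 < \<rho>" "\<rho> < 1"
    and n0_large: "n0 \<le> n \<Longrightarrow>
      real (1 + card (nb0 :: 'd lattice set)) * \<rho> ^ n \<le> 1 / (6 * real (n + 1) ^ 3)"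
begin

lemma prob_act_and:
  "prob {\<omega>. act n \<omega> v \<and> snd (\<omega> (v, Suc n)) \<in> K} =
     (1 / 2) ^ Suc (card (nb0 :: 'd lattice set)) * measure (measure_pmf update_law) K"
proof -
  let ?G = "(\<lambda>z. (v + z, Suc n)) ` nb0"
  define X where "X i = (if i = (v, Suc n) then {True} \<times> K else {False} \<times> UNIV)" for i :: "'d lattice \<times> nat"
  have notin: "(v, Suc n) \<notin> ?G" by (auto simp: nb0_iff)
  have card: "card ?G = card (nb0 :: 'd lattice set)" by (rule card_image) (auto simp: inj_on_def)
  have X0: "X i = {False} \<times> UNIV" if "i \<in> ?G" for i using that notin by (auto simp: X_def)
  have "{\<omega>. act n \<omega> v \<and> snd (\<omega> (v, Suc n)) \<in> K} = {\<omega>. \<forall>i\<in>insert (v, Suc n) ?G. \<omega> i \<in> X i}"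
    using X0 by (auto simp: act_def X_def mem_Times_iff)
  then have "prob {\<omega>. act n \<omega> v \<and> snd (\<omega> (v, Suc n)) \<in> K} =
      (\<Prod>i\<in>insert (v, Suc n) ?G. measure (measure_pmf (coord_law i)) (X i))"
    using prob_coords[of "insert (v, Suc n) ?G" X] by simp
  also have "\<dots> = measure (measure_pmf symbol_law) ({True} \<times> K) *
      (\<Prod>i\<in>?G. measure (measure_pmf symbol_law) ({False} \<times> UNIV))"
  proof -
    have "(\<Prod>i\<in>?G. measure (measure_pmf (coord_law i)) (X i)) =
        (\<Prod>i\<in>?G. measure (measure_pmf symbol_law) ({False} \<times> UNIV))"
    proof (rule prod.cong[OF refl])
      fix i assume i: "i \<in> ?G"
      then have "coord_law i = symbol_law" by (auto simp: coord_law_def)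
      then show "measure (measure_pmf (coord_law i)) (X i) = measure (measure_pmf symbol_law) ({False} \<times> UNIV)"
        using X0[OF i] by simp
    qed
    moreover have "X (v, Suc n) = {True} \<times> K" "coord_law (v, Suc n) = symbol_law"
      by (auto simp: X_def coord_law_def)
    ultimately show ?thesis using notin by (subst prod.insert) auto
  qed
  also have "\<dots> = (1 / 2) ^ Suc (card (nb0 :: 'd lattice set)) * measure (measure_pmf update_law) K"
    by (simp add: symbol_law_def measure_pmf_prob_product card measure_pmf_single)
  finally show ?thesis .
qed

lemma live_local: "depends_on (ball1 v (Suc n) \<times> {1..n}) (\<lambda>\<omega>. live n \<omega> v)"
  by (auto intro!: depends_onI live_cong)

lemma pred_live [measurable]: "Measurable.pred Om (\<lambda>\<omega>. live n \<omega> v)"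
  by (rule measurable_local[OF _ live_local]) auto

lemma act_local: "depends_on (ball1 v 1 \<times> {Suc n}) (\<lambda>\<omega>. act n \<omega> v)"
  by (auto intro!: depends_onI act_cong)

lemma pred_act [measurable]: "Measurable.pred Om (\<lambda>\<omega>. act n \<omega> v)"
  by (rule measurable_local[OF _ act_local]) auto

lemma pred_req [measurable]: "Measurable.pred Om (\<lambda>\<omega>. req n \<omega> v)"
  by (rule measurable_local[where J="ball1 v (Suc (Suc n)) \<times> {1..n}"])
    (auto intro!: depends_onI req_cong')

text \<open>A first-moment bound: a site is live because it was live and inactive, or because of a neighbour.
  The symbols of time \<open>n\<close> are independent of the live sites at time \<open>n\<close>. The bound holds for all
  sites at once, so no correlation between live sites enters.\<close>
lemma prob_live: "prob {\<omega>. live n \<omega> v} \<le> \<rho> ^ n"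
proof (induction n arbitrary: v)
  case 0
  show ?case using prob_space by simp
next
  case (Suc n)
  let ?a = "(1 / 2) ^ Suc (card (nb0 :: 'd lattice set)) :: real"
  let ?\<kappa> = "measure (measure_pmf update_law) {k. \<not> obl k}"
  let ?B = "\<lambda>u \<omega>. act n \<omega> u \<and> snd (\<omega> (u, Suc n)) \<in> {k. \<not> obl k}"
  have a: "prob {\<omega>. act n \<omega> v} = ?a" using prob_act_and[of n v UNIV] by simp
  have Bm: "Measurable.pred Om (?B u)" for u by measurable
  have Em: "{\<omega>. live n \<omega> u \<and> ?B u \<omega>} \<in> sets Om" for u
    by (intro event_of_pred pred_intros_logic pred_live Bm)
  have Nm: "{\<omega>. live n \<omega> v \<and> \<not> act n \<omega> v} \<in> sets Om"
    by (intro event_of_pred pred_intros_logic pred_live pred_act)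
  have "{\<omega>. live (Suc n) \<omega> v} =
      {\<omega>. live n \<omega> v \<and> \<not> act n \<omega> v} \<union> (\<Union>z\<in>nb0. {\<omega>. live n \<omega> (v + z) \<and> ?B (v + z) \<omega>})"
    by auto
  then have "prob {\<omega>. live (Suc n) \<omega> v} \<le>
      prob {\<omega>. live n \<omega> v \<and> \<not> act n \<omega> v} + prob (\<Union>z\<in>nb0. {\<omega>. live n \<omega> (v + z) \<and> ?B (v + z) \<omega>})"
    using Nm Em by (simp only:) (intro measure_Un_le sets.finite_UN finite_nb0)
  also have "\<dots> \<le> prob {\<omega>. live n \<omega> v \<and> \<not> act n \<omega> v} +
      (\<Sum>z\<in>nb0. prob {\<omega>. live n \<omega> (v + z) \<and> ?B (v + z) \<omega>})"
    using Em by (intro add_left_mono finite_measure_subadditive_finite finite_nb0) blast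
  also have "prob {\<omega>. live n \<omega> v \<and> \<not> act n \<omega> v} =
      prob {\<omega>. live n \<omega> v} * prob {\<omega>. \<not> act n \<omega> v}"
  proof (rule prob_conj_depends[OF live_local])
    show "depends_on (ball1 v 1 \<times> {Suc n}) (\<lambda>\<omega>. \<not> act n \<omega> v)"
      using act_local[of v n] by (auto simp: depends_on_def)
  qed auto
  also have "prob {\<omega>. \<not> act n \<omega> v} = 1 - ?a"
    using prob_neg[of "\<lambda>\<omega>. act n \<omega> v"] a event_of_pred[OF pred_act[of n v]] by simp
  also have "(\<Sum>z\<in>nb0. prob {\<omega>. live n \<omega> (v + z) \<and> ?B (v + z) \<omega>}) =
      (\<Sum>z\<in>nb0. prob {\<omega>. live n \<omega> (v + z)} * (?a * ?\<kappa>))"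
  proof (rule sum.cong[OF refl])
    fix z :: "'d lattice" assume "z \<in> nb0"
    have "prob {\<omega>. live n \<omega> (v + z) \<and> ?B (v + z) \<omega>} =
        prob {\<omega>. live n \<omega> (v + z)} * prob {\<omega>. ?B (v + z) \<omega>}"
    proof (rule prob_conj_depends[OF live_local])
      show "depends_on (ball1 (v + z) 1 \<times> {Suc n}) (?B (v + z))"
        using act_local[of "v + z" n]
        by (auto simp: depends_on_def)
    qed (use Bm in auto)
    then show "prob {\<omega>. live n \<omega> (v + z) \<and> ?B (v + z) \<omega>} = prob {\<omega>. live n \<omega> (v + z)} * (?a * ?\<kappa>)"
      using prob_act_and[of n "v + z" "{k. \<not> obl k}"] by simp
  qed
  also have "prob {\<omega>. live n \<omega> v} * (1 - ?a) + (\<Sum>z\<in>nb0. prob {\<omega>. live n \<omega> (v + z)} * (?a * ?\<kappa>))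
      \<le> \<rho> ^ n * (1 - ?a) + (\<Sum>z\<in>(nb0 :: 'd lattice set). \<rho> ^ n * (?a * ?\<kappa>))"
    by (intro add_mono mult_right_mono sum_mono Suc.IH) (auto simp: power_le_one simp del: power_Suc)
  also have "\<dots> = \<rho> ^ n * (1 - ?a * (1 - real (card (nb0 :: 'd lattice set)) * ?\<kappa>))"
    by (simp add: algebra_simps)
  also have "\<dots> \<le> \<rho> ^ n * \<rho>"
    using decay rho by (intro mult_left_mono) auto
  finally show ?case by (simp add: mult.commute)
qed

lemma prob_req: "prob {\<omega>. req n \<omega> v} \<le> real (1 + card (nb0 :: 'd lattice set)) * \<rho> ^ n"
proof -
  have "{\<omega>. req n \<omega> v} = {\<omega>. live n \<omega> v} \<union> (\<Union>z\<in>nb0. {\<omega>. live n \<omega> (v + z)})"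
    by (auto simp: req_def)
  then have "prob {\<omega>. req n \<omega> v} \<le> prob {\<omega>. live n \<omega> v} + prob (\<Union>z\<in>nb0. {\<omega>. live n \<omega> (v + z)})"
    by (simp only:) (intro measure_Un_le sets.finite_UN finite_nb0 event_of_pred pred_live)
  also have "\<dots> \<le> prob {\<omega>. live n \<omega> v} + (\<Sum>z\<in>nb0. prob {\<omega>. live n \<omega> (v + z)})"
    by (intro add_left_mono finite_measure_subadditive_finite finite_nb0)
      (auto intro: event_of_pred pred_live)
  also have "\<dots> \<le> \<rho> ^ n + (\<Sum>z\<in>(nb0 :: 'd lattice set). \<rho> ^ n)"
    by (intro add_mono sum_mono prob_live)
  finally show ?thesis by (simp add: algebra_simps)
qed

lemma excess_local: "depends_on (ball1 v (n + 2) \<times> {..n}) (\<lambda>\<omega>. excess n \<omega> v)"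
  by (auto intro!: depends_onI excess_cong)

lemma excess_measurable [measurable]: "(\<lambda>\<omega>. excess n \<omega> v) \<in> measurable Om (count_space UNIV)"
  by (rule measurable_local[OF _ excess_local]) auto

lemma expectation_excess:
  assumes "n0 \<le> n"
  shows "1 / (6 * real (n + 1) ^ 3) \<le> expectation (\<lambda>\<omega>. real_of_int (excess n \<omega> v))"
proof -
  have "expectation (\<lambda>\<omega>. real_of_int (excess n \<omega> v)) =
      expectation (\<lambda>\<omega>. indicat_real {\<omega>. label n \<omega> v} \<omega> - indicat_real {\<omega>. req n \<omega> v} \<omega>)"
    by (rule Bochner_Integration.integral_cong) (auto simp: excess_def)
  also have "\<dots> = prob {\<omega>. label n \<omega> v} - prob {\<omega>. req n \<omega> v}"
  proof -
    have [simp]: "{\<omega>. label n \<omega> v} \<in> sets Om" "{\<omega>. req n \<omega> v} \<in> sets Om"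
      using pred_label[of n v] pred_req[of n v] by (simp_all add: pred_def)
    show ?thesis
      by (subst Bochner_Integration.integral_diff) (auto simp: emeasure_eq_measure)
  qed
  finally have "expectation (\<lambda>\<omega>. real_of_int (excess n \<omega> v)) = prob {\<omega>. label n \<omega> v} - prob {\<omega>. req n \<omega> v}" .
  moreover have "1 / (3 * real (n + 1) ^ 3) = 1 / (6 * real (n + 1) ^ 3) + 1 / (6 * real (n + 1) ^ 3)"
    by (simp add: field_simps)
  ultimately show ?thesis
    using prob_label[of n v] prob_req[of n v] n0_large[OF assms] by linarith
qed

text \<open>Sites of the same class modulo \<open>2 n + 5\<close> are so far apart that their excesses depend on disjoint
  sets of coordinates.\<close>
lemma prob_class_sum:
  assumes n: "n0 \<le> n" and M: "0 < M"
  shows "prob {\<omega>. (\<Sum>t<M. excess n \<omega> (along v (c + (2 * n + 5) * t))) \<le> 0} \<le>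
    exp (- real M / (72 * real (n + 1) ^ 6))"
proof -
  define w where "w = 2 * n + 5"
  define X where "X t \<omega> = real_of_int (excess n \<omega> (along v (c + w * t)))" for t \<omega>
  define \<eta> where "\<eta> = 1 / (6 * real (n + 1) ^ 3)"
  define J where "J t = ball1 (along v (c + w * t)) (n + 2) \<times> {..n}" for t
  have "disjoint_family_on J {..<M}"
    unfolding disjoint_family_on_def
  proof (intro ballI impI)
    fix s t :: nat assume "s \<noteq> t"
    have *: "ball1 (along v (c + w * i)) (n + 2) \<inter> ball1 (along v (c + w * j)) (n + 2) = {}" if "j < i" for i j
    proof (rule along_balls_disjoint)
      have "w * (j + 1) \<le> w * i" using that by (intro mult_le_mono2) simp
      then show "2 * (n + 2) < c + w * i - (c + w * j)" by (simp add: w_def algebra_simps)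
    qed
    from \<open>s \<noteq> t\<close> show "J s \<inter> J t = {}"
      using *[of s t] *[of t s] by (auto simp: J_def neq_iff)
  qed
  then have ind: "indep_vars (\<lambda>_. borel) X {..<M}"
  proof (rule indep_vars_depends)
    fix t show "depends_on (J t) (X t)"
      using excess_local[of "along v (c + w * t)" n] by (simp add: depends_on_def J_def X_def)
    show "X t \<in> borel_measurable Om" unfolding X_def by measurable
  qed
  interpret H: Hoeffding_ineq Om "{..<M}" X "\<lambda>_. -1" "\<lambda>_. 1" "\<Sum>t<M. expectation (X t)"
    by unfold_locales (use ind in \<open>auto simp: X_def excess_def\<close>)
  have "(\<Sum>t<M. \<eta>) \<le> (\<Sum>t<M. expectation (X t))"
    unfolding X_def \<eta>_def by (intro sum_mono expectation_excess n)
  then have mean: "real M * \<eta> \<le> (\<Sum>t<M. expectation (X t))" by simp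
  have "prob {\<omega>. (\<Sum>t<M. excess n \<omega> (along v (c + w * t))) \<le> 0} \<le>
      prob {\<omega>\<in>space Om. (\<Sum>t<M. X t \<omega>) \<le> (\<Sum>t<M. expectation (X t)) - real M * \<eta>}"
  proof (rule finite_measure_mono)
    show "{\<omega>. (\<Sum>t<M. excess n \<omega> (along v (c + w * t))) \<le> 0} \<subseteq>
        {\<omega>\<in>space Om. (\<Sum>t<M. X t \<omega>) \<le> (\<Sum>t<M. expectation (X t)) - real M * \<eta>}"
    proof clarsimp
      fix \<omega> :: "'d field" assume "(\<Sum>t<M. excess n \<omega> (along v (c + w * t))) \<le> 0"
      then have "real_of_int (\<Sum>t<M. excess n \<omega> (along v (c + w * t))) \<le> 0" by linarith
      then show "(\<Sum>t<M. X t \<omega>) \<le> (\<Sum>t<M. expectation (X t)) - real M * \<eta>"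
        using mean by (simp add: X_def)
    qed
    have [measurable]: "X t \<in> borel_measurable Om" for t unfolding X_def by measurable
    show "{\<omega>\<in>space Om. (\<Sum>t<M. X t \<omega>) \<le> (\<Sum>t<M. expectation (X t)) - real M * \<eta>} \<in> sets Om"
      by measurable
  qed
  also have "\<dots> \<le> exp (- 2 * (real M * \<eta>)\<^sup>2 / (\<Sum>t<M. (1 - - 1)\<^sup>2))"
    by (rule H.Hoeffding_ineq_le) (use M in \<open>auto simp: \<eta>_def\<close>)
  also have "- 2 * (real M * \<eta>)\<^sup>2 / (\<Sum>t<M. (1 - - 1)\<^sup>2) = - real M / (72 * real (n + 1) ^ 6)"
  proof -
    define q where "q = real (n + 1)"
    have "\<eta> = 1 / (6 * q ^ 3)" unfolding \<eta>_def q_def ..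
    then have "\<eta>\<^sup>2 = 1 / (36 * q ^ 6)"
      by (simp add: power_divide power_mult_distrib power_mult[symmetric])
    moreover have "2 * (real M * \<eta>)\<^sup>2 / (real M * 4) = real M * \<eta>\<^sup>2 / 2"
      using M by (simp add: power2_eq_square)
    ultimately have "2 * (real M * \<eta>)\<^sup>2 / (real M * 4) = real M / (72 * q ^ 6)"
      by simp
    then show ?thesis by (simp add: q_def)
  qed
  finally show ?thesis by (simp add: w_def)
qed

lemma sum_residue_classes:
  fixes f :: "nat \<Rightarrow> int"
  assumes "0 < w"
  shows "(\<Sum>i\<in>{1..w * M}. f i) = (\<Sum>c<w. \<Sum>t<M. f (Suc c + w * t))"
  unfolding sum.cartesian_product
proof (rule sum.reindex_bij_witness[of _ "\<lambda>(c, t). Suc c + w * t" "\<lambda>i. ((i - 1) mod w, (i - 1) div w)"])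
  fix i assume "i \<in> {1..w * M}"
  then have i: "i - 1 < w * M" "1 \<le> i" by auto
  then show "((i - 1) mod w, (i - 1) div w) \<in> {..<w} \<times> {..<M}"
    using assms by (auto simp: less_mult_imp_div_less mult.commute)
  show "(case ((i - 1) mod w, (i - 1) div w) of (c, t) \<Rightarrow> Suc c + w * t) = i"
    using i by simp
  show "(case ((i - 1) mod w, (i - 1) div w) of (c, t) \<Rightarrow> f (Suc c + w * t)) = f i"
    using i by simp
next
  fix p assume "p \<in> {..<w} \<times> {..<M}"
  then obtain c t where p: "p = (c, t)" "c < w" "t < M" by auto
  have "c + w * t < w * Suc t" using p by simp
  also have "w * Suc t \<le> w * M" using p by (intro mult_le_mono2) simp
  finally show "(case p of (c, t) \<Rightarrow> Suc c + w * t) \<in> {1..w * M}" by (simp add: p)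
  show "(((case p of (c, t) \<Rightarrow> Suc c + w * t) - 1) mod w, ((case p of (c, t) \<Rightarrow> Suc c + w * t) - 1) div w) = p"
    using p by simp
qed

lemma hit_local: "depends_on (ball1 v (j + n + 2) \<times> {..n}) (\<lambda>\<omega>. hit n \<omega> v j)"
  by (auto intro!: depends_onI hit_cong)

lemma pred_hit [measurable]: "Measurable.pred Om (\<lambda>\<omega>. hit n \<omega> v j)"
  by (rule measurable_local[OF _ hit_local]) auto

lemma prob_no_hit:
  assumes n: "n0 \<le> n" and M: "0 < M"
  shows "prob {\<omega>. \<not> hit n \<omega> v ((2 * n + 5) * M)} \<le>
    real (2 * n + 5) * exp (- real M / (72 * real (n + 1) ^ 6))"
proof -
  let ?w = "2 * n + 5"
  let ?E = "\<lambda>c. {\<omega>. (\<Sum>t<M. excess n \<omega> (along v (Suc c + ?w * t))) \<le> 0}"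
  have Em: "?E c \<in> sets Om" for c
  proof -
    have "Measurable.pred Om (\<lambda>\<omega>. (\<Sum>t<M. excess n \<omega> (along v (Suc c + ?w * t))) \<le> 0)"
      by (rule measurable_local[where J="(\<Union>t<M. ball1 (along v (Suc c + ?w * t)) (n + 2)) \<times> {..n}"])
        (simp, rule depends_onI, rule arg_cong[where f="\<lambda>s. s \<le> 0"],
          rule sum.cong[OF refl], rule excess_cong, blast)
    then show ?thesis by (rule event_of_pred)
  qed
  have "{\<omega>. \<not> hit n \<omega> v (?w * M)} \<subseteq> (\<Union>c<?w. ?E c)"
  proof (rule subsetI, rule ccontr)
    fix \<omega> :: "'d field" assume nh: "\<omega> \<in> {\<omega>. \<not> hit n \<omega> v (?w * M)}" and "\<omega> \<notin> (\<Union>c<?w. ?E c)"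
    then have pos: "1 \<le> (\<Sum>t<M. excess n \<omega> (along v (Suc c + ?w * t)))" if "c < ?w" for c
      using that by (force simp: not_le)
    have "(\<Sum>c<?w. 1) \<le> (\<Sum>c<?w. \<Sum>t<M. excess n \<omega> (along v (Suc c + ?w * t)))"
      by (rule sum_mono) (rule pos, simp)
    also have "\<dots> = (\<Sum>i\<in>{1..?w * M}. excess n \<omega> (along v i))"
      by (rule sum_residue_classes[symmetric]) simp
    finally have "hit n \<omega> v (?w * M)"
      using M by (intro hit_if_positive) auto
    with nh show False by simp
  qed
  then have "prob {\<omega>. \<not> hit n \<omega> v (?w * M)} \<le> prob (\<Union>c<?w. ?E c)"
    by (rule finite_measure_mono) (use Em in auto)
  also have "\<dots> \<le> (\<Sum>c<?w. prob (?E c))"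
    by (rule finite_measure_subadditive_finite) (use Em in auto)
  also have "\<dots> \<le> (\<Sum>c<?w. exp (- real M / (72 * real (n + 1) ^ 6)))"
    by (intro sum_mono prob_class_sum n M)
  finally show ?thesis by simp
qed

text \<open>The factor \<open>72 N\<^sup>7\<close> turns the exponent of \<open>prob_no_hit\<close> into at most \<open>-N\<close> for all times below \<open>N\<close>; the
  other factor bounds the number of residue classes at these times.\<close>
definition window :: "nat \<Rightarrow> nat" where
  "window N = (2 * N + 5) * (72 * N ^ 7)"

definition good :: "nat \<Rightarrow> 'd field \<Rightarrow> bool" where
  "good N w \<longleftrightarrow> dead N w 0 \<and>
     (\<forall>n\<in>{n0..<N}. \<forall>v\<in>ball1 0 (reach N (window N)). \<exists>j\<in>{..window N}. hit n w v j)"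

definition radius :: "nat \<Rightarrow> nat" where
  "radius N = reach N (window N) + N + 1"

lemma pred_good [measurable]: "Measurable.pred Om (\<lambda>\<omega>. good N \<omega>)"
  unfolding good_def dead_def by (intro pred_intros_logic pred_intros_finite pred_live pred_hit) auto

lemma radius_le: "radius N \<le> 366 * (N + 1) ^ 9"
proof -
  define m where "m = N + 1"
  have m: "1 \<le> m" "N \<le> m" by (auto simp: m_def)
  have p8: "m * m ^ 7 = m ^ 8" and p9: "m * m ^ 8 = m ^ 9"
    using power_Suc[of m 7] power_Suc[of m 8] by simp_all
  have "window N \<le> (5 * m) * (72 * m ^ 7)"
    unfolding window_def by (intro mult_le_mono power_mono) (auto simp: m_def)
  also have "\<dots> = 360 * m ^ 8" by (simp add: p8[symmetric])
  finally have w: "window N \<le> 360 * m ^ 8" .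
  have 1: "1 \<le> m ^ 8" by (rule one_le_power[OF m(1)])
  have "radius N = N * (window N + 3) + 2 * m" by (simp add: radius_def reach_def m_def)
  also have "\<dots> \<le> m * (window N + 3) + 2 * m" by (rule add_right_mono[OF mult_le_mono1[OF m(2)]])
  also have "\<dots> = m * (window N + 5)" by (simp add: algebra_simps)
  also have "\<dots> \<le> m * (366 * m ^ 8)"
    using w 1 by (intro mult_le_mono2) linarith
  also have "\<dots> = 366 * m ^ 9" by (simp add: p9[symmetric])
  finally show ?thesis by (simp add: m_def)
qed

lemma prob_not_good:
  "\<exists>A k b. 0 < A \<and> 0 < b \<and> b < 1 \<and>
    (\<forall>N. prob {\<omega>. \<not> good N \<omega>} \<le> A * real (N + 1) ^ k * b ^ N)"
proof -
  define D where "D = CARD('d)"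
  define b where "b = max \<rho> (exp (- 1))"
  define A :: real where "A = 6 * 733 ^ D"
  have b: "0 < b" "b < 1" using rho by (auto simp: b_def)
  have "prob {\<omega>. \<not> good N \<omega>} \<le> A * real (N + 1) ^ (9 * D + 2) * b ^ N" for N
  proof (cases "N = 0")
    case True
    have "(1::real) \<le> 733 ^ D" by (rule one_le_power) simp
    then have "1 \<le> A" unfolding A_def by linarith
    then show ?thesis using order_trans[OF prob_le_1[of "{\<omega>. \<not> good N \<omega>}"], of A] True by simp
  next
    case False
    let ?R = "reach N (window N)"
    let ?F = "\<lambda>n v. {\<omega>. \<not> hit n \<omega> v ((2 * n + 5) * (72 * N ^ 7))}"
    let ?m = "real (N + 1)"
    have Fm: "?F n v \<in> sets Om" for n v
      by (intro event_of_pred pred_intros_logic pred_hit)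
    have Lm: "{\<omega>. live N \<omega> v} \<in> sets Om" for v using pred_live[of N v] by (simp add: pred_def)
    have card: "real (card (ball1 (0 :: 'd lattice) r)) \<le> 733 ^ D * ?m ^ (9 * D)" if "r \<le> radius N" for r
    proof -
      have "2 * r + 1 \<le> 2 * (366 * (N + 1) ^ 9) + (N + 1) ^ 9"
        using that radius_le[of N] one_le_power[of "N + 1" 9] by linarith
      then have "(2 * r + 1) ^ D \<le> (733 * (N + 1) ^ 9) ^ D" by (intro power_mono) auto
      then have "card (ball1 (0 :: 'd lattice) r) \<le> (733 * (N + 1) ^ 9) ^ D"
        using card_ball1[of "0 :: 'd lattice" r] unfolding D_def by linarith
      then have "real (card (ball1 (0 :: 'd lattice) r)) \<le> real ((733 * (N + 1) ^ 9) ^ D)"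
        by (rule of_nat_mono)
      then show ?thesis by (simp add: power_mult_distrib power_mult)
    qed
    have "{\<omega>. \<not> good N \<omega>} \<subseteq> (\<Union>v\<in>ball1 0 N. {\<omega>. live N \<omega> v}) \<union> (\<Union>n\<in>{n0..<N}. \<Union>v\<in>ball1 0 ?R. ?F n v)"
    proof (rule subsetI, rule ccontr)
      fix \<omega> :: "'d field"
      assume ng: "\<omega> \<in> {\<omega>. \<not> good N \<omega>}"
        and not: "\<omega> \<notin> (\<Union>v\<in>ball1 0 N. {\<omega>. live N \<omega> v}) \<union> (\<Union>n\<in>{n0..<N}. \<Union>v\<in>ball1 0 ?R. ?F n v)"
      have "dead N \<omega> 0" using not by (auto simp: dead_def)
      moreover have "\<exists>j\<in>{..window N}. hit n \<omega> v j" if "n \<in> {n0..<N}" "v \<in> ball1 0 ?R" for n v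
      proof (rule bexI)
        show "hit n \<omega> v ((2 * n + 5) * (72 * N ^ 7))" using not that by auto
        show "(2 * n + 5) * (72 * N ^ 7) \<in> {..window N}"
          using that(1) unfolding window_def by (auto intro!: mult_le_mono1)
      qed
      ultimately have "good N \<omega>" by (simp add: good_def)
      with ng show False by simp
    qed
    then have "prob {\<omega>. \<not> good N \<omega>} \<le>
        prob ((\<Union>v\<in>ball1 0 N. {\<omega>. live N \<omega> v}) \<union> (\<Union>n\<in>{n0..<N}. \<Union>v\<in>ball1 0 ?R. ?F n v))"
      by (rule finite_measure_mono) (use Fm Lm in \<open>auto intro!: sets.finite_UN sets.Un\<close>)
    also have "\<dots> \<le> prob (\<Union>v\<in>ball1 0 N. {\<omega>. live N \<omega> v}) + prob (\<Union>n\<in>{n0..<N}. \<Union>v\<in>ball1 0 ?R. ?F n v)"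
      by (rule measure_Un_le) (use Fm Lm in \<open>auto intro!: sets.finite_UN\<close>)
    also have "prob (\<Union>v\<in>ball1 0 N. {\<omega>. live N \<omega> v}) \<le> (\<Sum>v\<in>ball1 (0 :: 'd lattice) N. \<rho> ^ N)"
      by (rule order_trans[OF finite_measure_subadditive_finite sum_mono[OF prob_live]]) (use Lm in auto)
    also have "(\<Sum>v\<in>ball1 (0 :: 'd lattice) N. \<rho> ^ N) \<le> (733 ^ D * ?m ^ (9 * D)) * b ^ N"
      using card[of N] rho by (auto simp: radius_def b_def intro!: mult_mono power_mono)
    also have "prob (\<Union>n\<in>{n0..<N}. \<Union>v\<in>ball1 0 ?R. ?F n v) \<le>
        (\<Sum>n\<in>{n0..<N}. \<Sum>v\<in>ball1 (0 :: 'd lattice) ?R. 5 * ?m * b ^ N)"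
    proof (rule order_trans[OF finite_measure_subadditive_finite sum_mono])
      fix n assume n: "n \<in> {n0..<N}"
      show "prob (\<Union>v\<in>ball1 0 ?R. ?F n v) \<le> (\<Sum>v\<in>ball1 (0 :: 'd lattice) ?R. 5 * ?m * b ^ N)"
      proof (rule order_trans[OF finite_measure_subadditive_finite sum_mono])
        fix v :: "'d lattice"
        have "prob (?F n v) \<le> real (2 * n + 5) * exp (- real (72 * N ^ 7) / (72 * real (n + 1) ^ 6))"
          by (rule prob_no_hit) (use n False in auto)
        also have "\<dots> \<le> (5 * ?m) * exp (- real N)"
        proof (intro mult_mono)
          have "real (n + 1) ^ 6 \<le> real N ^ 6" using n by (intro power_mono) auto
          then have "real N * real (n + 1) ^ 6 \<le> real N * real N ^ 6" by (rule mult_left_mono) simp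
          also have "\<dots> = real N ^ 7" by (simp add: eval_nat_numeral)
          finally have "real N \<le> real N ^ 7 / real (n + 1) ^ 6" by (simp add: pos_le_divide_eq)
          then show "exp (- real (72 * N ^ 7) / (72 * real (n + 1) ^ 6)) \<le> exp (- real N)" by simp
        qed (use n in auto)
        also have "exp (- real N) = exp (- 1) ^ N" by (simp add: exp_of_nat_mult[symmetric])
        also have "5 * ?m * exp (- 1) ^ N \<le> 5 * ?m * b ^ N"
          by (intro mult_left_mono power_mono) (auto simp: b_def)
        finally show "prob (?F n v) \<le> 5 * ?m * b ^ N" .
      qed (use Fm in auto)
    qed (use Fm in \<open>auto intro!: sets.finite_UN\<close>)
    also have "(\<Sum>n\<in>{n0..<N}. \<Sum>v\<in>ball1 (0 :: 'd lattice) ?R. 5 * ?m * b ^ N) \<le>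
        ?m * ((733 ^ D * ?m ^ (9 * D)) * (5 * ?m * b ^ N))"
      using card[of ?R] b by (auto simp: radius_def intro!: mult_mono)
    also have "(733 ^ D * ?m ^ (9 * D)) * b ^ N + ?m * ((733 ^ D * ?m ^ (9 * D)) * (5 * ?m * b ^ N)) =
        (733 ^ D * ?m ^ (9 * D) * b ^ N) * (1 + 5 * ?m ^ 2)"
      by (simp add: algebra_simps power2_eq_square)
    also have "\<dots> \<le> (733 ^ D * ?m ^ (9 * D) * b ^ N) * (6 * ?m ^ 2)"
      using b by (intro mult_left_mono) auto
    also have "\<dots> = A * ?m ^ (9 * D + 2) * b ^ N"
      by (simp add: A_def power_add power2_eq_square)
    finally show ?thesis by simp
  qed
  moreover have "0 < A" by (simp add: A_def)
  ultimately show ?thesis using b by blast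
qed

end

section \<open>Invariance of the random field under the dynamics\<close>

locale spin_field = prob_space \<mu>
  for S :: "'a set" and \<mu> :: "('d::finite lattice \<Rightarrow> 'a) measure" +
  assumes finite_spins: "finite S"
    and sets_field: "sets \<mu> = sets (PiM UNIV (\<lambda>_. count_space S))"
begin

lemma space_field: "space \<mu> = {x. \<forall>v. x v \<in> S}"
  using sets_eq_imp_space_eq[OF sets_field] by (auto simp: space_PiM PiE_iff)

lemma config_in: "x \<in> space \<mu> \<Longrightarrow> x v \<in> S"
  by (simp add: space_field)

lemma cylinder_sets: "finite B \<Longrightarrow> {x \<in> space \<mu>. \<forall>b\<in>B. x b = \<eta> b} \<in> sets \<mu>"
proof -
  assume B: "finite B"
  have [measurable]: "(\<lambda>x. x b) \<in> measurable \<mu> (count_space S)" for b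
    unfolding measurable_cong_sets[OF sets_field refl] by (rule measurable_component_singleton) simp
  have "{x \<in> space \<mu>. x b = \<eta> b} \<in> sets \<mu>" for b
  proof -
    have "(\<lambda>x. x b) -` ({\<eta> b} \<inter> S) \<inter> space \<mu> \<in> sets \<mu>"
      by (rule measurable_sets[of _ _ "count_space S"]) auto
    also have "(\<lambda>x. x b) -` ({\<eta> b} \<inter> S) \<inter> space \<mu> = {x \<in> space \<mu>. x b = \<eta> b}"
      by (auto simp: space_field)
    finally show ?thesis .
  qed
  with B show ?thesis by (intro sets.sets_Collect_finite_All)
qed

text \<open>Reduces local events to cylinders, both for the configuration itself (\<open>T\<close> the identity) and after
  a step of the dynamics.\<close>
lemma
  assumes B: "finite B"
    and T: "\<And>x b. x \<in> space \<mu> \<Longrightarrow> b \<in> B \<Longrightarrow> T x b \<in> S"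
    and meas: "\<And>\<eta>. {x \<in> space \<mu>. \<forall>b\<in>B. T x b = \<eta> b} \<in> sets \<mu>"
    and P: "\<And>x y. (\<And>b. b \<in> B \<Longrightarrow> x b = y b) \<Longrightarrow> P x = P y"
  shows split_sum: "measure \<mu> {x \<in> space \<mu>. P (T x)} =
      (\<Sum>\<eta> | \<eta> \<in> PiE B (\<lambda>_. S) \<and> P \<eta>. measure \<mu> {x \<in> space \<mu>. \<forall>b\<in>B. T x b = \<eta> b})"
    and split_sets: "{x \<in> space \<mu>. P (T x)} \<in> sets \<mu>"
proof -
  let ?I = "{\<eta> \<in> PiE B (\<lambda>_. S). P \<eta>}" and ?C = "\<lambda>\<eta>. {x \<in> space \<mu>. \<forall>b\<in>B. T x b = \<eta> b}"
  have fin: "finite ?I"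
    by (rule finite_subset[OF _ finite_PiE[OF B]]) (use finite_spins in auto)
  have eq: "{x \<in> space \<mu>. P (T x)} = (\<Union>\<eta>\<in>?I. ?C \<eta>)"
  proof safe
    fix x assume x: "x \<in> space \<mu>" "P (T x)"
    have "restrict (T x) B \<in> ?I" using x T P[of "restrict (T x) B" "T x"] by auto
    moreover have "x \<in> ?C (restrict (T x) B)" using x by auto
    ultimately show "x \<in> (\<Union>\<eta>\<in>?I. ?C \<eta>)" by blast
  next
    fix x \<eta> assume "P \<eta>" "\<forall>b\<in>B. T x b = \<eta> b"
    then show "P (T x)" using P[of "T x" \<eta>] by auto
  qed
  have disj: "disjoint_family_on ?C ?I"
    unfolding disjoint_family_on_def
  proof (intro ballI impI)
    fix \<eta> \<eta>' assume "\<eta> \<in> ?I" "\<eta>' \<in> ?I" "\<eta> \<noteq> \<eta>'"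
    then obtain b where "b \<in> B" "\<eta> b \<noteq> \<eta>' b" by (auto dest: PiE_ext)
    then show "?C \<eta> \<inter> ?C \<eta>' = {}" by auto
  qed
  show "measure \<mu> {x \<in> space \<mu>. P (T x)} = (\<Sum>\<eta>\<in>?I. measure \<mu> (?C \<eta>))"
    unfolding eq by (rule finite_measure_finite_Union[OF fin _ disj]) (use meas in auto)
  show "{x \<in> space \<mu>. P (T x)} \<in> sets \<mu>"
    unfolding eq using fin meas by (intro sets.finite_UN) auto
qed

lemma local_sets:
  assumes "finite B" "\<And>x y. (\<And>b. b \<in> B \<Longrightarrow> x b = y b) \<Longrightarrow> P x = P y"
  shows "{x \<in> space \<mu>. P x} \<in> sets \<mu>"
proof (rule split_sets[where T="\<lambda>x. x", OF assms(1) _ _ assms(2)])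
  show "{x \<in> space \<mu>. \<forall>b\<in>B. x b = \<eta> b} \<in> sets \<mu>" for \<eta>
    by (rule cylinder_sets[OF assms(1)])
qed (auto simp: space_field)

end

text \<open>The heat-bath assumption says that the updates sample the conditional law of the spin at \<open>v\<close> given any
  finite set of other spins that contains the neighbours of \<open>v\<close>.\<close>
locale mrf_dynamics = subcritical_dynamics upd obl S s0 n0 letter_law update_law \<rho> + mu: spin_field S \<mu>
  for upd :: "nat \<Rightarrow> ('d::finite lattice \<Rightarrow> 'a) \<Rightarrow> 'a" and obl S s0 n0 letter_law update_law \<rho>
    and \<mu> :: "('d lattice \<Rightarrow> 'a) measure" +
  assumes heat_bath: "finite B \<Longrightarrow> v \<notin> B \<Longrightarrow> (\<And>z. z \<in> nb0 \<Longrightarrow> v + z \<in> B) \<Longrightarrow>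
      measure \<mu> {x \<in> space \<mu>. x v = s \<and> (\<forall>b\<in>B. x b = \<eta> b)} =
      measure (measure_pmf update_law) {k. upd k (\<lambda>z\<in>nb0. \<eta> (v + z)) = s} *
      measure \<mu> {x \<in> space \<mu>. \<forall>b\<in>B. x b = \<eta> b}"
begin

definition cyl_prob :: "'d lattice set \<Rightarrow> ('d lattice \<Rightarrow> 'a) \<Rightarrow> real" where
  "cyl_prob B \<eta> = measure \<mu> {x \<in> space \<mu>. \<forall>b\<in>B. x b = \<eta> b}"

text \<open>Since the sites of \<open>A\<close> are pairwise non-adjacent, they can be removed one after the other without
  ever losing a neighbour of a remaining one.\<close>
lemma cyl_heat_bath:
  assumes "finite A" "finite B" "A \<subseteq> B"
    and "\<And>v z. v \<in> A \<Longrightarrow> z \<in> nb0 \<Longrightarrow> v + z \<in> B - A"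
  shows "cyl_prob B \<eta> = (\<Prod>v\<in>A. measure (measure_pmf update_law) {k. upd k (\<lambda>z\<in>nb0. \<eta> (v + z)) = \<eta> v}) * cyl_prob (B - A) \<eta>"
  using assms
proof (induction A arbitrary: B rule: finite_induct)
  case (insert v A)
  let ?p = "\<lambda>v. measure (measure_pmf update_law) {k. upd k (\<lambda>z\<in>nb0. \<eta> (v + z)) = \<eta> v}"
  have eq: "{x \<in> space \<mu>. \<forall>b\<in>B. x b = \<eta> b} = {x \<in> space \<mu>. x v = \<eta> v \<and> (\<forall>b\<in>B - {v}. x b = \<eta> b)}"
    using insert.prems(2) by auto
  have "cyl_prob B \<eta> = ?p v * cyl_prob (B - {v}) \<eta>"
    unfolding cyl_prob_def eq
  proof (rule heat_bath)
    fix z :: "'d lattice" assume "z \<in> nb0"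
    then show "v + z \<in> B - {v}" using insert.prems(3)[of v z] by auto
  qed (use insert.prems in auto)
  also have "cyl_prob (B - {v}) \<eta> = (\<Prod>v\<in>A. ?p v) * cyl_prob (B - {v} - A) \<eta>"
    by (rule insert.IH) (use insert.prems insert.hyps in auto)
  also have "B - {v} - A = B - insert v A" by auto
  finally show ?case using insert.hyps by (simp add: mult.assoc)
qed simp

definition halo :: "'d lattice set \<Rightarrow> 'd lattice set" where
  "halo B = B \<union> (\<lambda>(b, z). b + z) ` (B \<times> nb0)"

lemma finite_halo: "finite B \<Longrightarrow> finite (halo B)"
  by (simp add: halo_def)

definition active_sites :: "'d lattice set \<Rightarrow> ('d lattice \<Rightarrow> bool) \<Rightarrow> 'd lattice set" where
  "active_sites B \<alpha> = {v \<in> B. \<alpha> v \<and> (\<forall>z\<in>nb0. \<not> \<alpha> (v + z))}"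

text \<open>Resampling only the active sites in \<open>B\<close> has the same effect on \<open>B\<close>, but leaves a finite event on \<open>halo B\<close>,
  where all neighbours of resampled sites are visible.\<close>
definition inner_step :: "'d lattice set \<Rightarrow> nat \<Rightarrow> 'd field \<Rightarrow> ('d lattice \<Rightarrow> 'a) \<Rightarrow> 'd lattice \<Rightarrow> 'a" where
  "inner_step B n w x v = (if v \<in> B then step n w x v else x v)"

text \<open>The coins on \<open>halo B\<close> show \<open>\<alpha>\<close>, and all resampled sites happen to receive the spins of \<open>\<eta>\<close>.\<close>
definition pattern :: "'d lattice set \<Rightarrow> nat \<Rightarrow> ('d lattice \<Rightarrow> 'a) \<Rightarrow> ('d lattice \<Rightarrow> bool) \<Rightarrow> 'd field set" where
  "pattern B n \<eta> \<alpha> = {\<omega>. \<forall>b\<in>halo B. \<omega> (b, Suc n) \<in>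
     {\<alpha> b} \<times> (if b \<in> active_sites B \<alpha> then {k. upd k (\<lambda>z\<in>nb0. \<eta> (b + z)) = \<eta> b} else UNIV)}"

text \<open>The result is \<open>\<eta>\<close> if and only if the spins that were not resampled agree with \<open>\<eta>\<close> and every resampled
  site received the spin of \<open>\<eta>\<close>; the latter is an event about the symbols alone, because the neighbours
  of a resampled site are not resampled.\<close>
lemma inner_step_cyl:
  fixes w :: "'d field"
  assumes B: "finite B"
  shows "measure \<mu> {x \<in> space \<mu>. \<forall>b\<in>halo B. inner_step B n w x b = \<eta> b} =
    (\<Sum>\<alpha>\<in>PiE (halo B) (\<lambda>_. UNIV). indicator (pattern B n \<eta> \<alpha>) w * cyl_prob (halo B - active_sites B \<alpha>) \<eta>)"
proof -
  define \<alpha>0 where "\<alpha>0 = (\<lambda>b\<in>halo B. fst (w (b, Suc n)))"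
  define A where "A = active_sites B \<alpha>0"
  have nbB: "b + z \<in> halo B" if "b \<in> B" "z \<in> nb0" for b z using that by (force simp: halo_def)
  have act: "act n w b \<longleftrightarrow> b \<in> A" if "b \<in> B" for b
    using that nbB[OF that] by (auto simp: A_def active_sites_def act_def \<alpha>0_def halo_def)
  have nbA: "b + z \<in> halo B - A" if "b \<in> A" "z \<in> nb0" for b z
    using that nbB[of b z] by (auto simp: A_def active_sites_def)
  have AB: "A \<subseteq> B" by (auto simp: A_def active_sites_def)
  have sub: "B \<subseteq> halo B" by (auto simp: halo_def)
  define ok where "ok \<longleftrightarrow> (\<forall>b\<in>A. upd (snd (w (b, Suc n))) (\<lambda>z\<in>nb0. \<eta> (b + z)) = \<eta> b)"
  have eqx: "(\<forall>b\<in>halo B. inner_step B n w x b = \<eta> b) \<longleftrightarrow> ok \<and> (\<forall>b\<in>halo B - A. x b = \<eta> b)" for x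
  proof -
    have off: "inner_step B n w x b = x b" if "b \<in> halo B - A" for b
      using that act[of b] by (auto simp: inner_step_def step_def)
    have on: "inner_step B n w x b = upd (snd (w (b, Suc n))) (\<lambda>z\<in>nb0. x (b + z))" if "b \<in> A" for b
      using that act[of b] AB by (auto simp: inner_step_def step_def)
    have cong: "(\<lambda>z\<in>nb0. x (b + z)) = (\<lambda>z\<in>nb0. \<eta> (b + z))"
      if "\<forall>b\<in>halo B - A. x b = \<eta> b" "b \<in> A" for b
      using that nbA[OF that(2)] by (auto simp: restrict_def fun_eq_iff)
    show ?thesis
    proof
      assume l: "\<forall>b\<in>halo B. inner_step B n w x b = \<eta> b"
      then have r: "\<forall>b\<in>halo B - A. x b = \<eta> b" using off by auto
      moreover have ok unfolding ok_def
      proof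
        fix b assume b: "b \<in> A"
        then have "inner_step B n w x b = \<eta> b" using l AB sub by blast
        then show "upd (snd (w (b, Suc n))) (\<lambda>z\<in>nb0. \<eta> (b + z)) = \<eta> b"
          unfolding on[OF b] cong[OF r b] .
      qed
      ultimately show "ok \<and> (\<forall>b\<in>halo B - A. x b = \<eta> b)" by blast
    next
      assume r: "ok \<and> (\<forall>b\<in>halo B - A. x b = \<eta> b)"
      then have r2: "\<forall>b\<in>halo B - A. x b = \<eta> b" by blast
      show "\<forall>b\<in>halo B. inner_step B n w x b = \<eta> b"
      proof
        fix b assume b: "b \<in> halo B"
        show "inner_step B n w x b = \<eta> b"
        proof (cases "b \<in> A")
          case True
          then show ?thesis using r on[OF True] cong[OF r2 True] by (simp add: ok_def)
        next
          case False
          then show ?thesis using r2 off[of b] b by simp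
        qed
      qed
    qed
  qed
  have "measure \<mu> {x \<in> space \<mu>. \<forall>b\<in>halo B. inner_step B n w x b = \<eta> b} =
      of_bool ok * cyl_prob (halo B - A) \<eta>"
    unfolding eqx cyl_prob_def by (cases ok) simp_all
  also have "of_bool ok = (indicator (pattern B n \<eta> \<alpha>0) w :: real)"
  proof -
    have "fst (w (b, Suc n)) = \<alpha>0 b" if "b \<in> halo B" for b using that by (simp add: \<alpha>0_def)
    then have "w \<in> pattern B n \<eta> \<alpha>0 \<longleftrightarrow> ok"
      unfolding pattern_def A_def[symmetric] ok_def using AB sub by (auto simp: mem_Times_iff)
    then show ?thesis by (simp add: indicator_def)
  qed
  also have "indicator (pattern B n \<eta> \<alpha>0) w * cyl_prob (halo B - A) \<eta> =
      (\<Sum>\<alpha>\<in>PiE (halo B) (\<lambda>_. UNIV). if \<alpha> = \<alpha>0 then indicator (pattern B n \<eta> \<alpha>0) w * cyl_prob (halo B - A) \<eta> else 0)"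
    by (subst sum.delta) (auto simp: \<alpha>0_def B finite_halo intro!: finite_PiE)
  also have "\<dots> = (\<Sum>\<alpha>\<in>PiE (halo B) (\<lambda>_. UNIV).
      indicator (pattern B n \<eta> \<alpha>) w * cyl_prob (halo B - active_sites B \<alpha>) \<eta>)"
  proof (rule sum.cong[OF refl])
    fix \<alpha> :: "'d lattice \<Rightarrow> bool" assume \<alpha>: "\<alpha> \<in> PiE (halo B) (\<lambda>_. UNIV)"
    have "w \<notin> pattern B n \<eta> \<alpha>" if ne: "\<alpha> \<noteq> \<alpha>0"
    proof
      assume "w \<in> pattern B n \<eta> \<alpha>"
      then have "\<alpha> b = \<alpha>0 b" if "b \<in> halo B" for b
        using that by (auto simp: pattern_def \<alpha>0_def mem_Times_iff)
      then have "\<alpha> = \<alpha>0" using \<alpha> by (intro PiE_ext[OF \<alpha>]) (auto simp: \<alpha>0_def)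
      with ne show False ..
    qed
    then show "(if \<alpha> = \<alpha>0 then indicator (pattern B n \<eta> \<alpha>0) w * cyl_prob (halo B - A) \<eta> else 0) =
        indicator (pattern B n \<eta> \<alpha>) w * cyl_prob (halo B - active_sites B \<alpha>) \<eta>"
      by (auto simp: A_def)
  qed
  finally show ?thesis .
qed

lemma prob_pattern:
  assumes B: "finite B"
  shows "prob (pattern B n \<eta> \<alpha>) = (1 / 2) ^ card (halo B) *
    (\<Prod>v\<in>active_sites B \<alpha>. measure (measure_pmf update_law) {k. upd k (\<lambda>z\<in>nb0. \<eta> (v + z)) = \<eta> v})"
proof -
  let ?K = "\<lambda>b. {k. upd k (\<lambda>z\<in>nb0. \<eta> (b + z)) = \<eta> b}"
  let ?L = "\<lambda>b. if b \<in> active_sites B \<alpha> then ?K b else UNIV"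
  let ?F = "(\<lambda>b. (b, Suc n)) ` halo B"
  have "pattern B n \<eta> \<alpha> = {\<omega>. \<forall>i\<in>?F. \<omega> i \<in> {\<alpha> (fst i)} \<times> ?L (fst i)}"
    by (auto simp: pattern_def)
  then have "prob (pattern B n \<eta> \<alpha>) = (\<Prod>i\<in>?F. measure (measure_pmf (coord_law i)) ({\<alpha> (fst i)} \<times> ?L (fst i)))"
    using prob_coords[of ?F "\<lambda>i. {\<alpha> (fst i)} \<times> ?L (fst i)"] finite_halo[OF B] by simp
  also have "\<dots> = (\<Prod>b\<in>halo B. measure (measure_pmf symbol_law) ({\<alpha> b} \<times> ?L b))"
    by (subst prod.reindex) (auto simp: inj_on_def coord_law_def cong: if_cong)
  also have "\<dots> = (\<Prod>b\<in>halo B. 1 / 2 * measure (measure_pmf update_law) (?L b))"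
    by (rule prod.cong[OF refl])
      (simp add: symbol_law_def measure_pmf_prob_product measure_pmf_single del: measure_pmf_UNIV)
  also have "\<dots> = (1 / 2) ^ card (halo B) * (\<Prod>b\<in>halo B. measure (measure_pmf update_law) (?L b))"
    by (simp only: prod.distrib prod_constant)
  also have "(\<Prod>b\<in>halo B. measure (measure_pmf update_law) (?L b)) = (\<Prod>b\<in>active_sites B \<alpha>. measure (measure_pmf update_law) (?K b))"
    by (rule prod.mono_neutral_cong_right)
      (use finite_halo[OF B] in \<open>auto simp: active_sites_def halo_def\<close>)
  finally show ?thesis .
qed

lemma pattern_sets: "finite B \<Longrightarrow> pattern B n \<eta> \<alpha> \<in> sets Om"
  unfolding pattern_def
  by (rule event_of_pred, rule measurable_local[where J="halo B \<times> {Suc n}"])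
    (auto simp: finite_halo depends_on_def)

text \<open>For every coin pattern the probability that the updates produce \<open>\<eta>\<close> on the resampled sites is
  exactly the factor which \<open>cyl_heat_bath\<close> splits off; what remains is a sum over all
  coin patterns of their probability.\<close>
lemma expectation_inner_step:
  assumes B: "finite B"
  shows "expectation (\<lambda>\<omega>. measure \<mu> {x \<in> space \<mu>. \<forall>b\<in>halo B. inner_step B n \<omega> x b = \<eta> b}) = cyl_prob (halo B) \<eta>"
proof -
  let ?P = "PiE (halo B) (\<lambda>_. UNIV :: bool set)"
  have "expectation (\<lambda>\<omega>. measure \<mu> {x \<in> space \<mu>. \<forall>b\<in>halo B. inner_step B n \<omega> x b = \<eta> b}) =
      (\<Sum>\<alpha>\<in>?P. prob (pattern B n \<eta> \<alpha>) * cyl_prob (halo B - active_sites B \<alpha>) \<eta>)"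
    unfolding inner_step_cyl[OF B]
    by (subst Bochner_Integration.integral_sum)
      (auto simp: pattern_sets[OF B] emeasure_eq_measure)
  also have "\<dots> = (\<Sum>\<alpha>\<in>?P. (1 / 2) ^ card (halo B) * cyl_prob (halo B) \<eta>)"
  proof (rule sum.cong[OF refl])
    fix \<alpha> assume "\<alpha> \<in> ?P"
    have "cyl_prob (halo B) \<eta> = (\<Prod>v\<in>active_sites B \<alpha>. measure (measure_pmf update_law) {k. upd k (\<lambda>z\<in>nb0. \<eta> (v + z)) = \<eta> v}) *
        cyl_prob (halo B - active_sites B \<alpha>) \<eta>"
      by (rule cyl_heat_bath) (use B finite_halo[OF B] in \<open>force simp: active_sites_def halo_def\<close>)+
    then show "prob (pattern B n \<eta> \<alpha>) * cyl_prob (halo B - active_sites B \<alpha>) \<eta> =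
        (1 / 2) ^ card (halo B) * cyl_prob (halo B) \<eta>"
      by (simp add: prob_pattern[OF B])
  qed
  also have "\<dots> = real (card ?P) * ((1 / 2) ^ card (halo B) * cyl_prob (halo B) \<eta>)" by simp
  also have "card ?P = 2 ^ card (halo B)"
    using finite_halo[OF B] by (simp add: card_PiE)
  finally show ?thesis by (simp add: power_one_over)
qed

lemma inner_step_in: "x \<in> space \<mu> \<Longrightarrow> inner_step B n w x b \<in> S"
  by (simp add: inner_step_def step_def mu.space_field upd_in)

lemma step_in: "x \<in> space \<mu> \<Longrightarrow> step n w x b \<in> S"
  by (simp add: step_def mu.space_field upd_in)

lemma step_cong_halo:
  assumes "\<And>b. b \<in> halo B \<Longrightarrow> x b = y b" "b \<in> B"
  shows "step n w x b = step n w y b"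
proof -
  have "x (b + z) = y (b + z)" if "z \<in> nb0" for z
  proof (rule assms(1))
    show "b + z \<in> halo B" using assms(2) that by (force simp: halo_def)
  qed
  then have "(\<lambda>z\<in>nb0. x (b + z)) = (\<lambda>z\<in>nb0. y (b + z))" by (simp add: restrict_def fun_eq_iff)
  moreover have "x b = y b" using assms by (simp add: halo_def)
  ultimately show ?thesis by (simp add: step_def)
qed

lemma step_sets:
  assumes "finite B"
  shows "{x \<in> space \<mu>. \<forall>b\<in>B. step n w x b = \<eta> b} \<in> sets \<mu>"
proof (rule mu.local_sets[OF finite_halo[OF assms]])
  fix x y :: "'d lattice \<Rightarrow> 'a" assume *: "\<And>b. b \<in> halo B \<Longrightarrow> x b = y b"
  then have "step n w x b = step n w y b" if "b \<in> B" for b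
    by (rule step_cong_halo[OF _ that])
  then show "(\<forall>b\<in>B. step n w x b = \<eta> b) = (\<forall>b\<in>B. step n w y b = \<eta> b)" by simp
qed

lemma inner_step_sets:
  assumes "finite B"
  shows "{x \<in> space \<mu>. \<forall>b\<in>halo B. inner_step B n w x b = \<eta> b} \<in> sets \<mu>"
proof (rule mu.local_sets[OF finite_halo[OF assms]])
  fix x y :: "'d lattice \<Rightarrow> 'a" assume *: "\<And>b. b \<in> halo B \<Longrightarrow> x b = y b"
  then have "inner_step B n w x b = inner_step B n w y b" if "b \<in> halo B" for b
    using that step_cong_halo[OF *] by (simp add: inner_step_def)
  then show "(\<forall>b\<in>halo B. inner_step B n w x b = \<eta> b) = (\<forall>b\<in>halo B. inner_step B n w y b = \<eta> b)"
    by simp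
qed

lemma bounded_local_integrable:
  fixes f :: "'d field \<Rightarrow> real"
  assumes "finite J" "depends_on J f" "\<And>\<omega>. \<bar>f \<omega>\<bar> \<le> 1"
  shows "integrable Om f"
  by (rule integrable_const_bound[where B=1]) (use assms borel_local[OF assms(1,2)] in auto)

lemma step_measure_local:
  "depends_on ((\<Union>b\<in>B. ball1 b 1) \<times> {Suc n}) (\<lambda>\<omega>. measure \<mu> {x \<in> space \<mu>. \<forall>b\<in>B. step n \<omega> x b = \<eta> b})"
proof (rule depends_onI)
  fix \<omega> \<omega>' :: "'d field"
  assume *: "\<And>i. i \<in> (\<Union>b\<in>B. ball1 b 1) \<times> {Suc n} \<Longrightarrow> \<omega> i = \<omega>' i"
  have "step n \<omega> x b = step n \<omega>' x b" if b: "b \<in> B" for x b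
  proof -
    have "act n \<omega> b = act n \<omega>' b" by (rule act_cong) (use * b in auto)
    moreover have "\<omega> (b, Suc n) = \<omega>' (b, Suc n)"
    proof (rule *)
      show "(b, Suc n) \<in> (\<Union>b\<in>B. ball1 b 1) \<times> {Suc n}" using b ball1_center[of b 1] by blast
    qed
    ultimately show ?thesis by (simp add: step_def)
  qed
  then show "measure \<mu> {x \<in> space \<mu>. \<forall>b\<in>B. step n \<omega> x b = \<eta> b} =
      measure \<mu> {x \<in> space \<mu>. \<forall>b\<in>B. step n \<omega>' x b = \<eta> b}" by simp
qed

lemma expectation_step:
  assumes B: "finite B"
  shows "expectation (\<lambda>\<omega>. measure \<mu> {x \<in> space \<mu>. \<forall>b\<in>B. step n \<omega> x b = \<eta> b}) = cyl_prob B \<eta>"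
proof -
  let ?I = "{\<eta>' \<in> PiE (halo B) (\<lambda>_. S). \<forall>b\<in>B. \<eta>' b = \<eta> b}"
  have sub: "B \<subseteq> halo B" by (auto simp: halo_def)
  have P: "(\<forall>b\<in>B. x b = \<eta> b) = (\<forall>b\<in>B. y b = \<eta> b)" if "\<And>b. b \<in> halo B \<Longrightarrow> x b = y b" for x y :: "'d lattice \<Rightarrow> 'a"
  proof -
    have "x b = y b" if "b \<in> B" for b
      by (rule \<open>\<And>b. b \<in> halo B \<Longrightarrow> x b = y b\<close>) (use that sub in blast)
    then show ?thesis by simp
  qed
  have 1: "measure \<mu> {x \<in> space \<mu>. \<forall>b\<in>B. step n \<omega> x b = \<eta> b} =
      (\<Sum>\<eta>'\<in>?I. measure \<mu> {x \<in> space \<mu>. \<forall>b\<in>halo B. inner_step B n \<omega> x b = \<eta>' b})" for \<omega>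
  proof -
    have "measure \<mu> {x \<in> space \<mu>. \<forall>b\<in>B. step n \<omega> x b = \<eta> b} =
        measure \<mu> {x \<in> space \<mu>. \<forall>b\<in>B. inner_step B n \<omega> x b = \<eta> b}"
      by (simp add: inner_step_def)
    also have "\<dots> = (\<Sum>\<eta>'\<in>?I. measure \<mu> {x \<in> space \<mu>. \<forall>b\<in>halo B. inner_step B n \<omega> x b = \<eta>' b})"
      by (rule mu.split_sum[OF finite_halo[OF B], where P="\<lambda>y. \<forall>b\<in>B. y b = \<eta> b"])
        (rule inner_step_in inner_step_sets[OF B] P, assumption?)+
    finally show ?thesis .
  qed
  have 2: "cyl_prob B \<eta> = (\<Sum>\<eta>'\<in>?I. cyl_prob (halo B) \<eta>')"
    unfolding cyl_prob_def
    by (rule mu.split_sum[OF finite_halo[OF B], where P="\<lambda>y. \<forall>b\<in>B. y b = \<eta> b" and T="\<lambda>x. x"])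
      (rule mu.config_in mu.cylinder_sets[OF finite_halo[OF B]] P, assumption?)+
  have "integrable Om (\<lambda>\<omega>. measure \<mu> {x \<in> space \<mu>. \<forall>b\<in>halo B. inner_step B n \<omega> x b = \<eta>' b})" for \<eta>'
    unfolding inner_step_cyl[OF B]
    by (auto intro!: Bochner_Integration.integrable_sum
      simp: pattern_sets[OF B] emeasure_eq_measure)
  then show ?thesis
    unfolding 1 2 by (subst Bochner_Integration.integral_sum) (auto simp: expectation_inner_step[OF B])
qed

lemma flow_local_set: "depends_on ((\<Union>b\<in>F. ball1 b (Suc (2 * n))) \<times> {1..n}) (\<lambda>\<omega>. \<forall>b\<in>F. flow n \<omega> x b = \<xi> b)"
proof (rule depends_onI)
  fix \<omega> \<omega>' :: "'d field"
  assume *: "\<And>i. i \<in> (\<Union>b\<in>F. ball1 b (Suc (2 * n))) \<times> {1..n} \<Longrightarrow> \<omega> i = \<omega>' i"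
  have "flow n \<omega> x b = flow n \<omega>' x b" if "b \<in> F" for b
    by (rule flow_cong', rule *) (use that in auto)
  then show "(\<forall>b\<in>F. flow n \<omega> x b = \<xi> b) = (\<forall>b\<in>F. flow n \<omega>' x b = \<xi> b)" by simp
qed

lemma flow_cong_init:
  assumes "\<And>b. b \<in> (\<Union>u\<in>F. ball1 u n) \<Longrightarrow> x b = y b" "u \<in> F"
  shows "flow n w x u = flow n w y u"
  by (rule flow_live) (use assms in auto)

text \<open>The dynamics preserves \<open>\<mu>\<close>. The earliest update is peeled off: its symbols are independent of all later ones, so after
  averaging over them the later updates act on a sample of \<open>\<mu>\<close> again. Working with the expected \<open>\<mu>\<close>-probability
  of a cylinder avoids a product space of symbols and configurations.\<close>
lemma expectation_flow:
  assumes F: "finite F"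
  shows "expectation (\<lambda>\<omega>. measure \<mu> {x \<in> space \<mu>. \<forall>b\<in>F. flow n \<omega> x b = \<xi> b}) = cyl_prob F \<xi>"
proof (induction n)
  case 0
  show ?case using prob_space by (simp add: cyl_prob_def)
next
  case (Suc n)
  define B where "B = (\<Union>u\<in>F. ball1 u n)"
  have B: "finite B" using F by (simp add: B_def)
  define g where "g \<omega> \<eta> = measure \<mu> {x \<in> space \<mu>. \<forall>b\<in>B. step n \<omega> x b = \<eta> b}" for \<omega> \<eta>
  define f :: "'d field \<Rightarrow> ('d lattice \<Rightarrow> 'a) \<Rightarrow> real"
    where "f \<omega> \<eta> = of_bool (\<forall>b\<in>F. flow n \<omega> \<eta> b = \<xi> b)" for \<omega> \<eta>
  have fin: "finite (PiE B (\<lambda>_. S))" by (rule finite_PiE) (use B mu.finite_spins in auto)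
  have P: "(\<forall>b\<in>F. flow n \<omega> x b = \<xi> b) = (\<forall>b\<in>F. flow n \<omega> y b = \<xi> b)" if "\<And>b. b \<in> B \<Longrightarrow> x b = y b" for x y \<omega>
  proof -
    have "flow n \<omega> x b = flow n \<omega> y b" if "b \<in> F" for b
      by (rule flow_cong_init[OF _ that]) (use \<open>\<And>b. b \<in> B \<Longrightarrow> x b = y b\<close> in \<open>simp add: B_def\<close>)
    then show ?thesis by simp
  qed
  have filter: "(\<Sum>\<eta> | \<eta> \<in> PiE B (\<lambda>_. S) \<and> (\<forall>b\<in>F. flow n \<omega> \<eta> b = \<xi> b). h \<eta>) =
      (\<Sum>\<eta>\<in>PiE B (\<lambda>_. S). f \<omega> \<eta> * h \<eta>)" for \<omega> and h :: "_ \<Rightarrow> real"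
    by (rule sum.mono_neutral_cong_left) (use fin in \<open>auto simp: f_def\<close>)
  have 1: "measure \<mu> {x \<in> space \<mu>. \<forall>b\<in>F. flow (Suc n) \<omega> x b = \<xi> b} =
      (\<Sum>\<eta>\<in>PiE B (\<lambda>_. S). f \<omega> \<eta> * g \<omega> \<eta>)" for \<omega>
    unfolding filter[symmetric] g_def flow.simps
    by (rule mu.split_sum[OF B, where P="\<lambda>y. \<forall>b\<in>F. flow n \<omega> y b = \<xi> b"])
      (rule step_in step_sets[OF B] P, assumption?)+
  have 2: "measure \<mu> {x \<in> space \<mu>. \<forall>b\<in>F. flow n \<omega> x b = \<xi> b} =
      (\<Sum>\<eta>\<in>PiE B (\<lambda>_. S). f \<omega> \<eta> * cyl_prob B \<eta>)" for \<omega>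
    unfolding filter[symmetric] cyl_prob_def
    by (rule mu.split_sum[OF B, where P="\<lambda>y. \<forall>b\<in>F. flow n \<omega> y b = \<xi> b" and T="\<lambda>x. x"])
      (rule mu.config_in mu.cylinder_sets[OF B] P, assumption?)+
  let ?J = "(\<Union>b\<in>F. ball1 b (Suc (2 * n))) \<times> {1..n}" and ?K = "(\<Union>b\<in>B. ball1 b 1) \<times> {Suc n}"
  have fd: "depends_on ?J (\<lambda>\<omega>. f \<omega> \<eta>)" for \<eta>
    unfolding f_def by (rule depends_on_comp[OF flow_local_set])
  have gd: "depends_on ?K (\<lambda>\<omega>. g \<omega> \<eta>)" for \<eta>
    unfolding g_def by (rule step_measure_local)
  have fi: "integrable Om (\<lambda>\<omega>. f \<omega> \<eta>)" for \<eta>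
    by (rule bounded_local_integrable[OF _ fd]) (use F in \<open>auto simp: f_def\<close>)
  have gi: "integrable Om (\<lambda>\<omega>. g \<omega> \<eta>)" for \<eta>
    by (rule bounded_local_integrable[OF _ gd]) (use B in \<open>auto simp: g_def\<close>)
  have fgi: "integrable Om (\<lambda>\<omega>. f \<omega> \<eta> * g \<omega> \<eta>)" for \<eta>
  proof (rule bounded_local_integrable)
    show "finite (?J \<union> ?K)" using F B by simp
    show "depends_on (?J \<union> ?K) (\<lambda>\<omega>. f \<omega> \<eta> * g \<omega> \<eta>)"
    proof (rule depends_onI)
      fix \<omega> \<omega>' :: "'d field" assume *: "\<And>i. i \<in> ?J \<union> ?K \<Longrightarrow> \<omega> i = \<omega>' i"
      have "f \<omega> \<eta> = f \<omega>' \<eta>" by (rule depends_onD[OF fd]) (rule *, blast)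
      moreover have "g \<omega> \<eta> = g \<omega>' \<eta>" by (rule depends_onD[OF gd]) (rule *, blast)
      ultimately show "f \<omega> \<eta> * g \<omega> \<eta> = f \<omega>' \<eta> * g \<omega>' \<eta>" by simp
    qed
    show "\<bar>f \<omega> \<eta> * g \<omega> \<eta>\<bar> \<le> 1" for \<omega> by (auto simp: f_def g_def)
  qed
  have "expectation (\<lambda>\<omega>. measure \<mu> {x \<in> space \<mu>. \<forall>b\<in>F. flow (Suc n) \<omega> x b = \<xi> b}) =
      (\<Sum>\<eta>\<in>PiE B (\<lambda>_. S). expectation (\<lambda>\<omega>. f \<omega> \<eta> * g \<omega> \<eta>))"
    unfolding 1 by (rule Bochner_Integration.integral_sum) (rule fgi)
  also have "\<dots> = (\<Sum>\<eta>\<in>PiE B (\<lambda>_. S). expectation (\<lambda>\<omega>. f \<omega> \<eta>) * cyl_prob B \<eta>)"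
  proof (rule sum.cong[OF refl])
    fix \<eta>
    have "expectation (\<lambda>\<omega>. f \<omega> \<eta> * g \<omega> \<eta>) = expectation (\<lambda>\<omega>. f \<omega> \<eta>) * expectation (\<lambda>\<omega>. g \<omega> \<eta>)"
      by (rule expectation_mult_depends[OF fd gd _ fi gi]) auto
    also have "expectation (\<lambda>\<omega>. g \<omega> \<eta>) = cyl_prob B \<eta>"
      unfolding g_def by (rule expectation_step[OF B])
    finally show "expectation (\<lambda>\<omega>. f \<omega> \<eta> * g \<omega> \<eta>) = expectation (\<lambda>\<omega>. f \<omega> \<eta>) * cyl_prob B \<eta>" .
  qed
  also have "\<dots> = expectation (\<lambda>\<omega>. measure \<mu> {x \<in> space \<mu>. \<forall>b\<in>F. flow n \<omega> x b = \<xi> b})"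
    unfolding 2 using fi by (subst Bochner_Integration.integral_sum) auto
  finally show ?case using Suc.IH by simp
qed

lemma pred_dead: "Measurable.pred Om (\<lambda>\<omega>. dead n \<omega> u)"
  unfolding dead_def by (intro pred_intros_finite pred_intros_logic pred_live) auto

lemma prob_not_dead: "prob {\<omega>. \<not> dead n \<omega> u} \<le> real ((2 * n + 1) ^ CARD('d)) * \<rho> ^ n"
proof -
  have "{\<omega>. \<not> dead n \<omega> u} = (\<Union>v\<in>ball1 u n. {\<omega>. live n \<omega> v})" by (auto simp: dead_def)
  then have "prob {\<omega>. \<not> dead n \<omega> u} \<le> (\<Sum>v\<in>ball1 u n. prob {\<omega>. live n \<omega> v})"
    by (simp only:) (intro finite_measure_subadditive_finite finite_ball1, auto intro: event_of_pred pred_live)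
  also have "\<dots> \<le> (\<Sum>v\<in>ball1 u n. \<rho> ^ n)" by (intro sum_mono prob_live)
  also have "\<dots> = real (card (ball1 u n)) * \<rho> ^ n" by simp
  also have "\<dots> \<le> real ((2 * n + 1) ^ CARD('d)) * \<rho> ^ n"
    using rho card_ball1[of u n] by (intro mult_right_mono of_nat_mono) auto
  finally show ?thesis .
qed

lemma pred_cftp: "Measurable.pred Om (\<lambda>\<omega>. cftp \<omega> u = s)"
proof -
  have fl: "Measurable.pred Om (\<lambda>\<omega>. flow n \<omega> (\<lambda>_. s0) u = s)" for n
    by (rule measurable_local[where J="ball1 u (Suc (2 * n)) \<times> {1..n}"])
      (auto intro!: depends_onI arg_cong[where f="\<lambda>t. t = s"] flow_cong')
  have eq: "cftp \<omega> u = s \<longleftrightarrow> (\<exists>n. dead n \<omega> u \<and> flow n \<omega> (\<lambda>_. s0) u = s) \<or> (\<forall>n. \<not> dead n \<omega> u) \<and> s0 = s" for \<omega>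
    using dead_flow_eq_cftp[of _ \<omega> u "\<lambda>_. s0"] by (cases "\<exists>n. dead n \<omega> u") (auto simp: cftp_def)
  show ?thesis unfolding eq
    by (intro pred_intros_logic pred_intros_countable pred_dead fl) auto
qed

text \<open>If everything near \<open>F\<close> is dead by time \<open>n\<close>, the output coincides on \<open>F\<close> with the flow started from any
  configuration. So the two laws differ by at most the probability of survival until time \<open>n\<close>.\<close>
lemma prob_cftp:
  assumes F: "finite F"
  shows "prob {\<omega>. \<forall>b\<in>F. cftp \<omega> b = \<xi> b} = cyl_prob F \<xi>"
proof -
  let ?q = "prob {\<omega>. \<forall>b\<in>F. cftp \<omega> b = \<xi> b}"
  have cftp_ev: "{\<omega>. \<forall>b\<in>F. cftp \<omega> b = \<xi> b} \<in> sets Om"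
    by (intro event_of_pred pred_intros_finite pred_cftp F)
  have bound: "\<bar>?q - cyl_prob F \<xi>\<bar> \<le> (\<Sum>u\<in>F. real ((2 * n + 1) ^ CARD('d)) * \<rho> ^ n)" for n
  proof -
    let ?g = "\<lambda>\<omega>. measure \<mu> {x \<in> space \<mu>. \<forall>b\<in>F. flow n \<omega> x b = \<xi> b}"
    let ?D = "{\<omega>. \<exists>u\<in>F. \<not> dead n \<omega> u}"
    have Dev: "?D \<in> sets Om" by (intro event_of_pred pred_intros_finite pred_intros_logic pred_dead F)
    have gi: "integrable Om ?g"
    proof (rule bounded_local_integrable)
      let ?J = "(\<Union>b\<in>F. ball1 b (Suc (2 * n))) \<times> {1..n}"
      show "finite ?J" using F by simp
      show "depends_on ?J ?g"
      proof (rule depends_onI)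
        fix \<omega> \<omega>' :: "'d field" assume "\<And>i. i \<in> ?J \<Longrightarrow> \<omega> i = \<omega>' i"
        then have "(\<forall>b\<in>F. flow n \<omega> x b = \<xi> b) = (\<forall>b\<in>F. flow n \<omega>' x b = \<xi> b)" for x
          by (rule depends_onD[OF flow_local_set])
        then show "?g \<omega> = ?g \<omega>'" by simp
      qed
    qed auto
    have symbol_law: "\<bar>indicator {\<omega>. \<forall>b\<in>F. cftp \<omega> b = \<xi> b} \<omega> - ?g \<omega>\<bar> \<le> indicator ?D \<omega>" for \<omega>
    proof (cases "\<omega> \<in> ?D")
      case True
      moreover have "\<bar>a - b\<bar> \<le> 1" if "a \<in> {0, 1}" "0 \<le> b" "b \<le> 1" for a b :: real
        using that by auto
      ultimately show ?thesis by (simp add: indicator_def)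
    next
      case False
      then have "flow n \<omega> x b = cftp \<omega> b" if "b \<in> F" for x b using that by (auto intro: dead_flow_eq_cftp)
      then have "?g \<omega> = measure \<mu> {x \<in> space \<mu>. \<forall>b\<in>F. cftp \<omega> b = \<xi> b}" by simp
      also have "\<dots> = indicator {\<omega>. \<forall>b\<in>F. cftp \<omega> b = \<xi> b} \<omega>"
      proof (cases "\<forall>b\<in>F. cftp \<omega> b = \<xi> b")
        case False
        then have e: "{x \<in> space \<mu>. \<forall>b\<in>F. cftp \<omega> b = \<xi> b} = {}" by blast
        have "\<omega> \<notin> {\<omega>. \<forall>b\<in>F. cftp \<omega> b = \<xi> b}" using False by blast
        then have z: "indicat_real {\<omega>. \<forall>b\<in>F. cftp \<omega> b = \<xi> b} \<omega> = 0" by (rule indicator_simps(2))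
        show ?thesis unfolding e z measure_empty ..
      qed (simp add: mu.prob_space)
      finally show ?thesis by simp
    qed
    have oi: "integrable Om (indicat_real {\<omega>. \<forall>b\<in>F. cftp \<omega> b = \<xi> b})"
      using cftp_ev by (simp add: emeasure_eq_measure)
    have "?q - cyl_prob F \<xi> = expectation (\<lambda>\<omega>. indicator {\<omega>. \<forall>b\<in>F. cftp \<omega> b = \<xi> b} \<omega> - ?g \<omega>)"
      using oi gi cftp_ev by (simp add: expectation_flow[OF F])
    also have "\<bar>\<dots>\<bar> \<le> expectation (\<lambda>\<omega>. \<bar>indicator {\<omega>. \<forall>b\<in>F. cftp \<omega> b = \<xi> b} \<omega> - ?g \<omega>\<bar>)"
      by (rule integral_abs_bound)
    also have "\<dots> \<le> expectation (indicat_real ?D)"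
      by (rule integral_mono) (use symbol_law oi gi Dev in \<open>auto simp: emeasure_eq_measure\<close>)
    also have "\<dots> = prob ?D" using Dev by simp
    also have "?D = (\<Union>u\<in>F. {\<omega>. \<not> dead n \<omega> u})" by auto
    also have "prob \<dots> \<le> (\<Sum>u\<in>F. prob {\<omega>. \<not> dead n \<omega> u})"
      by (rule finite_measure_subadditive_finite[OF F])
        (auto intro!: event_of_pred pred_intros_logic pred_dead)
    also have "\<dots> \<le> (\<Sum>u\<in>F. real ((2 * n + 1) ^ CARD('d)) * \<rho> ^ n)"
      by (intro sum_mono prob_not_dead)
    finally show ?thesis .
  qed
  have "(\<lambda>n. \<Sum>u\<in>F. real ((2 * n + 1) ^ CARD('d)) * \<rho> ^ n) \<longlonglongrightarrow> (\<Sum>u\<in>F. 0)"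
  proof (rule tendsto_sum)
    have "(\<lambda>n. real ((2 * n + 1) ^ CARD('d)) * \<rho> ^ n) \<longlonglongrightarrow> 0"
      using rho by real_asymp
    then show "(\<lambda>n. real ((2 * n + 1) ^ CARD('d)) * \<rho> ^ n) \<longlonglongrightarrow> 0" .
  qed
  then have "(\<lambda>n. \<Sum>u\<in>F. real ((2 * n + 1) ^ CARD('d)) * \<rho> ^ n) \<longlonglongrightarrow> 0" by simp
  then have "\<bar>?q - cyl_prob F \<xi>\<bar> \<le> 0"
    by (rule LIMSEQ_le_const) (use bound in auto)
  then show ?thesis by simp
qed

end

section \<open>The coding\<close>

lemma shift_measurable: "shift u \<in> measurable (config_space M) (config_space M)"
proof -
  have "(\<lambda>y. \<lambda>v\<in>UNIV. y (v + u)) \<in> measurable (config_space M) (config_space M)"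
    unfolding config_space_def by (rule measurable_restrict) (rule measurable_component_singleton, simp)
  then show ?thesis by (simp add: shift_def[abs_def] restrict_def)
qed

text \<open>The layers \<open>0, \<dots>, n0 + 1\<close> at a site, finitely many symbols from a finite set, are packed into one
  natural number.\<close>
locale coding_dynamics = mrf_dynamics upd obl S s0 n0 letter_law update_law \<rho> \<mu>
  for upd :: "nat \<Rightarrow> ('d::finite lattice \<Rightarrow> 'a) \<Rightarrow> 'a" and obl S s0 n0 letter_law update_law \<rho>
    and \<mu> :: "('d lattice \<Rightarrow> 'a) measure" +
  assumes finite_letter_law: "finite (set_pmf letter_law)" and finite_update_law: "finite (set_pmf update_law)"
begin

definition symbols :: "(bool \<times> nat) set" where
  "symbols = set_pmf letter_law \<union> set_pmf symbol_law"

definition T :: "nat set" where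
  "T = to_nat ` {xs. set xs \<subseteq> symbols \<and> length xs = n0 + 2}"

definition enc :: "'d field \<Rightarrow> 'd lattice \<Rightarrow> nat" where
  "enc \<omega> v = to_nat (map (\<lambda>k. \<omega> (v, k)) [0..<n0 + 2])"

text \<open>The case distinction matters on a null set only; it makes \<open>Y\<close> take values in \<open>T\<close> everywhere.\<close>
definition Y :: "'d field \<Rightarrow> 'd lattice \<Rightarrow> nat" where
  "Y \<omega> v = (if enc \<omega> v \<in> T then enc \<omega> v else SOME t. t \<in> T)"

text \<open>The layers that the coding does not have are filled with an arbitrary symbol.\<close>
definition dec :: "('d lattice \<Rightarrow> nat) \<Rightarrow> 'd field" where
  "dec y = (\<lambda>(v, k). if k < n0 + 2 then (from_nat (y v) :: (bool \<times> nat) list) ! k else (False, 0))"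

definition \<phi> :: "('d lattice \<Rightarrow> nat) \<Rightarrow> 'd lattice \<Rightarrow> 'a" where
  "\<phi> y = cftp (readout (dec y))"

definition \<nu> :: "('d lattice \<Rightarrow> nat) measure" where
  "\<nu> = distr Om (config_space (count_space T)) Y"

lemma finite_T: "finite T"
proof -
  have "finite symbols" using finite_letter_law finite_update_law by (simp add: symbols_def symbol_law_def)
  then show ?thesis unfolding T_def by (intro finite_imageI finite_lists_length_eq)
qed

lemma T_nonempty: "T \<noteq> {}"
proof -
  obtain s where "s \<in> symbols" using set_pmf_not_empty[of letter_law] by (auto simp: symbols_def)
  then have "set (replicate (n0 + 2) s) \<subseteq> symbols \<and> length (replicate (n0 + 2) s) = n0 + 2" by auto
  then show ?thesis unfolding T_def by blast
qed

lemma Y_in: "Y \<omega> v \<in> T"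
  using T_nonempty some_in_eq[of T] by (simp add: Y_def)

lemma Y_local: "depends_on ({v} \<times> {..<n0 + 2}) (\<lambda>\<omega>. Y \<omega> v)"
proof (rule depends_onI)
  fix \<omega> \<omega>' :: "'d field" assume *: "\<And>i. i \<in> {v} \<times> {..<n0 + 2} \<Longrightarrow> \<omega> i = \<omega>' i"
  have "map (\<lambda>k. \<omega> (v, k)) [0..<n0 + 2] = map (\<lambda>k. \<omega>' (v, k)) [0..<n0 + 2]"
    by (rule map_cong[OF refl], rule *) (simp only: set_upt atLeastLessThan_iff mem_Sigma_iff lessThan_iff, simp)
  then show "Y \<omega> v = Y \<omega>' v" unfolding Y_def enc_def by (simp only:)
qed

lemma Y_coord_measurable [measurable]: "(\<lambda>\<omega>. Y \<omega> v) \<in> measurable Om (count_space T)"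
proof -
  have "(\<lambda>\<omega>. Y \<omega> v) \<in> measurable Om (count_space UNIV)"
    by (rule measurable_local[OF _ Y_local]) auto
  from measurable_sets[OF this] show ?thesis
    unfolding measurable_count_space_eq2[OF finite_T] by (auto intro: Y_in)
qed

lemma Y_measurable: "Y \<in> measurable Om (config_space (count_space T))"
proof -
  have "(\<lambda>\<omega>. \<lambda>v\<in>UNIV. Y \<omega> v) \<in> measurable Om (config_space (count_space T))"
    unfolding config_space_def by (rule measurable_restrict) (rule Y_coord_measurable)
  then show ?thesis by (simp add: restrict_def)
qed

lemma Y_translate: "Y (translate a \<omega>) = shift a (Y \<omega>)"
  by (simp add: Y_def enc_def shift_def fun_eq_iff)

lemma coord_measurable: "(\<lambda>y. y v) \<in> measurable (config_space M) M"
  unfolding config_space_def by (rule measurable_component_singleton) simp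

lemma distr_translate:
  assumes "f \<in> measurable Om N"
  shows "distr Om N (\<lambda>\<omega>. f (translate a \<omega>)) = distr Om N f"
proof -
  have "distr Om N f = distr (distr Om Om (translate a)) N f" by (simp add: translate_preserves)
  also have "\<dots> = distr Om N (\<lambda>\<omega>. f (translate a \<omega>))"
    by (subst distr_distr[OF assms translate_measurable]) (simp add: comp_def)
  finally show ?thesis ..
qed

lemma prob_space_nu: "prob_space \<nu>"
  unfolding \<nu>_def by (rule prob_space_distr[OF Y_measurable])

lemma field_law_nu: "field_law (count_space T) \<nu>"
  using prob_space_nu by (simp add: field_law_def \<nu>_def)

lemma translation_invariant_nu: "translation_invariant (count_space T) \<nu>"
  unfolding translation_invariant_def
proof
  fix u
  have "distr \<nu> (config_space (count_space T)) (shift u) =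
      distr Om (config_space (count_space T)) (\<lambda>\<omega>. Y (translate u \<omega>))"
    unfolding \<nu>_def by (subst distr_distr[OF shift_measurable Y_measurable]) (simp add: comp_def Y_translate)
  then show "distr \<nu> (config_space (count_space T)) (shift u) = \<nu>"
    by (simp add: distr_translate[OF Y_measurable] \<nu>_def)
qed

lemma nu_coord: "distr \<nu> (count_space T) (\<lambda>y. y v) = distr Om (count_space T) (\<lambda>\<omega>. Y \<omega> v)"
  unfolding \<nu>_def by (subst distr_distr[OF coord_measurable Y_measurable]) (simp add: comp_def)

lemma iid_nu: "iid_law (count_space T) \<nu>"
  unfolding iid_law_def
proof (intro conjI allI field_law_nu)
  interpret nu: prob_space \<nu> by (rule prob_space_nu)
  have sets_nu: "sets \<nu> = sets (config_space (count_space T))" by (simp add: \<nu>_def)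
  have "indep_vars (\<lambda>_. count_space T) (\<lambda>v \<omega>. Y \<omega> v) UNIV"
  proof (rule indep_vars_depends)
    show "disjoint_family_on (\<lambda>v. {v} \<times> {..<n0 + 2}) UNIV" by (auto simp: disjoint_family_on_def)
  qed (rule Y_local Y_coord_measurable)+
  then have "distr Om (PiM UNIV (\<lambda>_. count_space T)) (\<lambda>\<omega>. \<lambda>v\<in>UNIV. Y \<omega> v) =
      PiM UNIV (\<lambda>v. distr Om (count_space T) (\<lambda>\<omega>. Y \<omega> v))"
    by (subst (asm) indep_vars_iff_distr_eq_PiM') (auto intro: Y_coord_measurable)
  then have nu_eq: "\<nu> = PiM UNIV (\<lambda>v. distr \<nu> (count_space T) (\<lambda>y. y v))"
    unfolding nu_coord by (simp add: \<nu>_def config_space_def restrict_def)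
  show "nu.indep_vars (\<lambda>_. count_space T) (\<lambda>v y. y v) UNIV"
  proof (subst nu.indep_vars_iff_distr_eq_PiM')
    have "distr \<nu> (PiM UNIV (\<lambda>_. count_space T)) (\<lambda>x. \<lambda>i\<in>UNIV. x i) = \<nu>"
      using distr_id2[of "PiM UNIV (\<lambda>_. count_space T)" \<nu>] sets_nu by (simp add: config_space_def restrict_def)
    with nu_eq show "distr \<nu> (PiM UNIV (\<lambda>_. count_space T)) (\<lambda>x. \<lambda>i\<in>UNIV. x i) =
        PiM UNIV (\<lambda>i. distr \<nu> (count_space T) (\<lambda>x. x i))" by simp
    show "(\<lambda>y. y v) \<in> measurable \<nu> (count_space T)" for v
      unfolding measurable_cong_sets[OF sets_nu refl] by (rule coord_measurable)
  qed auto
next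
  fix u v
  have *: "distr Om (count_space T) (\<lambda>\<omega>. Y \<omega> u) = distr Om (count_space T) (\<lambda>\<omega>. Y \<omega> 0)" for u
    using distr_translate[OF Y_coord_measurable[of 0], of u] by (simp add: Y_translate shift_def)
  show "distr \<nu> (count_space T) (\<lambda>y. y u) = distr \<nu> (count_space T) (\<lambda>y. y v)"
    unfolding nu_coord *[of u] *[of v] ..
qed

lemma dec_shift: "dec (shift u y) = translate u (dec y)"
  by (auto simp: dec_def shift_def translate_def)

lemma \<phi>_shift: "\<phi> (shift u y) = shift u (\<phi> y)"
proof -
  have "\<phi> (shift u y) = cftp (translate u (readout (dec y)))"
    by (simp only: \<phi>_def dec_shift readout_translate)
  then show ?thesis by (simp add: \<phi>_def cftp_translate shift_def fun_eq_iff)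
qed

lemma dec_measurable: "dec \<in> measurable (config_space (count_space T)) Om"
proof (rule measurable_into_Om)
  fix i :: "'d lattice \<times> nat"
  obtain v k where i: "i = (v, k)" by (cases i)
  have "(\<lambda>t. if k < n0 + 2 then (from_nat t :: (bool \<times> nat) list) ! k else (False, 0))
      \<in> measurable (count_space T) (count_space UNIV)" by simp
  from measurable_compose[OF coord_measurable this, of v]
  show "(\<lambda>y. dec y i) \<in> measurable (config_space (count_space T)) (count_space UNIV)"
    by (simp add: dec_def i)
qed

lemma cftp_measurable: "cftp \<in> measurable Om (config_space (count_space S))"
proof -
  have "(\<lambda>\<omega>. cftp \<omega> v) \<in> measurable Om (count_space S)" for v
    unfolding measurable_count_space_eq2[OF mu.finite_spins]
  proof (intro conjI ballI)
    fix s
    show "(\<lambda>\<omega>. cftp \<omega> v) -` {s} \<inter> space Om \<in> sets Om"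
      using event_of_pred[OF pred_cftp[of v s]] by (simp add: vimage_def)
  qed (auto intro: cftp_in)
  then have "(\<lambda>\<omega>. \<lambda>v\<in>UNIV. cftp \<omega> v) \<in> measurable Om (config_space (count_space S))"
    unfolding config_space_def by (rule measurable_restrict)
  then show ?thesis by (simp add: restrict_def)
qed

lemma cftp_readout_measurable: "(\<lambda>\<omega>. cftp (readout \<omega>)) \<in> measurable Om (config_space (count_space S))"
  by (rule measurable_compose[OF readout_measurable cftp_measurable])

lemma \<phi>_measurable: "\<phi> \<in> measurable (config_space (count_space T)) (config_space (count_space S))"
  unfolding \<phi>_def[abs_def] by (rule measurable_compose[OF dec_measurable cftp_readout_measurable])

lemma distr_cftp: "distr Om (config_space (count_space S)) cftp = \<mu>"
proof -
  have sets_c: "sets (config_space (count_space S)) = sets (PiM UNIV (\<lambda>_. count_space S))"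
    by (simp add: config_space_def)
  show ?thesis
  proof (rule measure_eqI_PiM_infinite)
    show "sets (distr Om (config_space (count_space S)) cftp) = sets (PiM UNIV (\<lambda>_. count_space S))"
      by (simp add: config_space_def)
    show "sets \<mu> = sets (PiM UNIV (\<lambda>_. count_space S))" by (rule mu.sets_field)
    show "finite_measure (distr Om (config_space (count_space S)) cftp)"
      using prob_space_distr[OF cftp_measurable] by (simp add: prob_space.axioms)
    fix A and J :: "'d lattice set" assume J: "finite J" and A: "\<And>i. i \<in> J \<Longrightarrow> A i \<in> sets (count_space S)"
    let ?E = "prod_emb UNIV (\<lambda>_. count_space S) J (PiE J A)"
    let ?P = "\<lambda>x. \<forall>j\<in>J. x j \<in> A j"
    let ?I = "{\<xi> \<in> PiE J (\<lambda>_. S). ?P \<xi>}"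
    have E: "?E = {x. \<forall>v. x v \<in> S} \<inter> {x. ?P x}"
      by (auto simp: prod_emb_def space_PiM restrict_def PiE_iff extensional_def)
    have Es: "?E \<in> sets (config_space (count_space S))"
      unfolding config_space_def using J A by (intro sets_PiM_I) auto
    have fin: "finite ?I"
      by (rule finite_subset[OF _ finite_PiE[OF J]]) (use mu.finite_spins in auto)
    have cftp_eq: "{\<omega>. ?P (cftp \<omega>)} = (\<Union>\<xi>\<in>?I. {\<omega>. \<forall>j\<in>J. cftp \<omega> j = \<xi> j})"
    proof safe
      fix \<omega> assume "?P (cftp \<omega>)"
      then have "restrict (cftp \<omega>) J \<in> ?I" by (auto intro: cftp_in)
      moreover have "\<forall>j\<in>J. cftp \<omega> j = restrict (cftp \<omega>) J j" by simp
      ultimately show "\<omega> \<in> (\<Union>\<xi>\<in>?I. {\<omega>. \<forall>j\<in>J. cftp \<omega> j = \<xi> j})" by blast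
    qed auto
    have "measure (distr Om (config_space (count_space S)) cftp) ?E = prob {\<omega>. ?P (cftp \<omega>)}"
      by (subst measure_distr[OF cftp_measurable Es]) (auto simp: E cftp_in intro!: arg_cong[where f=prob])
    also have "\<dots> = (\<Sum>\<xi>\<in>?I. prob {\<omega>. \<forall>j\<in>J. cftp \<omega> j = \<xi> j})"
      unfolding cftp_eq
    proof (rule finite_measure_finite_Union[OF fin])
      show "(\<lambda>\<xi>. {\<omega>. \<forall>j\<in>J. cftp \<omega> j = \<xi> j}) ` ?I \<subseteq> sets Om"
        using J by (auto intro!: event_of_pred pred_intros_finite pred_cftp)
      show "disjoint_family_on (\<lambda>\<xi>. {\<omega>. \<forall>j\<in>J. cftp \<omega> j = \<xi> j}) ?I"
        unfolding disjoint_family_on_def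
      proof (intro ballI impI)
        fix \<xi> \<xi>' assume "\<xi> \<in> ?I" "\<xi>' \<in> ?I" "\<xi> \<noteq> \<xi>'"
        then obtain b where "b \<in> J" "\<xi> b \<noteq> \<xi>' b" using PiE_ext[of \<xi> J "\<lambda>_. S" \<xi>'] by blast
        then show "{\<omega>. \<forall>j\<in>J. cftp \<omega> j = \<xi> j} \<inter> {\<omega>. \<forall>j\<in>J. cftp \<omega> j = \<xi>' j} = {}" by force
      qed
    qed
    also have "\<dots> = (\<Sum>\<xi>\<in>?I. measure \<mu> {x \<in> space \<mu>. \<forall>j\<in>J. x j = \<xi> j})"
      by (simp add: prob_cftp[OF J] cyl_prob_def)
    also have "\<dots> = measure \<mu> {x \<in> space \<mu>. ?P x}"
      by (rule mu.split_sum[OF J, where T="\<lambda>x. x", symmetric])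
        (auto simp: mu.config_in intro: mu.cylinder_sets[OF J])
    also have "{x \<in> space \<mu>. ?P x} = ?E" by (auto simp: E mu.space_field)
    finally show "emeasure (distr Om (config_space (count_space S)) cftp) ?E = emeasure \<mu> ?E"
      using prob_space_distr[OF cftp_measurable]
      by (simp add: mu.emeasure_eq_measure finite_measure.emeasure_eq_measure prob_space.axioms)
  qed
qed

definition typical :: "'d field \<Rightarrow> bool" where
  "typical \<omega> \<longleftrightarrow> (\<forall>i. \<omega> i \<in> symbols)"

lemma AE_typical: "AE \<omega> in Om. typical \<omega>"
  unfolding typical_def
proof (subst AE_all_countable, rule allI)
  fix i
  have ev: "{\<omega>. \<omega> i \<in> symbols} \<in> sets Om"
    by (intro event_of_pred) measurable
  have "1 = prob {\<omega>. \<omega> i \<in> set_pmf (coord_law i)}"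
    by (simp add: prob_coord measure_pmf.prob_eq_1 AE_measure_pmf)
  also have "\<dots> \<le> prob {\<omega>. \<omega> i \<in> symbols}"
    by (rule finite_measure_mono[OF _ ev]) (auto simp: coord_law_def symbols_def split: if_splits)
  finally have "prob {\<omega>. \<omega> i \<in> symbols} = 1"
    using prob_le_1[of "{\<omega>. \<omega> i \<in> symbols}"] by linarith
  from AE_prob_1[OF this] show "AE \<omega> in Om. \<omega> i \<in> symbols" by simp
qed

lemma dec_Y: "typical \<omega> \<Longrightarrow> k < n0 + 2 \<Longrightarrow> dec (Y \<omega>) (v, k) = \<omega> (v, k)"
proof -
  assume t: "typical \<omega>" and k: "k < n0 + 2"
  have "enc \<omega> v \<in> T"
    unfolding enc_def T_def by (rule imageI) (use t in \<open>auto simp: typical_def\<close>)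
  then have "Y \<omega> v = to_nat (map (\<lambda>k. \<omega> (v, k)) [0..<n0 + 2])"
    by (simp add: Y_def enc_def)
  then show ?thesis using k by (simp add: dec_def del: upt_Suc add_2_eq_Suc')
qed

text \<open>On a good event no request that matters for the origin reads a filler symbol, so decoding does not
  change the output there. The same holds for every \<open>y\<close> that agrees with \<open>Y \<omega>\<close> near the origin.\<close>
lemma good_cftp:
  assumes t: "typical \<omega>" and g: "good N (readout \<omega>)"
    and y: "\<And>v. norm1 v \<le> int (radius N) \<Longrightarrow> y v = Y \<omega> v"
  shows "\<phi> y 0 = cftp (readout \<omega>) 0"
  unfolding \<phi>_def
proof (rule cftp_local[where N=N and l="window N"])
  fix v :: "'d lattice" and k
  assume v: "v \<in> ball1 0 (reach N (window N) + N + 1)" and k: "k \<le> Suc n0"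
  have "y v = Y \<omega> v" by (rule y) (use v in \<open>simp add: ball1_def radius_def\<close>)
  then have "dec y (v, k) = dec (Y \<omega>) (v, k)" by (simp add: dec_def)
  then show "\<omega> (v, k) = dec y (v, k)" using dec_Y[OF t, of k v] k by simp
next
  fix n and v :: "'d lattice" assume "n0 \<le> n" "n < N" and v: "v \<in> ball1 0 (reach N (window N))"
  then have "n \<in> {n0..<N}" by simp
  with g v obtain j where "j \<in> {..window N}" "hit n (readout \<omega>) v j"
    unfolding good_def by blast
  then show "\<exists>j\<le>window N. hit n (readout \<omega>) v j" by auto
next
  show "dead N (readout \<omega>) 0" using g by (simp add: good_def)
qed

lemma good_radius:
  assumes t: "typical \<omega>" and g: "good N (readout \<omega>)"
  shows "coding_radius \<nu> \<phi> (Y \<omega>) \<le> enat (radius N)"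
proof -
  have eq: "\<phi> y 0 = \<phi> (Y \<omega>) 0" if "\<forall>v. norm1 v \<le> int (radius N) \<longrightarrow> y v = Y \<omega> v" for y
  proof -
    have "\<phi> y 0 = cftp (readout \<omega>) 0" by (rule good_cftp[OF t g]) (use that in blast)
    moreover have "\<phi> (Y \<omega>) 0 = cftp (readout \<omega>) 0" by (rule good_cftp[OF t g]) (rule refl)
    ultimately show ?thesis by (rule trans[OF _ sym])
  qed
  have d: "determined_within \<nu> \<phi> (Y \<omega>) (radius N)"
    unfolding determined_within_def by (rule AE_I2) (use eq in blast)
  have "(LEAST r. determined_within \<nu> \<phi> (Y \<omega>) r) \<le> radius N"
    using d by (rule Least_le)
  then show ?thesis using d unfolding coding_radius_def by (subst if_P) auto
qed

lemma prob_not_good_readout: "prob {\<omega>. \<not> good N (readout \<omega>)} = prob {\<omega>. \<not> good N \<omega>}"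
  by (rule prob_readout) (intro pred_intros_logic pred_good)

lemma AE_good: "AE \<omega> in Om. \<exists>N. good N (readout \<omega>)"
proof -
  obtain A k b where b: "0 < b" "b < 1" "0 < A"
    and le: "\<And>N. prob {\<omega>. \<not> good N \<omega>} \<le> A * real (N + 1) ^ k * b ^ N"
    using prob_not_good by blast
  have gm: "Measurable.pred Om (\<lambda>\<omega>. good N (readout \<omega>))" for N
    by (rule measurable_compose[OF readout_measurable pred_good])
  have ev: "{\<omega>. \<exists>N. good N (readout \<omega>)} \<in> sets Om"
    by (intro event_of_pred pred_intros_countable gm)
  have "prob {\<omega>. \<not> (\<exists>N. good N (readout \<omega>))} \<le> A * real (N + 1) ^ k * b ^ N" for N
  proof -
    have "prob {\<omega>. \<not> (\<exists>N. good N (readout \<omega>))} \<le> prob {\<omega>. \<not> good N (readout \<omega>)}"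
      by (rule finite_measure_mono) (auto intro!: event_of_pred pred_intros_logic gm)
    then show ?thesis using le[of N] by (simp add: prob_not_good_readout)
  qed
  moreover have "(\<lambda>N. A * real (N + 1) ^ k * b ^ N) \<longlonglongrightarrow> 0"
    using b by real_asymp
  ultimately have "prob {\<omega>. \<not> (\<exists>N. good N (readout \<omega>))} \<le> 0"
    by (intro LIMSEQ_le_const) auto
  moreover have "prob {\<omega>. \<not> (\<exists>N. good N (readout \<omega>))} = 1 - prob {\<omega>. \<exists>N. good N (readout \<omega>)}"
    using prob_neg[of "\<lambda>\<omega>. \<exists>N. good N (readout \<omega>)"] ev by simp
  ultimately have "prob {\<omega>. \<exists>N. good N (readout \<omega>)} = 1"
    using prob_le_1[of "{\<omega>. \<exists>N. good N (readout \<omega>)}"] by linarith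
  from AE_prob_1[OF this] show ?thesis by simp
qed

lemma AE_\<phi>_Y: "AE \<omega> in Om. \<phi> (Y \<omega>) = cftp (readout \<omega>)"
proof -
  have "AE \<omega> in Om. \<phi> (Y \<omega>) v = cftp (readout \<omega>) v" for v
  proof -
    have "AE \<omega> in Om. \<exists>N. good N (readout (translate v \<omega>))"
    proof -
      have "AE \<omega> in distr Om Om (translate v). \<exists>N. good N (readout \<omega>)"
        unfolding translate_preserves by (rule AE_good)
      then show ?thesis by (rule AE_distrD[OF translate_measurable])
    qed
    then show ?thesis
      using AE_typical
    proof eventually_elim
      case (elim \<omega>)
      then have t: "typical (translate v \<omega>)" by (auto simp: typical_def translate_def)
      from elim obtain N where "good N (readout (translate v \<omega>))" by blast
      from good_cftp[OF t this, of "Y (translate v \<omega>)"]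
      have "\<phi> (shift v (Y \<omega>)) 0 = cftp (translate v (readout \<omega>)) 0"
        by (simp add: Y_translate readout_translate)
      moreover have "\<phi> (shift v (Y \<omega>)) 0 = \<phi> (Y \<omega>) v"
        unfolding \<phi>_shift by (simp add: shift_def)
      ultimately show ?case by (simp add: cftp_translate)
    qed
  qed
  then show ?thesis by (simp add: fun_eq_iff AE_all_countable)
qed

lemma distr_\<phi>: "distr \<nu> (config_space (count_space S)) \<phi> = \<mu>"
proof -
  have "distr \<nu> (config_space (count_space S)) \<phi> = distr Om (config_space (count_space S)) (\<lambda>\<omega>. \<phi> (Y \<omega>))"
    unfolding \<nu>_def by (subst distr_distr[OF \<phi>_measurable Y_measurable]) (simp add: comp_def)
  also have "\<dots> = distr Om (config_space (count_space S)) (\<lambda>\<omega>. cftp (readout \<omega>))"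
    by (rule distr_cong_AE)
      (use AE_\<phi>_Y cftp_readout_measurable measurable_compose[OF Y_measurable \<phi>_measurable] in auto)
  also have "\<dots> = distr (distr Om Om readout) (config_space (count_space S)) cftp"
    by (subst distr_distr[OF cftp_measurable readout_measurable]) (simp add: comp_def)
  also have "\<dots> = \<mu>" by (simp add: readout_preserves distr_cftp)
  finally show ?thesis .
qed

text \<open>Although it is defined by an almost-sure quantifier over a second configuration, this event depends
  on \<open>y\<close> only through finitely many coordinates and the output at the origin.\<close>
lemma determined_measurable: "Measurable.pred \<nu> (\<lambda>y. determined_within \<nu> \<phi> y r)"
proof -
  let ?B = "ball1 (0 :: 'd lattice) r"
  define Q where "Q \<eta> s \<longleftrightarrow> (AE y' in \<nu>. (\<forall>v\<in>?B. y' v = \<eta> v) \<longrightarrow> \<phi> y' 0 = s)" for \<eta> s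
  have eq: "determined_within \<nu> \<phi> y r = Q (restrict y ?B) (\<phi> y 0)" for y
    by (auto simp: determined_within_def Q_def ball1_def)
  have sets_nu: "sets \<nu> = sets (config_space (count_space T))" by (simp add: \<nu>_def)
  have "(\<lambda>y. restrict y ?B) \<in> measurable \<nu> (PiM ?B (\<lambda>_. count_space T))"
    unfolding measurable_cong_sets[OF sets_nu refl]
    by (rule measurable_restrict) (rule coord_measurable)
  also have "PiM ?B (\<lambda>_. count_space T) = count_space (PiE ?B (\<lambda>_. T))"
    by (rule count_space_PiM_finite) (auto intro: countable_finite finite_T)
  finally have r: "(\<lambda>y. restrict y ?B) \<in> measurable \<nu> (count_space (PiE ?B (\<lambda>_. T)))" .
  have "(\<lambda>y. \<phi> y 0) \<in> measurable \<nu> (count_space S)"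
    unfolding measurable_cong_sets[OF sets_nu refl]
    by (rule measurable_compose[OF \<phi>_measurable coord_measurable])
  then have "Measurable.pred \<nu> (\<lambda>y. Q \<eta> (\<phi> y 0))" for \<eta>
    by (rule measurable_compose) simp
  then show ?thesis unfolding eq
    by (rule measurable_compose_countable'[OF _ r])
      (auto intro!: countable_finite finite_PiE finite_T)
qed

lemma coding_radius_measurable: "(\<lambda>y. coding_radius \<nu> \<phi> y) \<in> measurable \<nu> (count_space UNIV)"
proof -
  note [measurable] = determined_measurable
  show ?thesis unfolding coding_radius_def by measurable
qed

lemma AE_radius_finite: "AE y in \<nu>. coding_radius \<nu> \<phi> y < \<infinity>"
proof -
  have "AE \<omega> in Om. coding_radius \<nu> \<phi> (Y \<omega>) < \<infinity>"
    using AE_good AE_typical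
  proof eventually_elim
    case (elim \<omega>)
    then obtain N where "coding_radius \<nu> \<phi> (Y \<omega>) \<le> enat (radius N)" using good_radius by blast
    then show ?case using enat_ord_code(4) order_le_less_trans by blast
  qed
  moreover have "{y \<in> space \<nu>. coding_radius \<nu> \<phi> y < \<infinity>} \<in> sets \<nu>"
    using measurable_sets[OF coding_radius_measurable, of "{..<\<infinity>}"]
    by (simp add: vimage_def Int_def conj_commute)
  ultimately show ?thesis
    unfolding \<nu>_def by (subst AE_distr_iff[OF Y_measurable]) (simp_all add: \<nu>_def)
qed

lemma prob_radius_ge:
  assumes "real (radius N) < r"
  shows "measure \<nu> {y \<in> space \<nu>. ennreal r \<le> ennreal_of_enat (coding_radius \<nu> \<phi> y)} \<le> prob {\<omega>. \<not> good N \<omega>}"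
proof -
  let ?R = "\<lambda>y. ennreal_of_enat (coding_radius \<nu> \<phi> y)"
  have "(\<lambda>y. ennreal r \<le> ?R y) \<in> measurable \<nu> (count_space UNIV)"
    by (rule measurable_compose[OF coding_radius_measurable]) simp
  then have ev: "{y \<in> space \<nu>. ennreal r \<le> ?R y} \<in> sets \<nu>" by (simp add: pred_def)
  then have "measure \<nu> {y \<in> space \<nu>. ennreal r \<le> ?R y} = prob {\<omega>. ennreal r \<le> ?R (Y \<omega>)}"
    using measurable_space[OF Y_measurable] unfolding \<nu>_def
    by (subst measure_distr[OF Y_measurable]) (auto intro!: arg_cong[where f=prob])
  also have "\<dots> \<le> prob {\<omega>. \<not> good N (readout \<omega>)}"
  proof (rule finite_measure_mono_AE)
    show "AE \<omega> in Om. \<omega> \<in> {\<omega>. ennreal r \<le> ?R (Y \<omega>)} \<longrightarrow> \<omega> \<in> {\<omega>. \<not> good N (readout \<omega>)}"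
      using AE_typical
    proof eventually_elim
      case (elim \<omega>)
      show ?case
      proof (clarify)
        assume r: "ennreal r \<le> ?R (Y \<omega>)" and "good N (readout \<omega>)"
        then have "coding_radius \<nu> \<phi> (Y \<omega>) \<le> enat (radius N)" using good_radius elim by blast
        then have "?R (Y \<omega>) \<le> ennreal_of_enat (enat (radius N))"
          by (simp only: ennreal_of_enat_le_iff)
        then have "ennreal r \<le> ennreal (real (radius N))"
          by (intro order_trans[OF r]) (simp add: ennreal_of_nat_eq_real_of_nat)
        then show False using assms by (simp add: ennreal_le_iff)
      qed
    qed
    have "Measurable.pred Om (\<lambda>\<omega>. good N (readout \<omega>))"
      by (rule measurable_compose[OF readout_measurable pred_good])
    then show "{\<omega>. \<not> good N (readout \<omega>)} \<in> sets Om"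
      by (intro event_of_pred pred_intros_logic)
  qed
  finally show ?thesis by (simp add: prob_not_good_readout)
qed

text \<open>With \<open>N\<close> of order \<open>r\<close> to the power \<open>1 / 9\<close> the radius for \<open>N\<close> stays below \<open>r\<close>, and the exponential
  bound in \<open>N\<close> beats every power. The slack between \<open>1 / 9\<close> and \<open>1 / 10\<close> absorbs all constants.\<close>
lemma stretched_tails: "stretched_exponential_tails \<nu> (\<lambda>y. ennreal_of_enat (coding_radius \<nu> \<phi> y))"
  unfolding stretched_exponential_tails_def
proof
  interpret nu: prob_space \<nu> by (rule prob_space_nu)
  show "(\<lambda>y. ennreal_of_enat (coding_radius \<nu> \<phi> y)) \<in> borel_measurable \<nu>"
    by (rule measurable_compose[OF coding_radius_measurable]) simp
  obtain A k b where b: "0 < b" "b < 1" "0 < A"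
    and le: "\<And>N. prob {\<omega>. \<not> good N \<omega>} \<le> A * real (N + 1) ^ k * b ^ N"
    using prob_not_good by blast
  define \<beta> where "\<beta> = - ln b"
  have \<beta>: "0 < \<beta>" "b = exp (- \<beta>)" using b by (auto simp: \<beta>_def ln_less_zero)
  \<comment> \<open>The constant of \<open>radius_le\<close> plus one, which makes the comparison with \<open>r\<close> strict.\<close>
  define t where "t r = (r / 367) powr (1 / 9)" for r :: real
  let ?p = "\<lambda>r. measure \<nu> {y \<in> space \<nu>. ennreal r \<le> ennreal_of_enat (coding_radius \<nu> \<phi> y)}"
  have 1: "?p r \<le> A * t r ^ k * exp (- \<beta> * (t r - 2))" if r: "1 \<le> t r" "0 < r" for r
  proof -
    define N where "N = nat \<lfloor>t r\<rfloor> - 1"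
    have N: "real (N + 1) \<le> t r" "t r - 2 \<le> real N" using r(1) unfolding N_def by linarith+
    have "real (radius N) \<le> real (366 * (N + 1) ^ 9)" by (rule of_nat_mono[OF radius_le])
    also have "\<dots> = 366 * real (N + 1) ^ 9" by simp
    also have "\<dots> \<le> 366 * t r ^ 9" using N by (intro mult_left_mono power_mono) auto
    also have "t r ^ 9 = r / 367" using r(2) by (simp add: t_def powr_power)
    also have "366 * (r / 367) < r" using r(2) by simp
    finally have "?p r \<le> A * real (N + 1) ^ k * b ^ N"
      using prob_radius_ge[of N r] le[of N] by linarith
    also have "b ^ N = exp (- \<beta> * real N)" by (simp add: \<beta>(2) exp_of_nat_mult[symmetric] mult.commute)
    also have "A * real (N + 1) ^ k * exp (- \<beta> * real N) \<le> A * t r ^ k * exp (- \<beta> * (t r - 2))"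
      using b \<beta> N by (intro mult_mono power_mono) auto
    finally show ?thesis .
  qed
  have "eventually (\<lambda>r. A * t r ^ k * exp (- \<beta> * (t r - 2)) \<le> exp (- (r powr (1 / 10)))) at_top"
    unfolding t_def using b \<beta>(1) by real_asymp
  moreover have "eventually (\<lambda>r. 1 \<le> t r) at_top" unfolding t_def by real_asymp
  ultimately have "eventually (\<lambda>r. 0 < r \<and> 1 \<le> t r \<and>
      A * t r ^ k * exp (- \<beta> * (t r - 2)) \<le> exp (- (r powr (1 / 10)))) at_top"
    using eventually_gt_at_top[of 0] by eventually_elim auto
  then obtain R where R: "\<And>r. R \<le> r \<Longrightarrow> 0 < r \<and> 1 \<le> t r \<and>
      A * t r ^ k * exp (- \<beta> * (t r - 2)) \<le> exp (- (r powr (1 / 10)))"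
    by (auto simp: eventually_at_top_linorder)
  define C where "C = exp (\<bar>R\<bar> powr (1 / 10))"
  have C: "1 \<le> C" by (simp add: C_def)
  have "?p r \<le> C * exp (- (r powr (1 / 10)))" if "0 \<le> r" for r
  proof (cases "R \<le> r")
    case True
    then have "?p r \<le> exp (- (r powr (1 / 10)))" using 1[of r] R[of r] by linarith
    also have "\<dots> \<le> C * exp (- (r powr (1 / 10)))" using C by simp
    finally show ?thesis .
  next
    case False
    then have "r powr (1 / 10) \<le> \<bar>R\<bar> powr (1 / 10)" using that by (intro powr_mono2) auto
    then have "1 \<le> C * exp (- (r powr (1 / 10)))" by (simp add: C_def exp_add[symmetric])
    then show ?thesis using nu.prob_le_1 order_trans by blast
  qed
  then show "\<exists>C c. 0 < C \<and> 0 < c \<and> (\<forall>r\<ge>0. ?p r \<le> C * exp (- (r powr c)))"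
    using C by (intro exI[of _ C] exI[of _ "1 / 10"]) auto
qed

theorem coding_exists:
  assumes "field_law (count_space S) \<mu>" "translation_invariant (count_space S) \<mu>"
  shows "finite T \<and> iid_law (count_space T) \<nu> \<and> coding (count_space T) \<nu> (count_space S) \<mu> \<phi> \<and>
    finitary \<nu> \<phi> \<and> stretched_exponential_tails \<nu> (\<lambda>y. ennreal_of_enat (coding_radius \<nu> \<phi> y))"
  using assms finite_T iid_nu field_law_nu translation_invariant_nu \<phi>_measurable \<phi>_shift distr_\<phi>
    AE_radius_finite stretched_tails
  by (simp add: coding_def finitary_def)

end

section \<open>Conditional probabilities of a Markov random field\<close>

lemma finite_pmf_exists:
  fixes f :: "'x \<Rightarrow> real"
  assumes "finite A" "\<And>x. x \<in> A \<Longrightarrow> 0 \<le> f x" "sum f A = 1"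
  obtains q where "\<And>x. pmf q x = (if x \<in> A then f x else 0)"
proof -
  define g where "g x = (if x \<in> A then f x else 0)" for x
  have "(\<integral>\<^sup>+x. ennreal (g x) \<partial>count_space UNIV) = (\<Sum>x\<in>A. ennreal (g x))"
    by (rule nn_integral_count_space') (use assms(1) in \<open>auto simp: g_def\<close>)
  also have "\<dots> = ennreal (\<Sum>x\<in>A. g x)"
    by (rule sum_ennreal) (use assms(2) in \<open>auto simp: g_def\<close>)
  also have "(\<Sum>x\<in>A. g x) = 1" using assms(3) by (simp add: g_def)
  finally have 1: "(\<integral>\<^sup>+x. ennreal (g x) \<partial>count_space UNIV) = 1" by simp
  have "pmf (embed_pmf g) x = g x" for x
    by (rule pmf_embed_pmf[OF _ 1]) (use assms(2) in \<open>simp add: g_def\<close>)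
  then show ?thesis using that[of "embed_pmf g"] by (simp add: g_def)
qed

text \<open>The residual law is \<open>(p - \<gamma>) / (1 - sum \<gamma> S)\<close>. If the denominator vanishes, \<open>p\<close> and \<open>\<gamma>\<close> coincide and every law will do.\<close>
lemma residual_pmf_exists:
  fixes p \<gamma> :: "'a \<Rightarrow> real"
  assumes S: "finite S" and p: "sum p S = 1" and \<gamma>: "\<And>s. s \<in> S \<Longrightarrow> 0 \<le> \<gamma> s" "\<And>s. s \<in> S \<Longrightarrow> \<gamma> s \<le> p s"
  shows "\<exists>r. set_pmf r \<subseteq> S \<and> (\<forall>s\<in>S. p s = \<gamma> s + (1 - sum \<gamma> S) * pmf r s)"
proof -
  let ?g = "sum \<gamma> S"
  have g: "?g \<le> 1" using sum_mono[of S \<gamma> p] \<gamma>(2) p by simp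
  show ?thesis
  proof (cases "?g = 1")
    case True
    obtain r where r: "\<And>x. pmf r x = (if x \<in> S then p x else 0)"
      by (rule finite_pmf_exists[OF S _ p]) (use \<gamma> in \<open>auto intro: order_trans\<close>)
    have "(\<Sum>s\<in>S. p s - \<gamma> s) = 0" using p True by (simp add: sum_subtractf)
    then have "p s = \<gamma> s" if "s \<in> S" for s
      using that \<gamma>(2) S by (subst (asm) sum_nonneg_eq_0_iff) auto
    then show ?thesis using r True by (intro exI[of _ r]) (auto simp: set_pmf_eq)
  next
    case False
    with g have g1: "0 < 1 - ?g" by simp
    have "(\<Sum>s\<in>S. (p s - \<gamma> s) / (1 - ?g)) = 1"
      using g1 p by (simp add: sum_divide_distrib[symmetric] sum_subtractf)
    then obtain r where r: "\<And>x. pmf r x = (if x \<in> S then (p x - \<gamma> x) / (1 - ?g) else 0)"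
      using finite_pmf_exists[OF S, of "\<lambda>s. (p s - \<gamma> s) / (1 - ?g)"] \<gamma>(2) g1 by auto
    show ?thesis using r g1 by (intro exI[of _ r]) (auto simp: set_pmf_eq)
  qed
qed

text \<open>Draw either a spin, with probabilities \<open>\<gamma>\<close>, or nothing; independently, draw a spin from the residual law for each
  \<open>\<xi>\<close>. The update returns the former if there is one and the latter otherwise. Only finitely many outcomes
  have positive probability, so they can be numbered.\<close>
lemma oblivious_update_exists:
  fixes p :: "'x \<Rightarrow> 'a \<Rightarrow> real" and \<gamma> :: "'a \<Rightarrow> real"
  assumes S: "finite S" and X: "finite X" and s0: "s0 \<in> S"
    and p: "\<And>\<xi>. \<xi> \<in> X \<Longrightarrow> sum (p \<xi>) S = 1"
    and \<gamma>: "\<And>s. s \<in> S \<Longrightarrow> 0 \<le> \<gamma> s" "\<And>\<xi> s. \<xi> \<in> X \<Longrightarrow> s \<in> S \<Longrightarrow> \<gamma> s \<le> p \<xi> s" "sum \<gamma> S \<le> 1"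
  obtains update_law :: "nat pmf" and upd :: "nat \<Rightarrow> 'x \<Rightarrow> 'a" and obl :: "nat \<Rightarrow> bool" where
    "finite (set_pmf update_law)" "\<And>k \<xi>. upd k \<xi> \<in> S" "\<And>k \<xi> \<xi>'. obl k \<Longrightarrow> upd k \<xi> = upd k \<xi>'"
    "\<And>\<xi> s. \<xi> \<in> X \<Longrightarrow> s \<in> S \<Longrightarrow> measure (measure_pmf update_law) {k. upd k \<xi> = s} = p \<xi> s"
    "measure (measure_pmf update_law) {k. \<not> obl k} = 1 - sum \<gamma> S"
proof -
  let ?A = "insert None (Some ` S)"
  define f where "f = (\<lambda>o'. case o' of None \<Rightarrow> 1 - sum \<gamma> S | Some s \<Rightarrow> \<gamma> s)"
  have "sum f ?A = 1"
    using S by (subst sum.insert) (auto simp: f_def sum.reindex)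
  moreover have "0 \<le> f x" if "x \<in> ?A" for x using that \<gamma> by (auto simp: f_def)
  ultimately obtain q where q: "\<And>x. pmf q x = (if x \<in> ?A then f x else 0)"
    using finite_pmf_exists[of ?A f] S by auto
  have "\<forall>\<xi>\<in>X. \<exists>r. set_pmf r \<subseteq> S \<and> (\<forall>s\<in>S. p \<xi> s = \<gamma> s + (1 - sum \<gamma> S) * pmf r s)"
    using residual_pmf_exists[OF S p \<gamma>(1) \<gamma>(2)] by blast
  then obtain r where r: "\<And>\<xi>. \<xi> \<in> X \<Longrightarrow> set_pmf (r \<xi>) \<subseteq> S"
    "\<And>\<xi> s. \<xi> \<in> X \<Longrightarrow> s \<in> S \<Longrightarrow> p \<xi> s = \<gamma> s + (1 - sum \<gamma> S) * pmf (r \<xi>) s"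
    by metis
  define P where "P = Pi_pmf X s0 r"
  define law where "law = pair_pmf q P"
  define val where "val a \<xi> = (case fst a of None \<Rightarrow> snd a \<xi> | Some s \<Rightarrow> s)" for a :: "'a option \<times> ('x \<Rightarrow> 'a)" and \<xi>
  define h where "h = to_nat_on (set_pmf law)"
  define dec where "dec = from_nat_into (set_pmf law)"
  define update_law where "update_law = map_pmf h law"
  define upd where "upd k \<xi> = (if val (dec k) \<xi> \<in> S then val (dec k) \<xi> else s0)" for k \<xi>
  define obl where "obl k \<longleftrightarrow> fst (dec k) \<noteq> None" for k
  have setq: "set_pmf q \<subseteq> ?A" using q by (auto simp: set_pmf_eq)
  have fq: "finite (set_pmf q)" using finite_subset[OF setq] S by simp
  have setP: "set_pmf P = PiE_dflt X s0 (set_pmf \<circ> r)"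
    unfolding P_def by (rule set_Pi_pmf[OF X])
  have fP: "finite (set_pmf P)"
    unfolding setP
    by (rule finite_PiE_dflt) (use X S r(1) in \<open>auto intro: finite_subset\<close>)
  have dec_h: "dec (h a) = a" if "a \<in> set_pmf law" for a
    unfolding dec_def h_def using that by (intro from_nat_into_to_nat_on) auto
  have val_in: "val a \<xi> \<in> S" if "a \<in> set_pmf law" "\<xi> \<in> X" for a \<xi>
    using that setq r(1)[of \<xi>] unfolding law_def val_def
    by (auto simp: setP PiE_dflt_def split: option.split)
  have law_eq: "measure (measure_pmf update_law) {k. Q k} = measure (measure_pmf law) {a. R a}"
    if "\<And>a. a \<in> set_pmf law \<Longrightarrow> Q (h a) = R a" for Q R
    unfolding update_law_def measure_map_pmf vimage_def mem_Collect_eq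
    by (rule measure_pmf.finite_measure_eq_AE) (auto simp: AE_measure_pmf_iff that)
  have map_val: "map_pmf (\<lambda>a. val a \<xi>) law = bind_pmf q (\<lambda>o'. case o' of None \<Rightarrow> r \<xi> | Some s \<Rightarrow> return_pmf s)"
    if "\<xi> \<in> X" for \<xi>
  proof -
    have "map_pmf (\<lambda>f. f \<xi>) P = r \<xi>" using Pi_pmf_component[OF X, of \<xi> s0 r] that by (simp add: P_def)
    then have "map_pmf (\<lambda>y. val (o', y) \<xi>) P = (case o' of None \<Rightarrow> r \<xi> | Some s \<Rightarrow> return_pmf s)" for o'
      by (cases o') (simp_all add: val_def map_pmf_const)
    moreover have "law = bind_pmf q (\<lambda>o'. map_pmf (Pair o') P)"
      by (simp add: law_def pair_pmf_def map_pmf_def)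
    ultimately show ?thesis by (simp add: map_bind_pmf pmf.map_comp o_def)
  qed
  show ?thesis
  proof (rule that[of update_law upd obl])
    show "finite (set_pmf update_law)" using fq fP by (simp add: update_law_def law_def)
    show "upd k \<xi> \<in> S" for k \<xi> using s0 by (simp add: upd_def)
    show "upd k \<xi> = upd k \<xi>'" if "obl k" for k \<xi> \<xi>'
      using that by (auto simp: upd_def obl_def val_def)
    show "measure (measure_pmf update_law) {k. upd k \<xi> = s} = p \<xi> s" if \<xi>: "\<xi> \<in> X" and s: "s \<in> S" for \<xi> s
    proof -
      have "measure (measure_pmf update_law) {k. upd k \<xi> = s} = measure (measure_pmf law) {a. val a \<xi> = s}"
        by (rule law_eq) (use \<xi> val_in in \<open>simp add: upd_def dec_h\<close>)
      also have "\<dots> = pmf (map_pmf (\<lambda>a. val a \<xi>) law) s" by (simp add: pmf_map vimage_def)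
      also have "\<dots> = measure_pmf.expectation q (\<lambda>o'. pmf (case o' of None \<Rightarrow> r \<xi> | Some t \<Rightarrow> return_pmf t) s)"
        by (simp add: map_val[OF \<xi>] pmf_bind)
      also have "\<dots> = (\<Sum>o'\<in>?A. pmf q o' * pmf (case o' of None \<Rightarrow> r \<xi> | Some t \<Rightarrow> return_pmf t) s)"
        by (subst integral_measure_pmf[of ?A]) (use S setq in auto)
      also have "\<dots> = (1 - sum \<gamma> S) * pmf (r \<xi>) s + (\<Sum>t\<in>S. \<gamma> t * pmf (return_pmf t) s)"
        using S by (subst sum.insert) (auto simp: q f_def sum.reindex intro!: sum.cong)
      also have "(\<Sum>t\<in>S. \<gamma> t * pmf (return_pmf t) s) = (\<Sum>t\<in>S. if t = s then \<gamma> s else 0)"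
        by (rule sum.cong) auto
      also have "\<dots> = \<gamma> s" using S s by simp
      finally show ?thesis using r(2)[OF \<xi> s] by simp
    qed
    have "measure (measure_pmf update_law) {k. \<not> obl k} = measure (measure_pmf law) {a. fst a = None}"
      by (rule law_eq) (simp add: obl_def dec_h)
    also have "\<dots> = pmf (map_pmf fst law) None" by (simp add: pmf_map vimage_def)
    also have "\<dots> = 1 - sum \<gamma> S" by (simp add: law_def map_fst_pair_pmf q f_def)
    finally show "measure (measure_pmf update_law) {k. \<not> obl k} = 1 - sum \<gamma> S" .
  qed
qed

lemma bdry_singleton: "bdry {v} = nbhd v"
  by (auto simp: bdry_def nbhd_def adjacent_def)

locale markov_field = spin_field S \<mu>
  for S :: "'a set" and \<mu> :: "('d::finite lattice \<Rightarrow> 'a) measure" +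
  assumes markov: "markov_random_field S \<mu>"
begin

lemma space_config: "space (config_space (count_space S)) = space \<mu>"
  using sets_eq_imp_space_eq[OF sets_field] by (simp add: config_space_def)

lemma restrict_measurable: "(\<lambda>x. restrict x A) \<in> measurable \<mu> (PiM A (\<lambda>_. count_space S))"
  unfolding measurable_cong_sets[OF sets_field refl]
  by (rule measurable_restrict) (rule measurable_component_singleton, simp)

lemma sets_restr: "sets (restr_algebra (count_space S) A) =
    {(\<lambda>x. restrict x A) -` E \<inter> space \<mu> | E. E \<in> sets (PiM A (\<lambda>_. count_space S))}"
  unfolding restr_algebra_def space_config
  by (rule sets_vimage_algebra2) (use measurable_space[OF restrict_measurable] in auto)

lemma subalgebra_restr: "subalgebra \<mu> (restr_algebra (count_space S) A)"
  unfolding subalgebra_def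
proof
  show "space (restr_algebra (count_space S) A) = space \<mu>"
    by (simp add: restr_algebra_def space_config)
  show "sets (restr_algebra (count_space S) A) \<subseteq> sets \<mu>"
    using measurable_sets[OF restrict_measurable] by (auto simp: sets_restr)
qed

lemma cylinder_restr:
  assumes B: "finite B" "B \<subseteq> A"
  shows "{x \<in> space \<mu>. \<forall>b\<in>B. x b = \<eta> b} \<in> sets (restr_algebra (count_space S) A)"
proof -
  let ?M = "PiM A (\<lambda>_. count_space S)"
  let ?E = "{y \<in> space ?M. \<forall>b\<in>B. y b = \<eta> b}"
  have "{y \<in> space ?M. y b = \<eta> b} \<in> sets ?M" if "b \<in> B" for b
  proof -
    have "(\<lambda>y. y b) \<in> measurable ?M (count_space S)"
      by (rule measurable_component_singleton) (use that B in auto)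
    from measurable_sets[OF this, of "{\<eta> b} \<inter> S"]
    have "(\<lambda>y. y b) -` ({\<eta> b} \<inter> S) \<inter> space ?M \<in> sets ?M" by auto
    also have "(\<lambda>y. y b) -` ({\<eta> b} \<inter> S) \<inter> space ?M = {y \<in> space ?M. y b = \<eta> b}"
      using that B by (auto simp: space_PiM PiE_iff extensional_def)
    finally show ?thesis .
  qed
  then have "?E \<in> sets ?M" using B(1) by (intro sets.sets_Collect_finite_All)
  moreover have "{x \<in> space \<mu>. \<forall>b\<in>B. x b = \<eta> b} = (\<lambda>x. restrict x A) -` ?E \<inter> space \<mu>"
    using B(2) measurable_space[OF restrict_measurable] by (auto simp: subset_eq)
  ultimately show ?thesis unfolding sets_restr by blast
qed

lemma restr_measurable_const:
  fixes g :: "('d lattice \<Rightarrow> 'a) \<Rightarrow> real"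
  assumes "g \<in> borel_measurable (restr_algebra (count_space S) A)"
    and "x \<in> space \<mu>" "y \<in> space \<mu>" "\<And>a. a \<in> A \<Longrightarrow> x a = y a"
  shows "g x = g y"
proof -
  have sp: "space (restr_algebra (count_space S) A) = space \<mu>"
    using subalgebra_restr by (simp add: subalgebra_def)
  have "g -` {g x} \<inter> space \<mu> \<in> sets (restr_algebra (count_space S) A)"
    using measurable_sets[OF assms(1), of "{g x}"] by (simp add: sp)
  then obtain E where E: "g -` {g x} \<inter> space \<mu> = (\<lambda>x. restrict x A) -` E \<inter> space \<mu>"
    unfolding sets_restr by blast
  have xy: "restrict x A = restrict y A" using assms(4) by (simp add: restrict_def fun_eq_iff)
  have "x \<in> g -` {g x} \<inter> space \<mu>" using assms(2) by simp
  then have "restrict x A \<in> E" unfolding E by (rule IntD1[THEN vimageD])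
  then have "y \<in> (\<lambda>x. restrict x A) -` E \<inter> space \<mu>" using assms(3) by (simp add: xy)
  then have "y \<in> g -` {g x}" unfolding E[symmetric] by (rule IntD1)
  then show ?thesis by simp
qed

text \<open>The Markov property without conditional expectations: integrating the conditional expectation given
  \<open>- {v}\<close>, which is a function of the spins around \<open>v\<close>, over a cylinder multiplies the probability of
  the cylinder by a constant \<open>c\<close> that depends on the spins around \<open>v\<close> only. The same constant occurs for
  the base \<open>B\<close> and for the base \<open>nbhd v\<close>.\<close>
lemma conditional_product:
  assumes B: "finite B" "v \<notin> B" "nbhd v \<subseteq> B"
  shows "prob {x \<in> space \<mu>. x v = s \<and> (\<forall>b\<in>B. x b = \<eta> b)} * prob {x \<in> space \<mu>. \<forall>b\<in>nbhd v. x b = \<eta> b} =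
    prob {x \<in> space \<mu>. x v = s \<and> (\<forall>b\<in>nbhd v. x b = \<eta> b)} * prob {x \<in> space \<mu>. \<forall>b\<in>B. x b = \<eta> b}"
proof (cases "s \<in> S")
  case False
  then have e: "{x \<in> space \<mu>. x v = s \<and> P x} = {}" for P by (auto simp: space_field)
  show ?thesis unfolding e[of "\<lambda>x. \<forall>b\<in>B. x b = \<eta> b"] e[of "\<lambda>x. \<forall>b\<in>nbhd v. x b = \<eta> b"] by simp
next
  case True
  define F1 where "F1 = restr_algebra (count_space S) (- {v})"
  define F2 where "F2 = restr_algebra (count_space S) (nbhd v)"
  define D where "D = {x \<in> space \<mu>. restrict x {v} = (\<lambda>_\<in>{v}. s)}"
  define g where "g = real_cond_exp \<mu> F2 (indicator D)"
  have D_eq: "D = {x \<in> space \<mu>. \<forall>b\<in>{v}. x b = s}"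
    by (auto simp: D_def restrict_def fun_eq_iff)
  have D: "D \<in> sets \<mu>" unfolding D_eq by (rule cylinder_sets) simp
  interpret F1: finite_measure_subalgebra \<mu> F1
    by unfold_locales (simp add: F1_def subalgebra_restr)
  interpret F2: finite_measure_subalgebra \<mu> F2
    by unfold_locales (simp add: F2_def subalgebra_restr)
  have AE_eq: "AE x in \<mu>. real_cond_exp \<mu> F1 (indicator D) x = g x"
  proof -
    have "(\<lambda>_\<in>{v}. s) \<in> {v} \<rightarrow>\<^sub>E S" using True by auto
    moreover have "finite {v}" by simp
    ultimately show ?thesis
      using markov[unfolded markov_random_field_def, THEN conjunct2, rule_format, of "{v}" "\<lambda>_\<in>{v}. s"]
      unfolding F1_def F2_def g_def D_def bdry_singleton[symmetric] by (simp only:)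
  qed
  have gm: "g \<in> borel_measurable F2" unfolding g_def by (rule borel_measurable_cond_exp)
  have int: "prob (C \<inter> D) = (\<integral>x\<in>C. g x \<partial>\<mu>)" if C: "C \<in> sets F1" for C
  proof -
    have C': "C \<in> sets \<mu>" using C F1.subalg by (auto simp: subalgebra_def)
    have "(\<integral>x\<in>C. indicator D x \<partial>\<mu>) = (\<integral>x\<in>C. real_cond_exp \<mu> F1 (indicator D) x \<partial>\<mu>)"
      by (rule F1.real_cond_exp_intA[OF _ C]) (use D in \<open>simp add: emeasure_eq_measure\<close>)
    also have "\<dots> = (\<integral>x\<in>C. g x \<partial>\<mu>)"
      unfolding set_lebesgue_integral_def
    proof (rule integral_cong_AE)
      show "(\<lambda>x. indicat_real C x *\<^sub>R g x) \<in> borel_measurable \<mu>"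
        unfolding g_def using C' by simp
    qed (use AE_eq C' in auto)
    also have "(\<integral>x\<in>C. indicator D x \<partial>\<mu>) = (\<integral>x. indicat_real (C \<inter> D) x \<partial>\<mu>)"
      unfolding set_lebesgue_integral_def
      by (rule Bochner_Integration.integral_cong) (auto simp: indicator_def)
    also have "\<dots> = prob (C \<inter> D)" using C' D by simp
    finally show ?thesis .
  qed
  have main: "\<exists>c. \<forall>B. finite B \<and> v \<notin> B \<and> nbhd v \<subseteq> B \<longrightarrow>
      prob {x \<in> space \<mu>. x v = s \<and> (\<forall>b\<in>B. x b = \<eta> b)} = c * prob {x \<in> space \<mu>. \<forall>b\<in>B. x b = \<eta> b}"
  proof -
    \<comment> \<open>The constant is the value of \<open>g\<close> at any configuration that agrees with \<open>\<eta>\<close> around \<open>v\<close>.\<close>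
    define x0 where "x0 = (SOME x. x \<in> space \<mu> \<and> (\<forall>b\<in>nbhd v. x b = \<eta> b))"
    show ?thesis
    proof (intro exI[of _ "g x0"] allI impI)
      fix B assume B: "finite B \<and> v \<notin> B \<and> nbhd v \<subseteq> B"
      let ?C = "{x \<in> space \<mu>. \<forall>b\<in>B. x b = \<eta> b}"
      have const: "g x = g x0" if "x \<in> ?C" for x
      proof -
        have "\<exists>x. x \<in> space \<mu> \<and> (\<forall>b\<in>nbhd v. x b = \<eta> b)" using that B by auto
        then have x0: "x0 \<in> space \<mu> \<and> (\<forall>b\<in>nbhd v. x0 b = \<eta> b)" unfolding x0_def by (rule someI_ex)
        show ?thesis
          by (rule restr_measurable_const[OF gm[unfolded F2_def]]) (use x0 that B in auto)
      qed
      have C: "?C \<in> sets F1" unfolding F1_def by (rule cylinder_restr) (use B in auto)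
      have C': "?C \<in> sets \<mu>" by (rule cylinder_sets) (use B in auto)
      have "{x \<in> space \<mu>. x v = s \<and> (\<forall>b\<in>B. x b = \<eta> b)} = ?C \<inter> D" by (auto simp: D_eq)
      then have "prob {x \<in> space \<mu>. x v = s \<and> (\<forall>b\<in>B. x b = \<eta> b)} = (\<integral>x\<in>?C. g x \<partial>\<mu>)"
        using int[OF C] by simp
      also have "\<dots> = (\<integral>x. indicat_real ?C x * g x0 \<partial>\<mu>)"
        unfolding set_lebesgue_integral_def
        by (rule Bochner_Integration.integral_cong) (use const in \<open>auto simp: indicator_def\<close>)
      also have "\<dots> = g x0 * prob ?C" using C' by simp
      finally show "prob {x \<in> space \<mu>. x v = s \<and> (\<forall>b\<in>B. x b = \<eta> b)} = g x0 * prob ?C" .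
    qed
  qed
  then obtain c where c: "\<And>B. finite B \<Longrightarrow> v \<notin> B \<Longrightarrow> nbhd v \<subseteq> B \<Longrightarrow>
      prob {x \<in> space \<mu>. x v = s \<and> (\<forall>b\<in>B. x b = \<eta> b)} = c * prob {x \<in> space \<mu>. \<forall>b\<in>B. x b = \<eta> b}"
    by blast
  have "finite (nbhd v)" "v \<notin> nbhd v" using B finite_subset by auto
  then show ?thesis using c[of "nbhd v"] c[OF B] by simp
qed

lemma prob_cylinder_shift:
  assumes ti: "translation_invariant (count_space S) \<mu>" and B: "finite B"
  shows "prob {x \<in> space \<mu>. \<forall>b\<in>(\<lambda>b. b + v) ` B. x b = \<eta> b} = prob {x \<in> space \<mu>. \<forall>b\<in>B. x b = \<eta> (b + v)}"
proof -
  let ?E = "{x \<in> space \<mu>. \<forall>b\<in>B. x b = \<eta> (b + v)}"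
  have sets_eq: "sets \<mu> = sets (config_space (count_space S))"
    using sets_field by (simp add: config_space_def)
  have m: "shift v \<in> measurable \<mu> (config_space (count_space S))"
    unfolding measurable_cong_sets[OF sets_eq refl] by (rule shift_measurable)
  have E: "?E \<in> sets (config_space (count_space S))"
    unfolding sets_eq[symmetric] by (rule cylinder_sets[OF B])
  have "distr \<mu> (config_space (count_space S)) (shift v) = \<mu>"
    using ti unfolding translation_invariant_def by (rule spec)
  then have "prob ?E = measure (distr \<mu> (config_space (count_space S)) (shift v)) ?E" by (simp only:)
  also have "\<dots> = prob (shift v -` ?E \<inter> space \<mu>)" by (rule measure_distr[OF m E])
  also have "shift v -` ?E \<inter> space \<mu> = {x \<in> space \<mu>. \<forall>b\<in>(\<lambda>b. b + v) ` B. x b = \<eta> b}"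
    unfolding space_field by (auto simp: shift_def)
  finally show ?thesis ..
qed

definition origin_prob :: "('d lattice \<Rightarrow> 'a) \<Rightarrow> real" where
  "origin_prob \<xi> = prob {x \<in> space \<mu>. restrict x nb0 = \<xi>}"

definition spin_kernel :: "('d lattice \<Rightarrow> 'a) \<Rightarrow> 'a \<Rightarrow> real" where
  "spin_kernel \<xi> s = cond_prob \<mu> (\<lambda>x. x 0 = s) (\<lambda>x. restrict x nb0 = \<xi>)"

definition patterns :: "('d lattice \<Rightarrow> 'a) set" where
  "patterns = {\<xi> \<in> nb0 \<rightarrow>\<^sub>E S. 0 < origin_prob \<xi>}"

lemma restrict_eq_iff:
  assumes "\<xi> \<in> extensional A"
  shows "restrict x A = \<xi> \<longleftrightarrow> (\<forall>a\<in>A. x a = \<xi> a)"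
proof
  assume "\<forall>a\<in>A. x a = \<xi> a"
  then show "restrict x A = \<xi>"
    by (intro extensionalityI[OF restrict_extensional assms]) simp
next
  assume e: "restrict x A = \<xi>"
  show "\<forall>a\<in>A. x a = \<xi> a" unfolding e[symmetric] by simp
qed

lemma nbhd_shift: "nbhd v = (\<lambda>b. b + v) ` nb0"
  unfolding nbhd_eq[of v] by (rule image_cong[OF refl]) (rule add.commute)

text \<open>By translation invariance the constant of \<open>conditional_product\<close> is the conditional probability
  at the origin, provided that the spins around \<open>v\<close> have positive probability.\<close>
lemma kernel_heat_bath:
  assumes ti: "translation_invariant (count_space S) \<mu>"
    and B: "finite B" "v \<notin> B" "\<And>z. z \<in> nb0 \<Longrightarrow> v + z \<in> B"
    and pos: "0 < prob {x \<in> space \<mu>. \<forall>b\<in>B. x b = \<eta> b}"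
  shows "(\<lambda>z\<in>nb0. \<eta> (v + z)) \<in> patterns"
    and "prob {x \<in> space \<mu>. x v = s \<and> (\<forall>b\<in>B. x b = \<eta> b)} =
      spin_kernel (\<lambda>z\<in>nb0. \<eta> (v + z)) s * prob {x \<in> space \<mu>. \<forall>b\<in>B. x b = \<eta> b}"
proof -
  define \<xi> where "\<xi> = (\<lambda>z\<in>nb0. \<eta> (v + z))"
  define \<zeta> where "\<zeta> b = (if b = v then s else \<eta> b)" for b
  have ext: "\<xi> \<in> extensional nb0" unfolding \<xi>_def by (rule restrict_extensional)
  have app: "\<xi> b = \<eta> (b + v)" if "b \<in> nb0" for b
    using that unfolding \<xi>_def by (simp only: restrict_apply' add.commute)
  have sub: "nbhd v \<subseteq> B" unfolding nbhd_eq[of v] using B(3) by blast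
  have v: "v \<notin> nbhd v" using B(2) sub by blast
  obtain y where y: "y \<in> space \<mu>" "\<forall>b\<in>B. y b = \<eta> b"
  proof (rule ccontr)
    assume "\<not> thesis"
    with that have e: "{x \<in> space \<mu>. \<forall>b\<in>B. x b = \<eta> b} = {}" by blast
    show False using pos unfolding e by simp
  qed
  have \<xi>S: "\<xi> \<in> nb0 \<rightarrow>\<^sub>E S"
  proof (rule PiE_I)
    fix z :: "'d lattice" assume z: "z \<in> nb0"
    then have "\<xi> z = y (v + z)" using y(2) B(3)[OF z] by (simp add: \<xi>_def)
    then show "\<xi> z \<in> S" using y(1) by (simp add: space_field)
  next
    fix z :: "'d lattice" assume "z \<notin> nb0"
    then show "\<xi> z = undefined" by (simp add: \<xi>_def)
  qed
  have o1: "origin_prob \<xi> = prob {x \<in> space \<mu>. \<forall>b\<in>nbhd v. x b = \<eta> b}"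
  proof -
    have "origin_prob \<xi> = prob {x \<in> space \<mu>. \<forall>b\<in>nb0. x b = \<eta> (b + v)}"
      unfolding origin_prob_def restrict_eq_iff[OF ext] by (simp only: app cong: ball_cong)
    then show ?thesis unfolding nbhd_shift[of v] by (simp only: prob_cylinder_shift[OF ti finite_nb0])
  qed
  have "prob {x \<in> space \<mu>. \<forall>b\<in>B. x b = \<eta> b} \<le> prob {x \<in> space \<mu>. \<forall>b\<in>nbhd v. x b = \<eta> b}"
    by (rule finite_measure_mono) (use sub in blast, rule cylinder_sets[OF finite_subset[OF sub B(1)]])
  then have o2: "0 < origin_prob \<xi>" using pos unfolding o1 by linarith
  with \<xi>S show "(\<lambda>z\<in>nb0. \<eta> (v + z)) \<in> patterns" unfolding \<xi>_def[symmetric] by (simp add: patterns_def)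
  have "spin_kernel \<xi> s * origin_prob \<xi> = prob {x \<in> space \<mu>. x 0 = s \<and> restrict x nb0 = \<xi>}"
    using o2 by (simp add: spin_kernel_def cond_prob_def origin_prob_def)
  also have "{x \<in> space \<mu>. x 0 = s \<and> restrict x nb0 = \<xi>} = {x \<in> space \<mu>. \<forall>b\<in>insert 0 nb0. x b = \<zeta> (b + v)}"
  proof (rule Collect_cong, rule conj_cong[OF refl])
    fix x :: "'d lattice \<Rightarrow> 'a"
    have "\<zeta> (b + v) = \<xi> b" if "b \<in> nb0" for b
    proof -
      have "b + v \<noteq> v" using that by (auto simp: nb0_iff)
      then show ?thesis using app[OF that] by (simp add: \<zeta>_def)
    qed
    moreover have "\<zeta> (0 + v) = s" by (simp add: \<zeta>_def)
    ultimately show "(x 0 = s \<and> restrict x nb0 = \<xi>) = (\<forall>b\<in>insert 0 nb0. x b = \<zeta> (b + v))"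
      unfolding restrict_eq_iff[OF ext] by auto
  qed
  also have "prob \<dots> = prob {x \<in> space \<mu>. \<forall>b\<in>(\<lambda>b. b + v) ` insert 0 nb0. x b = \<zeta> b}"
    by (rule prob_cylinder_shift[OF ti, symmetric]) simp
  also have "(\<lambda>b. b + v) ` insert 0 nb0 = insert v (nbhd v)" unfolding nbhd_shift[of v] by simp
  also have "{x \<in> space \<mu>. \<forall>b\<in>insert v (nbhd v). x b = \<zeta> b} = {x \<in> space \<mu>. x v = s \<and> (\<forall>b\<in>nbhd v. x b = \<eta> b)}"
  proof (rule Collect_cong, rule conj_cong[OF refl])
    fix x :: "'d lattice \<Rightarrow> 'a"
    have "\<zeta> b = \<eta> b" if "b \<in> nbhd v" for b using that v by (auto simp: \<zeta>_def)
    moreover have "\<zeta> v = s" by (simp add: \<zeta>_def)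
    ultimately show "(\<forall>b\<in>insert v (nbhd v). x b = \<zeta> b) = (x v = s \<and> (\<forall>b\<in>nbhd v. x b = \<eta> b))"
      by auto
  qed
  finally have k: "spin_kernel \<xi> s * origin_prob \<xi> = prob {x \<in> space \<mu>. x v = s \<and> (\<forall>b\<in>nbhd v. x b = \<eta> b)}" .
  have "prob {x \<in> space \<mu>. x v = s \<and> (\<forall>b\<in>B. x b = \<eta> b)} * origin_prob \<xi> =
      spin_kernel \<xi> s * origin_prob \<xi> * prob {x \<in> space \<mu>. \<forall>b\<in>B. x b = \<eta> b}"
    unfolding k unfolding o1 by (rule conditional_product[OF B(1,2) sub])
  then show "prob {x \<in> space \<mu>. x v = s \<and> (\<forall>b\<in>B. x b = \<eta> b)} =
      spin_kernel (\<lambda>z\<in>nb0. \<eta> (v + z)) s * prob {x \<in> space \<mu>. \<forall>b\<in>B. x b = \<eta> b}"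
    using o2 unfolding \<xi>_def[symmetric] by simp
qed

lemma finite_patterns: "finite patterns"
  by (rule finite_subset[OF _ finite_PiE[of nb0 "\<lambda>_. S"]]) (auto simp: patterns_def finite_spins)

lemma restrict_nb0_sets: "\<xi> \<in> extensional nb0 \<Longrightarrow> {x \<in> space \<mu>. restrict x nb0 = \<xi>} \<in> sets \<mu>"
  by (subst restrict_eq_iff) (auto intro: cylinder_sets)

lemma patterns_nonempty: "patterns \<noteq> {}"
proof
  assume e: "patterns = {}"
  let ?P = "(nb0 :: 'd lattice set) \<rightarrow>\<^sub>E S"
  have fin: "finite ?P" by (rule finite_PiE) (auto simp: finite_spins)
  have "space \<mu> = (\<Union>\<xi>\<in>?P. {x \<in> space \<mu>. restrict x nb0 = \<xi>})"
    by (auto simp: space_field)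
  then have "prob (space \<mu>) = prob (\<Union>\<xi>\<in>?P. {x \<in> space \<mu>. restrict x nb0 = \<xi>})" by simp
  also have "\<dots> \<le> (\<Sum>\<xi>\<in>?P. origin_prob \<xi>)"
    unfolding origin_prob_def
    by (rule finite_measure_subadditive_finite[OF fin]) (auto intro!: restrict_nb0_sets simp: PiE_iff)
  also have "\<dots> = 0"
  proof (rule sum.neutral, rule ballI)
    fix \<xi> assume "\<xi> \<in> ?P"
    then have "\<not> 0 < origin_prob \<xi>" using e by (auto simp: patterns_def)
    then show "origin_prob \<xi> = 0" by (simp add: origin_prob_def zero_less_measure_iff)
  qed
  finally show False using prob_space by simp
qed

lemma sum_kernel: "\<xi> \<in> patterns \<Longrightarrow> sum (spin_kernel \<xi>) S = 1"
proof -
  assume \<xi>: "\<xi> \<in> patterns"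
  then have ext: "\<xi> \<in> extensional nb0" and pos: "0 < origin_prob \<xi>" by (auto simp: patterns_def PiE_iff)
  have eq: "{x \<in> space \<mu>. x 0 = s \<and> restrict x nb0 = \<xi>} =
      {x \<in> space \<mu>. \<forall>b\<in>{0}. x b = s} \<inter> {x \<in> space \<mu>. restrict x nb0 = \<xi>}" for s by auto
  have ev: "{x \<in> space \<mu>. x 0 = s \<and> restrict x nb0 = \<xi>} \<in> sets \<mu>" for s
    unfolding eq by (intro sets.Int cylinder_sets restrict_nb0_sets ext) simp
  have "(\<Sum>s\<in>S. prob {x \<in> space \<mu>. x 0 = s \<and> restrict x nb0 = \<xi>}) =
      prob (\<Union>s\<in>S. {x \<in> space \<mu>. x 0 = s \<and> restrict x nb0 = \<xi>})"
    by (rule finite_measure_finite_Union[symmetric])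
      (use ev finite_spins in \<open>auto simp: disjoint_family_on_def\<close>)
  also have "(\<Union>s\<in>S. {x \<in> space \<mu>. x 0 = s \<and> restrict x nb0 = \<xi>}) = {x \<in> space \<mu>. restrict x nb0 = \<xi>}"
    by (auto simp: space_field)
  also have "prob {x \<in> space \<mu>. restrict x nb0 = \<xi>} = origin_prob \<xi>" unfolding origin_prob_def ..
  finally have total: "(\<Sum>s\<in>S. prob {x \<in> space \<mu>. x 0 = s \<and> restrict x nb0 = \<xi>}) = origin_prob \<xi>" .
  have "spin_kernel \<xi> s = prob {x \<in> space \<mu>. x 0 = s \<and> restrict x nb0 = \<xi>} / origin_prob \<xi>" for s
    unfolding spin_kernel_def cond_prob_def origin_prob_def ..
  then have "sum (spin_kernel \<xi>) S = (\<Sum>s\<in>S. prob {x \<in> space \<mu>. x 0 = s \<and> restrict x nb0 = \<xi>}) / origin_prob \<xi>"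
    unfolding sum_divide_distrib by (intro sum.cong refl)
  then show ?thesis using pos unfolding total by simp
qed

lemma kernel_nonneg: "0 \<le> spin_kernel \<xi> s"
  by (simp add: spin_kernel_def cond_prob_def)

lemma min_cond_prob_eq: "min_cond_prob S \<mu> s = (INF \<xi>\<in>patterns. spin_kernel \<xi> s)"
  by (simp add: min_cond_prob_def patterns_def spin_kernel_def origin_prob_def)

lemma min_cond_prob_nonneg: "0 \<le> min_cond_prob S \<mu> s"
  unfolding min_cond_prob_eq by (rule cINF_greatest[OF patterns_nonempty kernel_nonneg])

lemma min_cond_prob_le: "\<xi> \<in> patterns \<Longrightarrow> min_cond_prob S \<mu> s \<le> spin_kernel \<xi> s"
  unfolding min_cond_prob_eq by (rule cINF_lower) (auto intro: bdd_belowI2 kernel_nonneg)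

lemma spins_nonempty: "S \<noteq> {}"
  using not_empty by (auto simp: space_field)

end

theorem theorem1p9:
  fixes S :: "'a set" and \<mu> :: "('d::finite lattice \<Rightarrow> 'a) measure"
  assumes "finite S"
    and "translation_invariant (count_space S) \<mu>"
    and "markov_random_field S \<mu>"
    and "high_noise S \<mu>"
  shows "\<exists>(T :: nat set) (\<nu> :: ('d lattice \<Rightarrow> nat) measure) \<phi>.
           finite T \<and>
           iid_law (count_space T) \<nu> \<and>
           coding (count_space T) \<nu> (count_space S) \<mu> \<phi> \<and>
           finitary \<nu> \<phi> \<and>
           stretched_exponential_tails \<nu> (\<lambda>y. ennreal_of_enat (coding_radius \<nu> \<phi> y))"
proof -
  interpret mf: markov_field S \<mu>
    unfolding markov_field_def markov_field_axioms_def spin_field_def spin_field_axioms_def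
    using assms(1,3) by (simp add: markov_random_field_def field_law_def config_space_def)
  obtain s0 where s0: "s0 \<in> S" using mf.spins_nonempty by blast
  let ?\<gamma> = "min_cond_prob S \<mu>"
  obtain \<xi>0 where "\<xi>0 \<in> mf.patterns" using mf.patterns_nonempty by blast
  then have g1: "sum ?\<gamma> S \<le> 1"
    using sum_mono[of S ?\<gamma> "mf.spin_kernel \<xi>0"] mf.min_cond_prob_le mf.sum_kernel by fastforce
  obtain update_law :: "nat pmf" and upd :: "nat \<Rightarrow> ('d lattice \<Rightarrow> 'a) \<Rightarrow> 'a" and obl where
    u: "finite (set_pmf update_law)" "\<And>k \<xi>. upd k \<xi> \<in> S"
      "\<And>k \<xi> \<xi>'. obl k \<Longrightarrow> upd k \<xi> = upd k \<xi>'"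
      "\<And>\<xi> s. \<xi> \<in> mf.patterns \<Longrightarrow> s \<in> S \<Longrightarrow> measure (measure_pmf update_law) {k. upd k \<xi> = s} = mf.spin_kernel \<xi> s"
      "measure (measure_pmf update_law) {k. \<not> obl k} = 1 - sum ?\<gamma> S"
  proof (rule oblivious_update_exists[where S=S and X=mf.patterns and p=mf.spin_kernel and \<gamma>="?\<gamma>"])
    show "?\<gamma> s \<le> mf.spin_kernel \<xi> s" if "\<xi> \<in> mf.patterns" "s \<in> S" for \<xi> s
      by (rule mf.min_cond_prob_le[OF that(1)])
    fix update_law :: "nat pmf" and upd :: "nat \<Rightarrow> ('d lattice \<Rightarrow> 'a) \<Rightarrow> 'a" and obl
    assume "finite (set_pmf update_law)" "\<And>k \<xi>. upd k \<xi> \<in> S"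
      "\<And>k \<xi> \<xi>'. obl k \<Longrightarrow> upd k \<xi> = upd k \<xi>'"
      "\<And>\<xi> s. \<xi> \<in> mf.patterns \<Longrightarrow> s \<in> S \<Longrightarrow> measure (measure_pmf update_law) {k. upd k \<xi> = s} = mf.spin_kernel \<xi> s"
      "measure (measure_pmf update_law) {k. \<not> obl k} = 1 - sum ?\<gamma> S"
    then show thesis by (rule that)
  qed (rule assms(1) mf.finite_patterns s0 g1 mf.min_cond_prob_nonneg | rule mf.sum_kernel, assumption)+
  define letter_law :: "(bool \<times> nat) pmf" where "letter_law = map_pmf (\<lambda>a. (False, a)) (pmf_of_set {0, 1, 2})"
  define c where "c = card (nb0 :: 'd lattice set)"
  define \<rho> where "\<rho> = 1 - (1 / 2) ^ Suc c * (1 - real c * (1 - sum ?\<gamma> S))"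
  \<comment> \<open>Here the high-noise condition enters.\<close>
  have "real c * (1 - sum ?\<gamma> S) < 1"
  proof -
    have h: "1 - sum ?\<gamma> S < 1 / (2 * real CARD('d))" using assms(4) by (simp add: high_noise_def)
    have "real c \<le> 2 * real CARD('d)" using card_nb0[where 'd='d] by (simp add: c_def)
    then have "real c * (1 - sum ?\<gamma> S) \<le> 2 * real CARD('d) * (1 - sum ?\<gamma> S)"
      using g1 by (intro mult_right_mono) auto
    also have "\<dots> < 2 * real CARD('d) * (1 / (2 * real CARD('d)))"
      using h by (intro mult_strict_left_mono) auto
    finally show ?thesis by simp
  qed
  moreover have "0 \<le> real c * (1 - sum ?\<gamma> S)" using g1 by simp
  ultimately have f: "0 < 1 - real c * (1 - sum ?\<gamma> S)" "1 - real c * (1 - sum ?\<gamma> S) \<le> 1" by auto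
  have "(1 / 2 :: real) ^ Suc c \<le> 1 / 2" using power_le_one[of "1 / 2 :: real" c] by simp
  then have "(1 / 2) ^ Suc c * (1 - real c * (1 - sum ?\<gamma> S)) \<le> 1 / 2 * 1"
    using f by (intro mult_mono) auto
  then have \<rho>: "0 < \<rho>" "\<rho> < 1" using f by (auto simp: \<rho>_def)
  have "(\<lambda>n. real (1 + c) * \<rho> ^ n * (6 * real (n + 1) ^ 3)) \<longlonglongrightarrow> 0"
    using \<rho> by real_asymp
  then have "eventually (\<lambda>n. real (1 + c) * \<rho> ^ n * (6 * real (n + 1) ^ 3) < 1) sequentially"
    by (rule order_tendstoD) simp
  then obtain n0 where n0: "\<And>n. n0 \<le> n \<Longrightarrow> real (1 + c) * \<rho> ^ n * (6 * real (n + 1) ^ 3) < 1"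
    by (auto simp: eventually_sequentially)
  interpret coding_dynamics upd obl S s0 n0 letter_law update_law \<rho> \<mu>
  proof unfold_locales
    show "measure (measure_pmf letter_law) {s. snd s = a} = 1 / 3" if "a \<le> 2" for a
    proof -
      have "{0, 1, 2} \<inter> {a} = {a}" using that by auto
      then show ?thesis by (simp add: letter_law_def measure_pmf_of_set vimage_def)
    qed
    show "real (1 + card (nb0 :: 'd lattice set)) * \<rho> ^ n \<le> 1 / (6 * real (n + 1) ^ 3)" if "n0 \<le> n" for n
      using n0[OF that] unfolding c_def by (subst pos_le_divide_eq) auto
    fix B :: "'d lattice set" and v s and \<eta> :: "'d lattice \<Rightarrow> 'a"
    assume B: "finite B" "v \<notin> B" "\<And>z. z \<in> nb0 \<Longrightarrow> v + z \<in> B"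
    let ?C = "{x \<in> space \<mu>. \<forall>b\<in>B. x b = \<eta> b}"
    let ?E = "{x \<in> space \<mu>. x v = s \<and> (\<forall>b\<in>B. x b = \<eta> b)}"
    show "measure \<mu> ?E = measure (measure_pmf update_law) {k. upd k (\<lambda>z\<in>nb0. \<eta> (v + z)) = s} * measure \<mu> ?C"
    proof (cases "0 < measure \<mu> ?C \<and> s \<in> S")
      case True
      then show ?thesis
        using mf.kernel_heat_bath[OF assms(2) B, of \<eta>] u(4) by simp
    next
      case False
      then consider "measure \<mu> ?C = 0" | "s \<notin> S" by (auto simp: zero_less_measure_iff)
      then show ?thesis
      proof cases
        case 1
        have "measure \<mu> ?E \<le> measure \<mu> ?C"
          by (rule mf.finite_measure_mono) (auto intro: mf.cylinder_sets B)
        then show ?thesis using 1 measure_nonneg[of \<mu> ?E] by simp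
      next
        case 2
        then have e: "?E = {}" "{k. upd k (\<lambda>z\<in>nb0. \<eta> (v + z)) = s} = {}"
          using u(2) by (auto simp: mf.space_field)
        show ?thesis unfolding e by simp
      qed
    qed
  qed (use u s0 \<rho> in \<open>auto simp: letter_law_def \<rho>_def c_def\<close>)
  have "field_law (count_space S) \<mu>" using assms(3) by (simp add: markov_random_field_def)
  from coding_exists[OF this assms(2)] show ?thesis by blast
qed

end
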